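(* Let $n\ge1$, $N\ge2$, let $\phi$ be a strictly local communication kernel of range $r_0>0$ on $\mathbb{R}^n$ and let $U$ be a confining radial potential on $\mathbb{R}^n$ (both as defined in the context). Consider $$\dot x_i=v_i,\qquad \dot v_i=\frac1N\sum_{j=1}^N\phi(x_i-x_j)(v_j-v_i)-\nabla U(x_i),\qquad i=1,\dots,N,$$ with initial data $(\mathbf{x}_0,\mathbf{v}_0)\in\mathbb{R}^{nN}\times\mathbb{R}^{nN}$, and let $$\mathcal{H}=\{(\mathbf{x}_0,\mathbf{v}_0)\in\mathbb{R}^{nN}\times\mathbb{R}^{nN}:\ |x_i(t)-x_j(t)|\ge r_0\ \ \forall i\neq j,\ \forall t\ge0\}.$$ Then for Lebesgue-almost every $(\mathbf{x}_0,\mathbf{v}_0)\in(\mathbb{R}^{nN}\times\mathbb{R}^{nN})\setminus\mathcal{H}$, $$\int_0^\infty\sum_{i\neq j}\phi(x_i(s)-x_j(s))\,ds=\infty .$$ In particular, this holds for almost every initial datum for which $|x_i^0-x_j^0|<r_0$ for at least one pair $i\neq j$.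
   Context: $\mathbf{x}=(x_1,\dots,x_N)$, $\mathbf{v}=(v_1,\dots,v_N)$ with $x_i,v_i\in\mathbb{R}^n$; $(\mathbf{x}(t),\mathbf{v}(t))$ denotes the solution with initial datum $(\mathbf{x}_0,\mathbf{v}_0)$, and $x_i^0=x_i(0)$. A strictly local communication kernel of range $r_0>0$ on $\mathbb{R}^n$ is a $C^1$ function $\phi:\mathbb{R}^n\to[0,\infty)$ that is a non-increasing function of $|x|$, with $\phi(x)>0$ for $|x|<r_0$ and $\phi(x)=0$ for $|x|\ge r_0$. A confining radial potential is a function $U=U(|x|)$, $U\in W^{2,\infty}_{\mathrm{loc}}(\mathbb{R}^n)$ (so that $\nabla U$ is locally Lipschitz), with $U(r)\to\infty$ as $r\to\infty$. *)

theory Defs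
  imports "HOL-Analysis.Analysis"
begin

section \<open>Function spaces on a Euclidean space\<close>

text \<open>\<open>Ck k f\<close>: all iterated partial derivatives of \<open>f\<close> up to order \<open>k\<close> exist and are continuous on
  the whole space. For \<open>k \<ge> 1\<close> continuity of the lower-order derivatives follows from
  differentiability.\<close>

primrec Ck :: "nat \<Rightarrow> ('a::euclidean_space \<Rightarrow> real) \<Rightarrow> bool" where
  "Ck 0 f \<longleftrightarrow> continuous_on UNIV f"
| "Ck (Suc k) f \<longleftrightarrow>
     (\<forall>x. f differentiable (at x)) \<and>
     (\<forall>b\<in>Basis. Ck k (\<lambda>x. frechet_derivative f (at x) b))"

definition test_function :: "('a::euclidean_space \<Rightarrow> real) \<Rightarrow> bool" where
  "test_function \<psi> \<longleftrightarrow> (\<forall>k. Ck k \<psi>) \<and> compact (closure {x. \<psi> x \<noteq> 0})"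

definition Linf_loc :: "('a::euclidean_space \<Rightarrow> real) \<Rightarrow> bool" where
  "Linf_loc f \<longleftrightarrow>
     f \<in> borel_measurable lebesgue \<and>
     (\<forall>K. compact K \<longrightarrow> (\<exists>C. AE x in lebesgue. x \<in> K \<longrightarrow> \<bar>f x\<bar> \<le> C))"

definition weak_partial_deriv ::
    "'a \<Rightarrow> ('a::euclidean_space \<Rightarrow> real) \<Rightarrow> ('a \<Rightarrow> real) \<Rightarrow> bool" where
  "weak_partial_deriv b f g \<longleftrightarrow>
     (\<forall>\<psi>. test_function \<psi> \<longrightarrow>
        (\<integral>x. f x * frechet_derivative \<psi> (at x) b \<partial>lebesgue) = - (\<integral>x. g x * \<psi> x \<partial>lebesgue))"

text \<open>The local Sobolev space \<open>W\<^sup>k\<^sup>,\<^sup>\<infinity>\<close>: all weak derivatives up to order \<open>k\<close> exist and are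
  locally essentially bounded.\<close>

primrec Wkinf_loc :: "nat \<Rightarrow> ('a::euclidean_space \<Rightarrow> real) \<Rightarrow> bool" where
  "Wkinf_loc 0 f \<longleftrightarrow> Linf_loc f"
| "Wkinf_loc (Suc k) f \<longleftrightarrow>
     Linf_loc f \<and> (\<forall>b\<in>Basis. \<exists>g. weak_partial_deriv b f g \<and> Wkinf_loc k g)"

definition grad :: "('a::euclidean_space \<Rightarrow> real) \<Rightarrow> 'a \<Rightarrow> 'a" where
  "grad f x = (THE D. GDERIV f x :> D)"

section \<open>Communication kernels and confining potentials\<close>

definition strictly_local_kernel :: "real \<Rightarrow> ('a::euclidean_space \<Rightarrow> real) \<Rightarrow> bool" where
  "strictly_local_kernel r\<^sub>0 \<phi> \<longleftrightarrow>
     0 < r\<^sub>0 \<and> Ck 1 \<phi> \<and> (\<forall>x. 0 \<le> \<phi> x) \<and>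
     (\<forall>x y. norm x \<le> norm y \<longrightarrow> \<phi> y \<le> \<phi> x) \<and>
     (\<forall>x. norm x < r\<^sub>0 \<longrightarrow> 0 < \<phi> x) \<and>
     (\<forall>x. r\<^sub>0 \<le> norm x \<longrightarrow> \<phi> x = 0)"

text \<open>An element of the Sobolev space is a class of functions modulo null sets. Continuity of \<open>U\<close>
  selects its continuous representative, which is continuously differentiable with locally
  Lipschitz gradient, so that \<open>grad U\<close> is defined at every point.\<close>

definition confining_radial_potential :: "('a::euclidean_space \<Rightarrow> real) \<Rightarrow> bool" where
  "confining_radial_potential U \<longleftrightarrow>
     continuous_on UNIV U \<and> Wkinf_loc 2 U \<and>
     (\<exists>u. (\<forall>x. U x = u (norm x)) \<and> filterlim u at_top at_top)"

section \<open>The particle system\<close>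

text \<open>The type \<open>'N\<close> indexes the agents, so a configuration \<open>(x\<^sub>1, \<dots>, x\<^sub>N)\<close> is an element of
  \<open>(real^'n)^'N\<close>; phase space consists of pairs
  (positions, velocities).\<close>

type_synonym ('n, 'N) phase = "((real^'n)^'N) \<times> ((real^'n)^'N)"

definition is_solution ::
    "(real^'n \<Rightarrow> real) \<Rightarrow> (real^'n \<Rightarrow> real) \<Rightarrow> ('n, 'N::finite) phase
      \<Rightarrow> (real \<Rightarrow> ('n, 'N::finite) phase) \<Rightarrow> bool" where
  "is_solution \<phi> U z\<^sub>0 z \<longleftrightarrow>
     z 0 = z\<^sub>0 \<and>
     (\<forall>t\<ge>0. \<forall>i.
        ((\<lambda>s. fst (z s) $ i) has_vector_derivative snd (z t) $ i) (at t within {0..}) \<and>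
        ((\<lambda>s. snd (z s) $ i) has_vector_derivative
            (1 / real CARD('N)) *\<^sub>R
              (\<Sum>j\<in>UNIV. \<phi> (fst (z t) $ i - fst (z t) $ j) *\<^sub>R (snd (z t) $ j - snd (z t) $ i))
            - grad U (fst (z t) $ i)) (at t within {0..}))"

text \<open>The choice is immaterial: for the kernels and potentials above, a solution exists on
  \<open>[0, \<infinity>)\<close> and its values there are unique. Nothing is said about negative times.\<close>

definition solution ::
    "(real^'n \<Rightarrow> real) \<Rightarrow> (real^'n \<Rightarrow> real) \<Rightarrow> ('n, 'N::finite) phase
      \<Rightarrow> real \<Rightarrow> ('n, 'N::finite) phase" where
  "solution \<phi> U z\<^sub>0 = (SOME z. is_solution \<phi> U z\<^sub>0 z)"

abbreviation pos ::
    "(real^'n \<Rightarrow> real) \<Rightarrow> (real^'n \<Rightarrow> real) \<Rightarrow> ('n, 'N::finite) phase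
      \<Rightarrow> 'N \<Rightarrow> real \<Rightarrow> real^'n" where
  "pos \<phi> U z\<^sub>0 i t \<equiv> fst (solution \<phi> U z\<^sub>0 t) $ i"

definition noninteracting_data ::
    "real \<Rightarrow> (real^'n \<Rightarrow> real) \<Rightarrow> (real^'n \<Rightarrow> real) \<Rightarrow> ('n, 'N::finite) phase set" where
  "noninteracting_data r\<^sub>0 \<phi> U =
     {z\<^sub>0. \<forall>i j. i \<noteq> j \<longrightarrow> (\<forall>t\<ge>0. r\<^sub>0 \<le> norm (pos \<phi> U z\<^sub>0 i t - pos \<phi> U z\<^sub>0 j t))}"

definition total_communication ::
    "(real^'n \<Rightarrow> real) \<Rightarrow> (real^'n \<Rightarrow> real) \<Rightarrow> ('n, 'N::finite) phase \<Rightarrow> ennreal" where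
  "total_communication \<phi> U z\<^sub>0 =
     (\<integral>\<^sup>+ s\<in>{0..}. ennreal (\<Sum>(i, j)\<in>{(i, j). i \<noteq> j}. \<phi> (pos \<phi> U z\<^sub>0 i s - pos \<phi> U z\<^sub>0 j s))
        \<partial>lborel)"

end

theory Submission
  imports Defs
begin

text \<open>The total energy decreases, so trajectories stay in compact sets, and the only term of the
  field with nonzero divergence is the alignment term, whose divergence is proportional to
  \<open>\<rho> = \<Sum> \<phi>(x\<^sub>i - x\<^sub>j)\<close>. Hence on data whose total communication is at most \<open>M\<close> the flow shrinks
  volume by at most a factor \<open>exp (- C M)\<close>, at all times, and a Poincare recurrence argument applies:
  if the data with total communication at most \<open>M\<close> and \<open>\<rho> \<ge> \<delta>\<close> at some time \<open>q\<close> had positive volume,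
  some of them would return often enough, each time adding a fixed amount, to exceed \<open>M\<close>.
  Since \<open>\<nabla>U\<close> is only Lipschitz, the volume estimate is proved for a splitting scheme, whose steps
  are shears and a near-identity linear map of the velocities, and then passed to the limit.\<close>

section \<open>Locally Lipschitz functions\<close>

text \<open>With a merely Lipschitz force the flow is not known to be differentiable in the data, so
  Liouville's formula for its Jacobian is not directly available. The device that replaces it is an
  additional coordinate that grows at least as fast as alignment can contract velocities. The claim
  then becomes that volume does not decrease, and a lower bound of this kind survives uniform
  limits, because the volume of compact sets is upper semicontinuous. This is why all volumes are
  taken of compact sets, whose continuous images are again compact. Solutions are given for
  nonnegative times only and volume is not preserved, so the classical recurrence theorem cannot be
  quoted. Its substitute is a count of overlaps among the images of a set at integer times, all of
  which lie in one energy sublevel. It needs injectivity of the flow, obtained from a Gronwall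
  estimate run backwards. Two facts that the statement takes for granted are established as well:
  the energy prevents blow-up, so that \<open>solution\<close> is a solution, and mollification
  recovers a locally Lipschitz \<open>grad U\<close> from the weak derivatives.\<close>

definition llip :: "('a::real_normed_vector \<Rightarrow> 'b::real_normed_vector) \<Rightarrow> bool" where
  "llip f \<longleftrightarrow> (\<forall>R. \<exists>L\<ge>0. \<forall>x\<in>cball 0 R. \<forall>y\<in>cball 0 R. norm (f x - f y) \<le> L * norm (x - y))"

lemma llipE:
  assumes "llip f"
  obtains L where "L \<ge> 0"
    "\<And>x y. norm x \<le> R \<Longrightarrow> norm y \<le> R \<Longrightarrow> norm (f x - f y) \<le> L * norm (x - y)"
  using assms unfolding llip_def by (metis mem_cball_0)

lemma llipI:
  assumes "\<And>R. R \<ge> 0 \<Longrightarrow> \<exists>L\<ge>0. \<forall>x y. norm x \<le> R \<longrightarrow> norm y \<le> R \<longrightarrow> norm (f x - f y) \<le> L * norm (x - y)"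
  shows "llip f"
  unfolding llip_def
proof (intro allI)
  fix R :: real
  show "\<exists>L\<ge>0. \<forall>x\<in>cball 0 R. \<forall>y\<in>cball 0 R. norm (f x - f y) \<le> L * norm (x - y)"
  proof (cases "R \<ge> 0")
    case True
    then show ?thesis using assms[of R] by (simp add: Ball_def)
  next
    case False
    then show ?thesis by (intro exI[of _ 0]) auto
  qed
qed

lemma llip_bounded:
  assumes "llip f"
  obtains B where "B \<ge> 0" "\<And>x. norm x \<le> R \<Longrightarrow> norm (f x) \<le> B"
proof -
  obtain L where L: "L \<ge> 0" "\<And>x y. norm x \<le> \<bar>R\<bar> \<Longrightarrow> norm y \<le> \<bar>R\<bar> \<Longrightarrow> norm (f x - f y) \<le> L * norm (x - y)"
    using llipE[OF assms, of "\<bar>R\<bar>"] by auto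
  show ?thesis
  proof (rule that[of "norm (f 0) + L * \<bar>R\<bar>"])
    show "norm (f 0) + L * \<bar>R\<bar> \<ge> 0" using L by simp
    fix x :: 'a assume x: "norm x \<le> R"
    have "norm (f x) \<le> norm (f 0) + norm (f x - f 0)" by (metis add.commute diff_add_cancel norm_triangle_ineq)
    also have "norm (f x - f 0) \<le> L * norm (x - 0)" using x by (intro L) auto
    also have "\<dots> \<le> L * \<bar>R\<bar>" using x L by (auto intro!: mult_left_mono)
    finally show "norm (f x) \<le> norm (f 0) + L * \<bar>R\<bar>" by simp
  qed
qed

lemma llip_continuous:
  assumes "llip f"
  shows "continuous_on S f"
proof -
  have "continuous (at x) f" for x
  proof -
    obtain L where L: "L \<ge> 0" "\<And>u v. norm u \<le> norm x + 1 \<Longrightarrow> norm v \<le> norm x + 1 \<Longrightarrow> norm (f u - f v) \<le> L * norm (u - v)"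
      using llipE[OF assms] by metis
    have "continuous_on (ball x 1) f"
    proof (rule lipschitz_on_continuous_on)
      have n: "norm u \<le> norm x + 1" if "u \<in> ball x 1" for u
        using that norm_triangle_ineq2[of u x] by (simp add: dist_norm norm_minus_commute)
      show "L-lipschitz_on (ball x 1) f"
        using n L by (intro lipschitz_onI) (auto simp: dist_norm)
    qed
    then show ?thesis by (simp add: continuous_on_eq_continuous_at)
  qed
  then show ?thesis by (simp add: continuous_at_imp_continuous_on)
qed

lemma llip_const: "llip (\<lambda>x. c)"
  by (rule llipI) (auto intro!: exI[of _ 0])

lemma llip_bounded_linear:
  assumes "bounded_linear f"
  shows "llip f"
proof (rule llipI)
  interpret bounded_linear f by fact
  obtain K where K: "K > 0" "\<And>x. norm (f x) \<le> norm x * K" using pos_bounded by blast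
  show "\<exists>L\<ge>0. \<forall>x y. norm x \<le> R \<longrightarrow> norm y \<le> R \<longrightarrow> norm (f x - f y) \<le> L * norm (x - y)" for R
    using K by (intro exI[of _ K]) (auto simp: diff[symmetric] mult.commute)
qed

lemma llip_add:
  assumes "llip f" "llip g"
  shows "llip (\<lambda>x. f x + g x)"
proof (rule llipI)
  fix R :: real
  obtain L where L: "L \<ge> 0" "\<And>x y. norm x \<le> R \<Longrightarrow> norm y \<le> R \<Longrightarrow> norm (f x - f y) \<le> L * norm (x - y)"
    using llipE[OF assms(1)] by metis
  obtain M where M: "M \<ge> 0" "\<And>x y. norm x \<le> R \<Longrightarrow> norm y \<le> R \<Longrightarrow> norm (g x - g y) \<le> M * norm (x - y)"
    using llipE[OF assms(2)] by metis
  show "\<exists>L\<ge>0. \<forall>x y. norm x \<le> R \<longrightarrow> norm y \<le> R \<longrightarrow> norm (f x + g x - (f y + g y)) \<le> L * norm (x - y)"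
  proof (intro exI[of _ "L + M"] conjI allI impI)
    fix x y :: 'a assume xy: "norm x \<le> R" "norm y \<le> R"
    have "norm (f x + g x - (f y + g y)) \<le> norm (f x - f y) + norm (g x - g y)"
      using norm_triangle_ineq[of "f x - f y" "g x - g y"] by (simp add: algebra_simps)
    then show "norm (f x + g x - (f y + g y)) \<le> (L + M) * norm (x - y)"
      using L(2)[OF xy] M(2)[OF xy] by (simp add: algebra_simps)
  qed (use L M in auto)
qed

lemma llip_bilinear:
  fixes f :: "'d::real_normed_vector \<Rightarrow> 'a::real_normed_vector"
    and g :: "'d \<Rightarrow> 'b::real_normed_vector"
    and p :: "'a \<Rightarrow> 'b \<Rightarrow> 'c::real_normed_vector"
  assumes "bounded_bilinear p" "llip f" "llip g"
  shows "llip (\<lambda>x. p (f x) (g x))"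
proof (rule llipI)
  interpret bounded_bilinear p by fact
  fix R :: real
  obtain K where K: "K > 0" "\<And>a b. norm (p a b) \<le> norm a * norm b * K" using pos_bounded by blast
  obtain L where L: "L \<ge> 0" "\<And>x y. norm x \<le> R \<Longrightarrow> norm y \<le> R \<Longrightarrow> norm (f x - f y) \<le> L * norm (x - y)"
    using llipE[OF assms(2)] by metis
  obtain M where M: "M \<ge> 0" "\<And>x y. norm x \<le> R \<Longrightarrow> norm y \<le> R \<Longrightarrow> norm (g x - g y) \<le> M * norm (x - y)"
    using llipE[OF assms(3)] by metis
  obtain B where B: "B \<ge> 0" "\<And>x. norm x \<le> R \<Longrightarrow> norm (f x) \<le> B" using llip_bounded[OF assms(2)] by metis
  obtain C where C: "C \<ge> 0" "\<And>x. norm x \<le> R \<Longrightarrow> norm (g x) \<le> C" using llip_bounded[OF assms(3)] by metis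
  show "\<exists>L\<ge>0. \<forall>x y. norm x \<le> R \<longrightarrow> norm y \<le> R \<longrightarrow> norm (p (f x) (g x) - p (f y) (g y)) \<le> L * norm (x - y)"
  proof (intro exI[of _ "L * C * K + B * M * K"] conjI allI impI)
    fix x y :: 'd assume xy: "norm x \<le> R" "norm y \<le> R"
    have "p (f x) (g x) - p (f y) (g y) = p (f x - f y) (g x) + p (f y) (g x - g y)"
      by (simp add: diff_left diff_right)
    then have "norm (p (f x) (g x) - p (f y) (g y)) \<le> norm (p (f x - f y) (g x)) + norm (p (f y) (g x - g y))"
      by (simp add: norm_triangle_ineq)
    also have "norm (p (f x - f y) (g x)) \<le> norm (f x - f y) * norm (g x) * K" by (rule K)
    also have "\<dots> \<le> (L * norm (x - y)) * C * K"
      using L C K xy by (intro mult_right_mono mult_mono) auto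
    also have "norm (p (f y) (g x - g y)) \<le> norm (f y) * norm (g x - g y) * K" by (rule K)
    also have "\<dots> \<le> B * (M * norm (x - y)) * K"
      using B M K xy by (intro mult_right_mono mult_mono) auto
    finally show "norm (p (f x) (g x) - p (f y) (g y)) \<le> (L * C * K + B * M * K) * norm (x - y)"
      by (simp add: algebra_simps)
  qed (use L M B C K in auto)
qed

lemma llip_compose:
  fixes f :: "'c::real_normed_vector \<Rightarrow> 'a::real_normed_vector"
    and g :: "'a \<Rightarrow> 'b::real_normed_vector"
  assumes "llip g" "llip f"
  shows "llip (\<lambda>x. g (f x))"
proof (rule llipI)
  fix R :: real
  obtain L where L: "L \<ge> 0" "\<And>x y. norm x \<le> R \<Longrightarrow> norm y \<le> R \<Longrightarrow> norm (f x - f y) \<le> L * norm (x - y)"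
    using llipE[OF assms(2)] by metis
  obtain B where B: "B \<ge> 0" "\<And>x. norm x \<le> R \<Longrightarrow> norm (f x) \<le> B" using llip_bounded[OF assms(2)] by metis
  obtain M where M: "M \<ge> 0" "\<And>x y. norm x \<le> B \<Longrightarrow> norm y \<le> B \<Longrightarrow> norm (g x - g y) \<le> M * norm (x - y)"
    using llipE[OF assms(1)] by metis
  show "\<exists>L\<ge>0. \<forall>x y. norm x \<le> R \<longrightarrow> norm y \<le> R \<longrightarrow> norm (g (f x) - g (f y)) \<le> L * norm (x - y)"
  proof (intro exI[of _ "M * L"] conjI allI impI)
    fix x y :: 'c assume xy: "norm x \<le> R" "norm y \<le> R"
    have "norm (g (f x) - g (f y)) \<le> M * norm (f x - f y)" using xy B by (intro M) auto
    also have "\<dots> \<le> M * (L * norm (x - y))" using xy L M by (intro mult_left_mono) auto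
    finally show "norm (g (f x) - g (f y)) \<le> M * L * norm (x - y)" by simp
  qed (use L M in auto)
qed

lemma llip_minus: "llip f \<Longrightarrow> llip (\<lambda>x. - f x)"
  by (rule llip_compose[OF llip_bounded_linear[OF bounded_linear_minus[OF bounded_linear_ident]]])

lemma llip_diff: "llip f \<Longrightarrow> llip g \<Longrightarrow> llip (\<lambda>x. f x - g x)"
  using llip_add[OF _ llip_minus[of g], of f] by simp

lemma llip_scaleR: "llip f \<Longrightarrow> llip g \<Longrightarrow> llip (\<lambda>x. f x *\<^sub>R g x)"
  by (rule llip_bilinear[OF bounded_bilinear_scaleR])

lemma llip_sum: "(\<And>i. i \<in> I \<Longrightarrow> llip (f i)) \<Longrightarrow> llip (\<lambda>x. \<Sum>i\<in>I. f i x)"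
  by (induction I rule: infinite_finite_induct) (auto intro: llip_add llip_const)

lemma llip_linear_compose:
  "bounded_linear h \<Longrightarrow> llip f \<Longrightarrow> llip (\<lambda>x. h (f x))"
  by (rule llip_compose[OF llip_bounded_linear])

lemma llip_Pair:
  assumes "llip f" "llip g"
  shows "llip (\<lambda>x. (f x, g x))"
proof -
  have "llip (\<lambda>x. (f x, 0) + (0, g x))"
    by (intro llip_add llip_linear_compose[OF _ assms(1)] llip_linear_compose[OF _ assms(2)])
       (auto intro: bounded_linear_intros)
  then show ?thesis by simp
qed

lemma bounded_linear_axis:
  "bounded_linear (axis i :: 'b::euclidean_space \<Rightarrow> 'b^'i::finite)"
  unfolding linear_conv_bounded_linear[symmetric]
  by (rule linearI) (auto simp: vec_eq_iff axis_def)

text \<open>A vector is the sum of its coordinates embedded along the axes, which reduces the claim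
  to \<open>llip_sum\<close>. The entries may be vectors themselves, as the positions in a
  configuration are.\<close>

lemma llip_vec:
  fixes f :: "'i::finite \<Rightarrow> 'a::real_normed_vector \<Rightarrow> 'b::euclidean_space"
  assumes "\<And>i. llip (f i)"
  shows "llip (\<lambda>x. \<chi> i. f i x)"
proof -
  have "llip (\<lambda>x. \<Sum>i\<in>UNIV. axis i (f i x))"
  proof (intro llip_sum)
    fix i :: 'i
    show "llip (\<lambda>x. axis i (f i x))"
      by (rule llip_linear_compose[OF bounded_linear_axis assms])
  qed
  moreover have "(\<Sum>i\<in>UNIV. axis i (f i x)) = (\<chi> i. f i x)" for x
    by (simp add: vec_eq_iff axis_def)
  ultimately show ?thesis by simp
qed

section \<open>Ordinary differential equations\<close>

text \<open>Mean value inequality for curves whose derivatives are taken relative to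
  \<open>{0..}\<close>, as in \<open>is_solution\<close>; since 0 \<le> a they restrict to
  \<open>{a..b}\<close>.\<close>

lemma vector_derivative_increment_bound:
  fixes y :: "real \<Rightarrow> 'a::real_normed_vector"
  assumes "0 \<le> a" "a \<le> b"
    and "\<And>s. s \<in> {a..b} \<Longrightarrow> (y has_vector_derivative y' s) (at s within {0..})"
    and "\<And>s. s \<in> {a..b} \<Longrightarrow> norm (y' s) \<le> B"
  shows "norm (y b - y a) \<le> B * (b - a)"
proof -
  have "norm (y b - y a) \<le> B * norm (b - a)"
  proof (rule differentiable_bound[where S="{a..b}" and f'="\<lambda>s h. h *\<^sub>R y' s"])
    fix s assume s: "s \<in> {a..b}"
    have "(y has_vector_derivative y' s) (at s within {a..b})"
      using assms(3)[OF s] by (rule has_vector_derivative_within_subset) (use assms in auto)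
    then show "(y has_derivative (\<lambda>h. h *\<^sub>R y' s)) (at s within {a..b})"
      by (simp add: has_vector_derivative_def)
    have "B \<ge> 0" using assms(4)[OF s] norm_ge_zero order_trans by blast
    then show "onorm (\<lambda>h. h *\<^sub>R y' s) \<le> B"
      using mult_left_mono[OF assms(4)[OF s]] by (intro onorm_le) (simp add: mult.commute[of B])
  qed (use assms in auto)
  then show ?thesis using assms by simp
qed


text \<open>Gronwall's inequality: \<open>exp (- c * t) * g t\<close> has nonpositive derivative.
  Neither \<open>c\<close> nor \<open>g\<close> carries a sign condition, so it applies to
  \<open>- g\<close> for backward bounds and with \<open>c = 0\<close> for monotonicity.\<close>

lemma exp_growth_bound:
  fixes g :: "real \<Rightarrow> real"
  assumes g: "\<And>t. 0 \<le> t \<Longrightarrow> t \<le> T \<Longrightarrow> (g has_vector_derivative g' t) (at t within {0..})"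
    and g': "\<And>t. 0 \<le> t \<Longrightarrow> t \<le> T \<Longrightarrow> g' t \<le> c * g t" and "0 \<le> T"
  shows "g T \<le> exp (c * T) * g 0"
proof (cases "T = 0")
  case False
  then have T: "0 < T" using assms by simp
  let ?h = "\<lambda>t. exp (- c * t) * g t"
  have gd: "(g has_field_derivative g' t) (at t within {0..T})" if "t \<in> {0..T}" for t
    using g[of t] that has_vector_derivative_within_subset[of g "g' t" t "{0..}" "{0..T}"]
    by (simp add: has_real_derivative_iff_has_vector_derivative)
  have hd: "(?h has_field_derivative (exp (- c * t) * (g' t - c * g t))) (at t within {0..T})" if "t \<in> {0..T}" for t
    by (rule derivative_eq_intros gd[OF that] refl | simp add: algebra_simps)+
  have "\<exists>t\<in>{0..T}. ?h T - ?h 0 = exp (- c * t) * (g' t - c * g t) * (T - 0)"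
    using T hd unfolding has_field_derivative_def by (intro mvt_very_simple) auto
  then obtain t where t: "t \<in> {0..T}" "?h T - ?h 0 = exp (- c * t) * (g' t - c * g t) * T" by auto
  have "exp (- c * t) * (g' t - c * g t) * T \<le> 0"
    using g'[of t] t T by (intro mult_nonpos_nonneg mult_nonneg_nonpos) auto
  then have "exp (- c * T) * g T \<le> g 0" using t by simp
  then have "exp (c * T) * (exp (- c * T) * g T) \<le> exp (c * T) * g 0" by (intro mult_left_mono) auto
  then show ?thesis by (simp add: exp_minus field_simps)
qed simp

text \<open>Gronwall's inequality is applied to the squared distance, which is differentiable even
  where the trajectories meet. The second bound, from the later time to the earlier one, makes the
  flow injective without any solution at negative times.\<close>

lemma trajectories_distance:
  fixes y z :: "real \<Rightarrow> 'a::real_inner"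
  assumes y: "\<And>t. 0 \<le> t \<Longrightarrow> t \<le> T \<Longrightarrow> (y has_vector_derivative F (y t)) (at t within {0..})"
    and z: "\<And>t. 0 \<le> t \<Longrightarrow> t \<le> T \<Longrightarrow> (z has_vector_derivative F (z t)) (at t within {0..})"
    and R: "\<And>t. 0 \<le> t \<Longrightarrow> t \<le> T \<Longrightarrow> norm (y t) \<le> R" "\<And>t. 0 \<le> t \<Longrightarrow> t \<le> T \<Longrightarrow> norm (z t) \<le> R"
    and L: "\<And>u v. norm u \<le> R \<Longrightarrow> norm v \<le> R \<Longrightarrow> norm (F u - F v) \<le> L * norm (u - v)"
    and T: "0 \<le> T"
  shows "norm (y T - z T) \<le> exp (L * T) * norm (y 0 - z 0)"
    and "norm (y 0 - z 0) \<le> exp (L * T) * norm (y T - z T)"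
proof -
  define g where "g = (\<lambda>t. (y t - z t) \<bullet> (y t - z t))"
  define g' where "g' = (\<lambda>t. 2 * ((y t - z t) \<bullet> (F (y t) - F (z t))))"
  have gd: "(g has_vector_derivative g' t) (at t within {0..})" if "0 \<le> t" "t \<le> T" for t
  proof -
    have "((\<lambda>t. y t - z t) has_vector_derivative (F (y t) - F (z t))) (at t within {0..})"
      by (intro has_vector_derivative_diff y z that)
    from bounded_bilinear.has_vector_derivative[OF bounded_bilinear_inner this this]
    show ?thesis by (simp add: g_def g'_def inner_commute)
  qed
  have bd: "\<bar>g' t\<bar> \<le> 2 * L * g t" if "0 \<le> t" "t \<le> T" for t
  proof -
    have "\<bar>g' t\<bar> \<le> 2 * (norm (y t - z t) * norm (F (y t) - F (z t)))"
      unfolding g'_def using Cauchy_Schwarz_ineq2 by (simp add: abs_mult)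
    also have "\<dots> \<le> 2 * (norm (y t - z t) * (L * norm (y t - z t)))"
      using that by (intro mult_left_mono L R) auto
    finally show ?thesis by (simp add: g_def dot_square_norm power2_eq_square algebra_simps)
  qed
  have sq: "exp (2 * L * T) = (exp (L * T))\<^sup>2" by (simp add: power2_eq_square mult_exp_exp)
  have "g T \<le> exp (2 * L * T) * g 0"
    by (rule exp_growth_bound[OF gd]) (use bd T in \<open>auto simp: abs_le_iff\<close>)
  then have "(norm (y T - z T))\<^sup>2 \<le> (exp (L * T) * norm (y 0 - z 0))\<^sup>2"
    unfolding sq by (simp add: g_def dot_square_norm power_mult_distrib)
  then show "norm (y T - z T) \<le> exp (L * T) * norm (y 0 - z 0)"
    by (rule power2_le_imp_le) simp
  \<comment> \<open>The bound \<open>g' t \<ge> - 2 * L * g t\<close> is the hypothesis of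
    Gronwall's inequality for \<open>- g\<close> with rate \<open>- (2 * L)\<close>.\<close>
  have "- g T \<le> exp (- (2 * L) * T) * (- g 0)"
  proof (rule exp_growth_bound[where g'="\<lambda>t. - g' t"])
    show "((\<lambda>t. - g t) has_vector_derivative - g' t) (at t within {0..})" if "0 \<le> t" "t \<le> T" for t
      using gd[OF that] by (rule has_vector_derivative_minus)
    show "- g' t \<le> - (2 * L) * - g t" if "0 \<le> t" "t \<le> T" for t
      using bd[OF that] by (auto simp: abs_le_iff)
  qed fact
  then have "exp (- (2 * L * T)) * g 0 \<le> g T" by simp
  then have "exp (2 * L * T) * (exp (- (2 * L * T)) * g 0) \<le> exp (2 * L * T) * g T"
    by (intro mult_left_mono) auto
  then have "g 0 \<le> exp (2 * L * T) * g T"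
    by (simp add: exp_minus field_simps)
  then have "(norm (y 0 - z 0))\<^sup>2 \<le> (exp (L * T) * norm (y T - z T))\<^sup>2"
    unfolding sq by (simp add: g_def dot_square_norm power_mult_distrib)
  then show "norm (y 0 - z 0) \<le> exp (L * T) * norm (y T - z T)"
    by (rule power2_le_imp_le) simp
qed


section \<open>Global existence: Picard iteration and Lyapunov functions\<close>

lemma integral_has_vector_derivative_halfline:
  fixes g :: "real \<Rightarrow> 'a::euclidean_space"
  assumes "continuous_on {0..} g" "0 \<le> t"
  shows "((\<lambda>t. integral {0..t} g) has_vector_derivative g t) (at t within {0..})"
proof -
  have "((\<lambda>t. integral {0..t} g) has_vector_derivative g t) (at t within {0..t+1})"
    by (rule integral_has_vector_derivative) (use assms in \<open>auto intro: continuous_on_subset\<close>)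
  moreover have "at t within {0..t+1} = at t within {0..}"
    by (rule at_within_nhd[where S="{..<t+1}"]) auto
  ultimately show ?thesis by simp
qed

text \<open>Bielecki's weight: the unknown is \<open>u t = exp (- 2 * L * t) *\<^sub>R y t\<close>,
  for which the Picard operator is a contraction with factor 1/2 on bounded continuous functions
  over all times at once. A single fixed point therefore gives a global solution. Boundedness of
  \<open>G\<close> keeps the operator within bounded functions.\<close>

lemma picard_global:
  fixes G :: "'a::euclidean_space \<Rightarrow> 'a"
  assumes lip: "\<And>u v. norm (G u - G v) \<le> L * norm (u - v)" and L: "L > 0"
    and bdd: "\<And>u. norm (G u) \<le> B"
  obtains y where "y 0 = y0" "\<And>t. t \<ge> 0 \<Longrightarrow> (y has_vector_derivative G (y t)) (at t within {0..})"
proof -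
  have contG: "continuous_on UNIV G"
    by (rule lipschitz_on_continuous_on[of L]) (auto intro!: lipschitz_onI simp: dist_norm lip L less_imp_le)
  define g where "g = (\<lambda>u::real \<Rightarrow> 'a. \<lambda>s. G (exp (2 * L * s) *\<^sub>R u s))"
  have contg: "continuous_on UNIV (g u)" if "continuous_on UNIV u" for u
    unfolding g_def by (intro continuous_on_compose2[OF contG] continuous_intros that) auto
  \<comment> \<open>\<open>max t 0\<close> extends the operator to negative times, because the
    bounded continuous functions live on the whole line; only times t \<ge> 0 are read off at the
    end.\<close>
  define \<Phi> where "\<Phi> = (\<lambda>u t. exp (- 2 * L * max t 0) *\<^sub>R (y0 + integral {0..max t 0} (g u)))"
  have B: "B \<ge> 0" using bdd[of 0] norm_ge_zero order_trans by blast
  have int: "g u integrable_on {0..t}" if "continuous_on UNIV u" for u t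
    by (intro integrable_continuous_interval continuous_on_subset[OF contg[OF that]]) auto
  have \<Phi>_cont: "continuous_on UNIV (\<Phi> u)" if "continuous_on UNIV u" for u
  proof -
    have "continuous_on {0..} (\<lambda>t. integral {0..t} (g u))"
      using integral_has_vector_derivative_halfline[OF continuous_on_subset[OF contg[OF that]]]
      by (auto simp: continuous_on_eq_continuous_within intro: has_vector_derivative_continuous)
    then have "continuous_on UNIV (\<lambda>t. integral {0..max t 0} (g u))"
      by (rule continuous_on_compose2) (auto intro!: continuous_intros)
    then show ?thesis
      unfolding \<Phi>_def by (intro continuous_intros)
  qed
  have \<Phi>_bdd: "norm (\<Phi> u t) \<le> norm y0 + B / (2 * L)" if u: "continuous_on UNIV u" for u t
  proof -
    define \<tau> where "\<tau> = max t 0"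
    have \<tau>: "\<tau> \<ge> 0" by (simp add: \<tau>_def)
    have "norm (integral {0..\<tau>} (g u)) \<le> B * (\<tau> - 0)"
      using \<tau> by (intro integral_bound continuous_on_subset[OF contg[OF u]]) (auto simp: g_def bdd)
    also have "\<dots> \<le> B * (exp (2 * L * \<tau>) / (2 * L))"
    proof (intro mult_left_mono)
      have "2 * L * \<tau> \<le> exp (2 * L * \<tau>)" using exp_ge_add_one_self[of "2 * L * \<tau>"] by linarith
      then show "\<tau> - 0 \<le> exp (2 * L * \<tau>) / (2 * L)" using L by (simp add: pos_le_divide_eq mult.commute)
    qed (rule B)
    finally have i: "norm (integral {0..\<tau>} (g u)) \<le> B * (exp (2 * L * \<tau>) / (2 * L))" .
    have "norm (\<Phi> u t) \<le> exp (- 2 * L * \<tau>) * (norm y0 + norm (integral {0..\<tau>} (g u)))"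
      unfolding \<Phi>_def \<tau>_def[symmetric] by (simp add: norm_triangle_ineq)
    also have "\<dots> \<le> exp (- 2 * L * \<tau>) * (norm y0 + B * (exp (2 * L * \<tau>) / (2 * L)))"
      using i by (intro mult_left_mono) auto
    also have "\<dots> = exp (- 2 * L * \<tau>) * norm y0 + B / (2 * L)"
      by (simp add: exp_minus field_simps)
    also have "\<dots> \<le> 1 * norm y0 + B / (2 * L)"
      using L \<tau> by (intro add_mono mult_right_mono) auto
    finally show ?thesis by simp
  qed
  have \<Phi>_mem: "\<Phi> u \<in> bcontfun" if "continuous_on UNIV u" for u
    by (rule bcontfun_normI[OF \<Phi>_cont[OF that] \<Phi>_bdd[OF that]])
  define T where "T = (\<lambda>u. Bcontfun (\<Phi> (apply_bcontfun u)))"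
  have T: "apply_bcontfun (T u) = \<Phi> (apply_bcontfun u)" for u
    unfolding T_def by (rule Bcontfun_inverse) (rule \<Phi>_mem, simp)
  have contr: "dist (T u) (T w) \<le> 1/2 * dist u w" for u w
  proof (rule dist_bound)
    fix t :: real
    define \<tau> where "\<tau> = max t 0"
    have \<tau>: "\<tau> \<ge> 0" by (simp add: \<tau>_def)
    define d where "d = dist u w"
    have d: "d \<ge> 0" "norm (u s - w s) \<le> d" for s
      using dist_bounded[of u s w] by (auto simp: d_def dist_norm)
    \<comment> \<open>The majorant \<open>L * exp (2 * L * s) * d\<close> is written as the
      derivative of \<open>exp (2 * L * s) * (d / 2)\<close>; the exponent \<open>2 * L\<close> of
      the weight is what produces the factor 1/2.\<close>
    have "((\<lambda>s. (2 * L) * (exp (2 * L * s) * (d / 2))) has_integral exp (2 * L * \<tau>) * (d / 2) - exp (2 * L * 0) * (d / 2)) {0..\<tau>}"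
      by (rule fundamental_theorem_of_calculus[OF \<tau>])
         (auto intro!: derivative_eq_intros simp: has_real_derivative_iff_has_vector_derivative[symmetric])
    moreover have le: "norm (g u s - g w s) \<le> (2 * L) * (exp (2 * L * s) * (d / 2))" for s
    proof -
      have "norm (g u s - g w s) \<le> L * norm (exp (2 * L * s) *\<^sub>R u s - exp (2 * L * s) *\<^sub>R w s)"
        unfolding g_def by (rule lip)
      also have "\<dots> = L * (exp (2 * L * s) * norm (u s - w s))"
        by (simp add: scaleR_diff_right[symmetric])
      also have "\<dots> \<le> L * (exp (2 * L * s) * d)"
        using L d(2)[of s] by (intro mult_left_mono) auto
      finally show ?thesis by simp
    qed
    moreover have id: "(\<lambda>s. g u s - g w s) integrable_on {0..\<tau>}" by (intro integrable_diff int) auto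
    ultimately have "norm (integral {0..\<tau>} (\<lambda>s. g u s - g w s)) \<le> exp (2 * L * \<tau>) * (d / 2) - d / 2"
      using integral_norm_bound_integral[of "\<lambda>s. g u s - g w s" "{0..\<tau>}" "\<lambda>s. (2 * L) * (exp (2 * L * s) * (d / 2))"]
        id
      by (auto simp: has_integral_iff)
    also have "\<dots> \<le> exp (2 * L * \<tau>) * (d / 2)" using d by simp
    finally have i: "norm (integral {0..\<tau>} (g u) - integral {0..\<tau>} (g w)) \<le> exp (2 * L * \<tau>) * (d / 2)"
      by (subst integral_diff[symmetric]) (auto intro!: int)
    have "dist (T u t) (T w t) = exp (- 2 * L * \<tau>) * norm (integral {0..\<tau>} (g u) - integral {0..\<tau>} (g w))"
      unfolding T \<Phi>_def \<tau>_def[symmetric] dist_norm scaleR_diff_right[symmetric] by simp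
    also have "\<dots> \<le> exp (- 2 * L * \<tau>) * (exp (2 * L * \<tau>) * (d / 2))"
      using i by (intro mult_left_mono) auto
    also have "\<dots> = d / 2" by (simp add: exp_minus field_simps)
    finally show "dist (T u t) (T w t) \<le> 1/2 * dist u w" by (simp add: d_def)
  qed
  have "\<exists>!u. T u = u"
    by (rule banach_fix_type[where c="1/2"]) (use contr in auto)
  then obtain u where u: "T u = u" by auto
  define y where "y = (\<lambda>t. y0 + integral {0..t} (g u))"
  have yu: "y t = exp (2 * L * t) *\<^sub>R u t" if "t \<ge> 0" for t
  proof -
    have "u t = \<Phi> u t" using T[of u] u by simp
    then show ?thesis using that by (simp add: \<Phi>_def y_def exp_minus)
  qed
  show ?thesis
  proof (rule that[of y])
    show "y 0 = y0" by (simp add: y_def)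
    fix t :: real assume t: "t \<ge> 0"
    have "(y has_vector_derivative g u t) (at t within {0..})"
      unfolding y_def
      by (auto intro!: derivative_eq_intros integral_has_vector_derivative_halfline continuous_on_subset[OF contg] t)
    then show "(y has_vector_derivative G (y t)) (at t within {0..})"
      using yu[OF t] by (simp add: g_def)
  qed
qed

text \<open>Gronwall's inequality with rate 0. The sign condition is asked only along the
  trajectory.\<close>

lemma lyapunov_nonincreasing:
  fixes H :: "'a::real_normed_vector \<Rightarrow> real"
  assumes y: "\<And>t. t \<ge> 0 \<Longrightarrow> (y has_vector_derivative y' t) (at t within {0..})"
    and H: "\<And>z. (H has_derivative H' z) (at z)"
    and neg: "\<And>t. t \<ge> 0 \<Longrightarrow> H' (y t) (y' t) \<le> 0"
    and t: "t \<ge> 0"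
  shows "H (y t) \<le> H (y 0)"
proof -
  have "((\<lambda>s. H (y s)) has_vector_derivative H' (y s) (y' s)) (at s within {0..})" if "s \<ge> 0" for s
  proof -
    have "((H \<circ> y) has_derivative (H' (y s) \<circ> (\<lambda>h. h *\<^sub>R y' s))) (at s within {0..})"
      using y[OF that] H[of "y s"] unfolding has_vector_derivative_def
      by (intro diff_chain_within) (auto intro: has_derivative_at_withinI)
    moreover have "H' (y s) \<circ> (\<lambda>h. h *\<^sub>R y' s) = (\<lambda>h. h *\<^sub>R H' (y s) (y' s))"
      using linear_cmul[OF has_derivative_linear[OF H[of "y s"]]] by auto
    ultimately show ?thesis by (simp add: has_vector_derivative_def o_def)
  qed
  from exp_growth_bound[of t "\<lambda>s. H (y s)" _ 0, OF this] neg t show ?thesis by auto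
qed

text \<open>The field is cut off outside a large ball and becomes bounded and globally Lipschitz.
  Multiplying it by a factor \<theta> \<ge> 0 keeps \<open>H\<close> nonincreasing, so the solution
  of the truncated equation stays in the sublevel set of \<open>y0\<close>, where \<theta> = 1 and
  the truncation is invisible.\<close>

lemma lyapunov_global_solution:
  fixes F :: "'a::euclidean_space \<Rightarrow> 'a" and H :: "'a \<Rightarrow> real"
  assumes F: "llip F"
    and H: "\<And>z. (H has_derivative H' z) (at z)"
    and neg: "\<And>z. H' z (F z) \<le> 0"
    and bdd: "\<And>c. bounded {z. H z \<le> c}"
  obtains y where "y 0 = y0" "\<And>t. t \<ge> 0 \<Longrightarrow> (y has_vector_derivative F (y t)) (at t within {0..})"
proof -
  obtain R where R: "R > 0" "\<And>z. H z \<le> H y0 \<Longrightarrow> norm z \<le> R"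
    using bdd[of "H y0"] unfolding bounded_pos by auto
  \<comment> \<open>\<open>R\<close> bounds the sublevel set of \<open>y0\<close>. The cut-off
    equals 1 up to norm R + 1, vanishes from norm R + 2 on, and has Lipschitz constant 1.\<close>
  define \<theta> where "\<theta> = (\<lambda>z::'a. max 0 (min 1 (R + 2 - norm z)))"
  define G where "G = (\<lambda>z. \<theta> z *\<^sub>R F z)"
  have \<theta>: "0 \<le> \<theta> z" "\<theta> z \<le> 1" for z by (auto simp: \<theta>_def)
  have \<theta>0: "\<theta> z = 0" if "norm z > R + 2" for z using that by (simp add: \<theta>_def)
  have \<theta>lip: "\<bar>\<theta> u - \<theta> v\<bar> \<le> norm (u - v)" for u v
    using norm_triangle_ineq3[of u v] by (auto simp: \<theta>_def max_def min_def)
  obtain L where L: "L \<ge> 0" "\<And>x y. norm x \<le> R + 2 \<Longrightarrow> norm y \<le> R + 2 \<Longrightarrow> norm (F x - F y) \<le> L * norm (x - y)"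
    using llipE[OF F] by metis
  obtain B where B: "B \<ge> 0" "\<And>x. norm x \<le> R + 2 \<Longrightarrow> norm (F x) \<le> B" using llip_bounded[OF F] by metis
  \<comment> \<open>With \<open>v\<close> in the ball of radius R + 2, either \<open>u\<close> is
    there too and the product is split in the usual way, or \<theta> u = 0 and only the change of
    \<theta> remains, multiplied by the bounded \<open>F v\<close>.\<close>
  have half: "norm (G u - G v) \<le> (L + B + 1) * norm (u - v)" if v: "norm v \<le> R + 2" for u v
  proof (cases "norm u \<le> R + 2")
    case True
    have "G u - G v = \<theta> u *\<^sub>R (F u - F v) + (\<theta> u - \<theta> v) *\<^sub>R F v"
      by (simp add: G_def algebra_simps)
    then have "norm (G u - G v) \<le> \<theta> u * norm (F u - F v) + \<bar>\<theta> u - \<theta> v\<bar> * norm (F v)"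
      using norm_triangle_ineq[of "\<theta> u *\<^sub>R (F u - F v)" "(\<theta> u - \<theta> v) *\<^sub>R F v"] \<theta>(1)[of u] by simp
    also have "\<dots> \<le> 1 * (L * norm (u - v)) + norm (u - v) * B"
      using \<theta>[of u] \<theta>lip[of u v] L B v True by (intro add_mono mult_mono) auto
    also have "\<dots> \<le> (L + B + 1) * norm (u - v)" by (simp add: algebra_simps)
    finally show ?thesis .
  next
    case False
    then have "\<theta> u = 0" by (simp add: \<theta>0)
    then have "norm (G u - G v) = \<bar>\<theta> u - \<theta> v\<bar> * norm (F v)" by (simp add: G_def)
    also have "\<dots> \<le> norm (u - v) * B"
      using \<theta>lip[of u v] B v by (intro mult_mono) auto
    also have "\<dots> \<le> (L + B + 1) * norm (u - v)" using L B by (simp add: algebra_simps)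
    finally show ?thesis .
  qed
  have lip: "norm (G u - G v) \<le> (L + B + 1) * norm (u - v)" for u v
  proof -
    consider "norm v \<le> R + 2" | "norm u \<le> R + 2" | "norm u > R + 2" "norm v > R + 2" by linarith
    then show ?thesis
    proof cases
      case 1 then show ?thesis by (rule half)
    next
      case 2 then show ?thesis using half[of u v] by (simp add: norm_minus_commute)
    next
      case 3 then show ?thesis using \<theta>0[of u] \<theta>0[of v] L B by (simp add: G_def)
    qed
  qed
  have Gbdd: "norm (G u) \<le> B" for u
  proof (cases "norm u \<le> R + 2")
    case True
    have "norm (G u) = \<theta> u * norm (F u)" using \<theta>(1)[of u] by (simp add: G_def)
    also have "\<dots> \<le> norm (F u)" using \<theta>[of u] by (intro mult_left_le_one_le) auto
    finally have "norm (G u) \<le> norm (F u)" .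
    then show ?thesis using B(2)[OF True] by simp
  qed (use \<theta>0[of u] B in \<open>auto simp: G_def\<close>)
  have pos: "L + B + 1 > 0" using L(1) B(1) by simp
  obtain y where y: "y 0 = y0" "\<And>t. t \<ge> 0 \<Longrightarrow> (y has_vector_derivative G (y t)) (at t within {0..})"
    using picard_global[of G "L + B + 1" B y0, OF lip pos Gbdd] by metis
  have "H' z (G z) \<le> 0" for z
    using neg[of z] \<theta>(1)[of z] linear_cmul[OF has_derivative_linear[OF H[of z]]]
    by (simp add: G_def mult_nonneg_nonpos)
  then have "H (y t) \<le> H y0" if "t \<ge> 0" for t
    using lyapunov_nonincreasing[OF y(2) H] that y(1) by auto
  then have "norm (y t) \<le> R" if "t \<ge> 0" for t using R that by blast
  then have "\<theta> (y t) = 1" if "t \<ge> 0" for t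
    using that unfolding \<theta>_def by fastforce
  then have "G (y t) = F (y t)" if "t \<ge> 0" for t
    using that by (simp add: G_def)
  then show ?thesis using that[of y] y by auto
qed

section \<open>Maps that do not shrink volume too much\<close>

text \<open>Testing on compact sets avoids measurability questions, since images under continuous
  maps are again compact. Neither injectivity nor differentiability of \<open>g\<close> is
  presupposed.\<close>

definition vol_ge :: "real \<Rightarrow> ('a::euclidean_space \<Rightarrow> 'b::euclidean_space) \<Rightarrow> bool" where
  "vol_ge \<kappa> g \<longleftrightarrow>
     (\<forall>A. compact A \<longrightarrow> ennreal \<kappa> * emeasure lborel A \<le> emeasure lborel (g ` A))"

lemma vol_ge_mono:
  assumes "vol_ge \<kappa> g" "\<kappa>' \<le> \<kappa>"
  shows "vol_ge \<kappa>' g"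
  unfolding vol_ge_def
proof (intro allI impI)
  fix A :: "'a set" assume A: "compact A"
  have "ennreal \<kappa>' * emeasure lborel A \<le> ennreal \<kappa> * emeasure lborel A"
    using assms(2) by (intro mult_right_mono ennreal_leI) auto
  also have "\<dots> \<le> emeasure lborel (g ` A)" using assms(1) A by (auto simp: vol_ge_def)
  finally show "ennreal \<kappa>' * emeasure lborel A \<le> emeasure lborel (g ` A)" .
qed

lemma vol_ge_compose:
  assumes g: "vol_ge \<kappa> g" "continuous_on UNIV g" and h: "vol_ge \<mu> h" and pos: "\<kappa> \<ge> 0" "\<mu> \<ge> 0"
  shows "vol_ge (\<mu> * \<kappa>) (\<lambda>x. h (g x))"
  unfolding vol_ge_def
proof (intro allI impI)
  fix A :: "'a set" assume A: "compact A"
  have gA: "compact (g ` A)" using A g(2) by (intro compact_continuous_image) (auto intro: continuous_on_subset)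
  have "ennreal (\<mu> * \<kappa>) * emeasure lborel A = ennreal \<mu> * (ennreal \<kappa> * emeasure lborel A)"
    using pos by (simp add: ennreal_mult mult.assoc)
  also have "\<dots> \<le> ennreal \<mu> * emeasure lborel (g ` A)"
    using g A by (intro mult_left_mono) (auto simp: vol_ge_def)
  also have "\<dots> \<le> emeasure lborel (h ` g ` A)" using h gA by (auto simp: vol_ge_def)
  finally show "ennreal (\<mu> * \<kappa>) * emeasure lborel A \<le> emeasure lborel ((\<lambda>x. h (g x)) ` A)"
    by (simp add: image_image)
qed

lemma vol_ge_affine:
  fixes c :: "'a::euclidean_space"
  shows "vol_ge (\<bar>m\<bar> ^ DIM('a)) (\<lambda>x. m *\<^sub>R x + c)"
  unfolding vol_ge_def
proof (intro allI impI)
  fix A :: "'a set" assume A: "compact A"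
  have A': "compact ((\<lambda>x. m *\<^sub>R x + c) ` A)"
    using A by (intro compact_continuous_image continuous_intros)
  have "emeasure lebesgue ((\<lambda>x. m *\<^sub>R x + c) ` A) = \<bar>m\<bar> ^ DIM('a) * emeasure lebesgue A"
    by (rule emeasure_lebesgue_affine)
  then show "ennreal (\<bar>m\<bar> ^ DIM('a)) * emeasure lborel A \<le> emeasure lborel ((\<lambda>x. m *\<^sub>R x + c) ` A)"
    using borel_compact[OF A] borel_compact[OF A'] by simp
qed

section \<open>Cavalieri's principle and maps that act on fibres\<close>

lemma emeasure_fibres:
  fixes B :: "('a::euclidean_space \<times> 'b::euclidean_space) set"
  assumes "B \<in> sets borel"
  shows "emeasure lborel B = (\<integral>\<^sup>+a. emeasure lborel (Pair a -` B) \<partial>lborel)"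
    and "emeasure lborel B = (\<integral>\<^sup>+b. emeasure lborel ((\<lambda>a. (a, b)) -` B) \<partial>lborel)"
    and "(\<lambda>a. emeasure lborel (Pair a -` B)) \<in> borel_measurable lborel"
    and "(\<lambda>b. emeasure lborel ((\<lambda>a. (a, b)) -` B)) \<in> borel_measurable lborel"
proof -
  have B: "B \<in> sets (lborel \<Otimes>\<^sub>M lborel)" using assms by (subst lborel_prod) simp
  show "emeasure lborel B = (\<integral>\<^sup>+a. emeasure lborel (Pair a -` B) \<partial>lborel)"
    using lborel.emeasure_pair_measure_alt[OF B] by (simp add: lborel_prod)
  show "emeasure lborel B = (\<integral>\<^sup>+b. emeasure lborel ((\<lambda>a. (a, b)) -` B) \<partial>lborel)"
    using lborel_pair.emeasure_pair_measure_alt2[OF B] by (simp add: lborel_prod)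
  show "(\<lambda>a. emeasure lborel (Pair a -` B)) \<in> borel_measurable lborel"
    by (rule lborel.measurable_emeasure_Pair[OF B])
  show "(\<lambda>b. emeasure lborel ((\<lambda>a. (a, b)) -` B)) \<in> borel_measurable lborel"
    by (rule lborel_pair.measurable_emeasure_Pair2[OF B])
qed

text \<open>The map fixes \<open>a\<close>, so the fibre of the image over \<open>a\<close> is the
  image of the fibre, and Cavalieri's principle integrates the fibrewise bounds. Only continuity in
  \<open>a\<close> is asked for, which is why a merely Lipschitz force causes no trouble.\<close>

lemma vol_ge_fibrewise:
  fixes g :: "'a::euclidean_space \<Rightarrow> 'b::euclidean_space \<Rightarrow> 'b"
  assumes g: "\<And>a. vol_ge \<kappa> (g a)" and cont: "continuous_on UNIV (\<lambda>(a, b). (a, g a b))"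
  shows "vol_ge \<kappa> (\<lambda>(a, b). (a, g a b))"
  unfolding vol_ge_def
proof (intro allI impI)
  fix B :: "('a \<times> 'b) set" assume B: "compact B"
  let ?S = "\<lambda>(a, b). (a, g a b)"
  have SB: "compact (?S ` B)"
    using B by (intro compact_continuous_image continuous_on_subset[OF cont]) auto
  have fib: "compact (Pair a -` B)" for a
  proof -
    have "compact (B \<inter> {a} \<times> UNIV)" by (intro compact_Int_closed B closed_Times) auto
    then have "compact (snd ` (B \<inter> {a} \<times> UNIV))"
      by (intro compact_continuous_image continuous_intros)
    moreover have "snd ` (B \<inter> {a} \<times> UNIV) = Pair a -` B" by force
    ultimately show ?thesis by simp
  qed
  have "ennreal \<kappa> * emeasure lborel B = (\<integral>\<^sup>+a. ennreal \<kappa> * emeasure lborel (Pair a -` B) \<partial>lborel)"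
    using emeasure_fibres[OF borel_compact[OF B]] by (simp add: nn_integral_cmult)
  also have "\<dots> \<le> (\<integral>\<^sup>+a. emeasure lborel (Pair a -` ?S ` B) \<partial>lborel)"
  proof (rule nn_integral_mono)
    fix a
    have "Pair a -` ?S ` B = g a ` (Pair a -` B)" by force
    then show "ennreal \<kappa> * emeasure lborel (Pair a -` B) \<le> emeasure lborel (Pair a -` ?S ` B)"
      using g[of a] fib[of a] by (auto simp: vol_ge_def)
  qed
  also have "\<dots> = emeasure lborel (?S ` B)"
    using emeasure_fibres(1)[OF borel_compact[OF SB]] by simp
  finally show "ennreal \<kappa> * emeasure lborel B \<le> emeasure lborel (?S ` B)" .
qed

text \<open>The mirror image, for maps such as free transport that move the first coordinate and
  keep the second.\<close>

lemma vol_ge_fibrewise2: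
  fixes g :: "'b::euclidean_space \<Rightarrow> 'a::euclidean_space \<Rightarrow> 'a"
  assumes g: "\<And>b. vol_ge \<kappa> (g b)" and cont: "continuous_on UNIV (\<lambda>(a, b). (g b a, b))"
  shows "vol_ge \<kappa> (\<lambda>(a, b). (g b a, b))"
  unfolding vol_ge_def
proof (intro allI impI)
  fix B :: "('a \<times> 'b) set" assume B: "compact B"
  let ?S = "\<lambda>(a, b). (g b a, b)"
  have SB: "compact (?S ` B)"
    using B by (intro compact_continuous_image continuous_on_subset[OF cont]) auto
  have fib: "compact ((\<lambda>a. (a, b)) -` B)" for b
  proof -
    have "compact (B \<inter> UNIV \<times> {b})" by (intro compact_Int_closed B closed_Times) auto
    then have "compact (fst ` (B \<inter> UNIV \<times> {b}))"
      by (intro compact_continuous_image continuous_intros)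
    moreover have "fst ` (B \<inter> UNIV \<times> {b}) = (\<lambda>a. (a, b)) -` B" by force
    ultimately show ?thesis by simp
  qed
  have "ennreal \<kappa> * emeasure lborel B = (\<integral>\<^sup>+b. ennreal \<kappa> * emeasure lborel ((\<lambda>a. (a, b)) -` B) \<partial>lborel)"
    using emeasure_fibres(4)[OF borel_compact[OF B]] 
    by (subst emeasure_fibres(2)[OF borel_compact[OF B]]) (simp add: nn_integral_cmult)
  also have "\<dots> \<le> (\<integral>\<^sup>+b. emeasure lborel ((\<lambda>a. (a, b)) -` ?S ` B) \<partial>lborel)"
  proof (rule nn_integral_mono)
    fix b
    have "(\<lambda>a. (a, b)) -` ?S ` B = g b ` ((\<lambda>a. (a, b)) -` B)" by force
    then show "ennreal \<kappa> * emeasure lborel ((\<lambda>a. (a, b)) -` B) \<le> emeasure lborel ((\<lambda>a. (a, b)) -` ?S ` B)"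
      using g[of b] fib[of b] by (auto simp: vol_ge_def)
  qed
  also have "\<dots> = emeasure lborel (?S ` B)"
    using emeasure_fibres(2)[OF borel_compact[OF SB]] by simp
  finally show "ennreal \<kappa> * emeasure lborel B \<le> emeasure lborel (?S ` B)" .
qed

text \<open>A linear map that moves every vector by at most a fraction \<open>q < 1\<close> of its norm maps a ball onto
  a superset of the ball shrunk by \<open>1 - q\<close>; open sets are filled by disjoint balls up to a null set.\<close>

lemma vol_ge_near_identity:
  fixes T :: "'a::euclidean_space \<Rightarrow> 'a"
  assumes T: "linear T" and q: "0 \<le> q" "q < 1" and near: "\<And>v. norm (T v - v) \<le> q * norm v"
  shows "vol_ge ((1 - q) ^ DIM('a)) T"
proof -
  let ?\<kappa> = "(1 - q) ^ DIM('a)"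
  \<comment> \<open>This estimate gives injectivity, hence bijectivity in finite dimension, and also
    the inclusion of the shrunk balls.\<close>
  have low: "(1 - q) * norm v \<le> norm (T v)" for v
    using near[of v] norm_triangle_ineq2[of v "T v"] by (simp add: algebra_simps norm_minus_commute)
  have inj: "inj T"
  proof (rule linear_injective_0[OF T, THEN iffD2], intro allI impI)
    fix v assume "T v = 0"
    then show "v = 0" using low[of v] q by (simp add: mult_le_0_iff)
  qed
  then have surj: "surj T" using linear_inj_imp_surj[OF T] by simp
  have contT: "continuous_on S T" for S by (rule linear_continuous_on) (simp add: T linear_conv_bounded_linear[symmetric])
  have balls: "ball (T a) ((1 - q) * r) \<subseteq> T ` ball a r" for a r
  proof
    fix y assume y: "y \<in> ball (T a) ((1 - q) * r)"
    obtain x where x: "y = T x" using surj by blast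
    have "(1 - q) * norm (a - x) \<le> norm (T a - T x)" using low[of "a - x"] by (simp add: linear_diff[OF T])
    also have "\<dots> < (1 - q) * r" using y x by (simp add: dist_norm)
    finally have "norm (a - x) < r" using q by simp
    then show "y \<in> T ` ball a r" using x by (auto simp: dist_norm)
  qed
  have openT: "open (T ` U)" if "open U" for U
    using that by (rule open_surjective_linear_image[OF _ T surj])
  have open_case: "ennreal ?\<kappa> * emeasure lborel U \<le> emeasure lborel (T ` U)" if U: "open U" for U
  proof -
    \<comment> \<open>Centres and radii of all balls inside \<open>U\<close>. They contain
      arbitrarily small balls around every point of \<open>U\<close>, as Vitali's covering theorem
      requires.\<close>
    define K where "K = {(a, r::real). r > 0 \<and> ball a r \<subseteq> U}"
    have cover: "\<exists>i. i \<in> K \<and> x \<in> ball (fst i) (snd i) \<and> snd i < d" if "x \<in> U" "0 < d" for x d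
    proof -
      obtain e where e: "e > 0" "ball x e \<subseteq> U" using U \<open>x \<in> U\<close> open_contains_ball by blast
      have "(x, min e (d/2)) \<in> K" using e \<open>0 < d\<close> unfolding K_def by auto
      then show ?thesis using e \<open>0 < d\<close> by (intro exI[of _ "(x, min e (d/2))"]) auto
    qed
    obtain C where C: "countable C" "C \<subseteq> K"
      "pairwise (\<lambda>i j. disjnt (ball (fst i) (snd i)) (ball (fst j) (snd j))) C"
      "negligible (U - (\<Union>i\<in>C. ball (fst i) (snd i)))"
      by (rule Vitali_covering_theorem_balls[of U K fst snd, OF cover])
    let ?V = "\<Union>i\<in>C. ball (fst i) (snd i)"
    have VU: "?V \<subseteq> U" using C(2) by (force simp: K_def)
    have oV: "open ?V" by auto
    have "U - ?V \<in> null_sets lborel"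
    proof -
      have "U - ?V \<in> sets lborel" using U oV by auto
      then show ?thesis
        using C(4) by (simp add: negligible_iff_null_sets null_sets_completion_iff)
    qed
    then have "emeasure lborel U = emeasure lborel (?V \<union> (U - ?V))" using VU by (simp add: Un_absorb1)
    also have "\<dots> = emeasure lborel ?V"
      using \<open>U - ?V \<in> null_sets lborel\<close> oV by (intro emeasure_Un_null_set) auto
    also have "\<dots> = (\<integral>\<^sup>+i. emeasure lborel (ball (fst i) (snd i)) \<partial>count_space C)"
      using C(1,3) by (intro emeasure_UN_countable)
        (auto simp: disjoint_family_on_def pairwise_def disjnt_def)
    finally have eU: "emeasure lborel U = (\<integral>\<^sup>+i. emeasure lborel (ball (fst i) (snd i)) \<partial>count_space C)" .
    have "ennreal ?\<kappa> * emeasure lborel U = (\<integral>\<^sup>+i. ennreal ?\<kappa> * emeasure lborel (ball (fst i) (snd i)) \<partial>count_space C)"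
      unfolding eU by (simp add: nn_integral_cmult)
    also have "\<dots> \<le> (\<integral>\<^sup>+i. emeasure lborel (T ` ball (fst i) (snd i)) \<partial>count_space C)"
    proof (rule nn_integral_mono)
      fix i assume "i \<in> space (count_space C)"
      then have r: "snd i > 0" using C(2) by (auto simp: K_def)
      have "ennreal ?\<kappa> * emeasure lborel (ball (fst i) (snd i)) = emeasure lborel (ball (T (fst i)) ((1 - q) * snd i))"
        using r q by (simp add: emeasure_ball ennreal_mult[symmetric] power_mult_distrib mult_ac)
      also have "\<dots> \<le> emeasure lborel (T ` ball (fst i) (snd i))"
        using openT[of "ball (fst i) (snd i)"] by (intro emeasure_mono balls) auto
      finally show "ennreal ?\<kappa> * emeasure lborel (ball (fst i) (snd i)) \<le> emeasure lborel (T ` ball (fst i) (snd i))" .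
    qed
    also have "\<dots> = emeasure lborel (\<Union>i\<in>C. T ` ball (fst i) (snd i))"
    proof (intro emeasure_UN_countable[symmetric])
      show "disjoint_family_on (\<lambda>i. T ` ball (fst i) (snd i)) C"
        using C(3) by (auto simp: disjoint_family_on_def pairwise_def disjnt_def image_Int[OF inj, symmetric])
      show "T ` ball (fst i) (snd i) \<in> sets lborel" for i
        using openT[of "ball (fst i) (snd i)"] by auto
    qed (rule C)
    also have "\<dots> \<le> emeasure lborel (T ` U)"
      using VU openT[OF U] by (intro emeasure_mono) auto
    finally show ?thesis .
  qed
  show ?thesis
    unfolding vol_ge_def
  proof (intro allI impI)
    fix A :: "'a set" assume A: "compact A"
    have TA: "compact (T ` A)" using A contT by (intro compact_continuous_image)
    \<comment> \<open>From open to compact sets by outer regularity on the image side: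
      \<open>U\<close> is open and slightly larger than the image of \<open>A\<close>, and the open
      case is applied to its preimage, whose image is exactly \<open>U\<close> by
      surjectivity.\<close>
    have eps: "ennreal ?\<kappa> * emeasure lborel A \<le> emeasure lborel (T ` A) + ennreal e" if e: "e > 0" for e
    proof -
      obtain U where U: "open U" "T ` A \<subseteq> U" "emeasure lborel (U - T ` A) < e"
        using outer_regular_lborel[OF borel_compact[OF TA] e] by metis
      have op: "open (T -` U)" using U(1) contT by (intro open_vimage) auto
      have "ennreal ?\<kappa> * emeasure lborel A \<le> ennreal ?\<kappa> * emeasure lborel (T -` U)"
        using U op by (intro mult_left_mono emeasure_mono) auto
      also have "\<dots> \<le> emeasure lborel (T ` (T -` U))" by (rule open_case[OF op])
      also have "T ` (T -` U) = U" using surj by (simp add: surj_image_vimage_eq)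
      also have "emeasure lborel U = emeasure lborel (T ` A \<union> (U - T ` A))" using U by (simp add: Un_absorb1)
      also have "\<dots> \<le> emeasure lborel (T ` A) + emeasure lborel (U - T ` A)"
        using U borel_compact[OF TA] by (intro emeasure_subadditive) auto
      also have "\<dots> \<le> emeasure lborel (T ` A) + ennreal e" using U by (intro add_left_mono) auto
      finally show ?thesis .
    qed
    show "ennreal ?\<kappa> * emeasure lborel A \<le> emeasure lborel (T ` A)"
      by (rule ennreal_le_epsilon) (rule eps)
  qed
qed

section \<open>Convergence of splitting schemes\<close>

text \<open>Consistency of order one: a step differs from the Euler step by O(h^2), uniformly on
  balls. No reference is made to the exact flow.\<close>

definition consistent :: "(real \<Rightarrow> 'a \<Rightarrow> 'a) \<Rightarrow> ('a::real_normed_vector \<Rightarrow> 'a) \<Rightarrow> bool" where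
  "consistent S F \<longleftrightarrow>
     (\<forall>R. \<exists>C\<ge>0. \<exists>h\<^sub>0>0. \<forall>h y. 0 \<le> h \<longrightarrow> h \<le> h\<^sub>0 \<longrightarrow> norm y \<le> R \<longrightarrow>
        norm (S h y - y - h *\<^sub>R F y) \<le> C * h\<^sup>2)"

lemma consistentE:
  assumes "consistent S F"
  obtains C h\<^sub>0 where "C \<ge> 0" "h\<^sub>0 > 0"
    "\<And>h y. 0 \<le> h \<Longrightarrow> h \<le> h\<^sub>0 \<Longrightarrow> norm y \<le> R \<Longrightarrow> norm (S h y - y - h *\<^sub>R F y) \<le> C * h\<^sup>2"
  using assms unfolding consistent_def by metis

lemma consistent_euler: "consistent (\<lambda>h y. y + h *\<^sub>R F y) F"
  unfolding consistent_def by (auto intro!: exI[of _ 0] exI[of _ 1])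

text \<open>Lie splitting: \<open>S h y\<close> differs from \<open>y\<close> by O(h), so evaluating
  \<open>F'\<close> there instead of at \<open>y\<close> costs only h times L times O(h).\<close>

lemma consistent_compose:
  fixes F F' :: "'a::real_normed_vector \<Rightarrow> 'a"
  assumes S: "consistent S F" and S': "consistent S' F'" and F: "llip F" and F': "llip F'"
  shows "consistent (\<lambda>h y. S' h (S h y)) (\<lambda>y. F y + F' y)"
  unfolding consistent_def
proof (intro allI)
  fix R :: real
  obtain C h0 where C: "C \<ge> 0" "h0 > 0"
    "\<And>h y. 0 \<le> h \<Longrightarrow> h \<le> h0 \<Longrightarrow> norm y \<le> R \<Longrightarrow> norm (S h y - y - h *\<^sub>R F y) \<le> C * h\<^sup>2"
    using consistentE[OF S] by metis
  obtain C' h0' where C': "C' \<ge> 0" "h0' > 0"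
    "\<And>h y. 0 \<le> h \<Longrightarrow> h \<le> h0' \<Longrightarrow> norm y \<le> R + 1 \<Longrightarrow> norm (S' h y - y - h *\<^sub>R F' y) \<le> C' * h\<^sup>2"
    using consistentE[OF S'] by metis
  obtain B where B: "B \<ge> 0" "\<And>x. norm x \<le> R \<Longrightarrow> norm (F x) \<le> B" using llip_bounded[OF F] by metis
  obtain L where L: "L \<ge> 0" "\<And>x y. norm x \<le> R + 1 \<Longrightarrow> norm y \<le> R + 1 \<Longrightarrow> norm (F' x - F' y) \<le> L * norm (x - y)"
    using llipE[OF F'] by metis
  \<comment> \<open>The bound \<open>1 / (C + B + 1)\<close> keeps \<open>S h y\<close> within
    distance 1 of \<open>y\<close>, hence in the ball of radius R + 1 on which \<open>C'\<close> and
    \<open>L\<close> are valid; h \<le> 1 allows h^2 to be replaced by h.\<close>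
  define h1 where "h1 = min (min h0 h0') (min 1 (1 / (C + B + 1)))"
  have CB: "C + B + 1 > 0" using C B by simp
  have h1: "h1 > 0" using C C' CB by (simp add: h1_def)
  have main: "norm (S' h (S h y) - y - h *\<^sub>R (F y + F' y)) \<le> (C' + C + L * (C + B)) * h\<^sup>2"
    if h: "0 \<le> h" "h \<le> h1" and y: "norm y \<le> R" for h y
  proof -
    have hs: "h \<le> h0" "h \<le> h0'" "h \<le> 1" "h \<le> 1 / (C + B + 1)" using h by (auto simp: h1_def)
    have e1: "norm (S h y - y - h *\<^sub>R F y) \<le> C * h\<^sup>2" using C(3) h hs y by auto
    have "norm (S h y - y) \<le> norm (S h y - y - h *\<^sub>R F y) + norm (h *\<^sub>R F y)"
      by (metis diff_add_cancel norm_triangle_ineq)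
    also have "\<dots> \<le> C * h\<^sup>2 + h * B" using e1 B(2)[OF y] h by (intro add_mono) (auto intro!: mult_left_mono)
    also have "\<dots> \<le> C * h + h * B"
      using C h hs by (auto intro!: mult_left_mono simp: power2_eq_square mult_left_le_one_le)
    also have "\<dots> = (C + B) * h" by (simp add: algebra_simps)
    finally have d: "norm (S h y - y) \<le> (C + B) * h" .
    also have "\<dots> \<le> (C + B + 1) * (1 / (C + B + 1))"
      using hs C B h by (intro mult_mono) auto
    also have "\<dots> = 1" using CB by simp
    finally have d1: "norm (S h y - y) \<le> 1" .
    have Sy: "norm (S h y) \<le> R + 1"
      using d1 y norm_triangle_ineq[of "S h y - y" y] by simp
    have e2: "norm (S' h (S h y) - S h y - h *\<^sub>R F' (S h y)) \<le> C' * h\<^sup>2" using C'(3) h hs Sy by auto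
    have "norm (F' (S h y) - F' y) \<le> L * norm (S h y - y)" using Sy y by (intro L) auto
    also have "\<dots> \<le> L * ((C + B) * h)" using d L by (intro mult_left_mono) auto
    finally have "h * norm (F' (S h y) - F' y) \<le> h * (L * ((C + B) * h))" using h by (intro mult_left_mono) auto
    then have e3: "norm (h *\<^sub>R (F' (S h y) - F' y)) \<le> L * (C + B) * h\<^sup>2"
      using h by (simp add: power2_eq_square mult_ac)
    have "S' h (S h y) - y - h *\<^sub>R (F y + F' y) = (S' h (S h y) - S h y - h *\<^sub>R F' (S h y))
        + (S h y - y - h *\<^sub>R F y) + h *\<^sub>R (F' (S h y) - F' y)"
      by (simp add: algebra_simps)
    also have "norm \<dots> \<le> C' * h\<^sup>2 + C * h\<^sup>2 + L * (C + B) * h\<^sup>2"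
      using e1 e2 e3 by (intro norm_triangle_mono)
    finally show ?thesis by (simp add: algebra_simps)
  qed
  show "\<exists>C\<ge>0. \<exists>h\<^sub>0>0. \<forall>h y. 0 \<le> h \<longrightarrow> h \<le> h\<^sub>0 \<longrightarrow> norm y \<le> R \<longrightarrow>
      norm (S' h (S h y) - y - h *\<^sub>R (F y + F' y)) \<le> C * h\<^sup>2"
    using main h1 C(1) C'(1) L(1) B(1)
    by (intro exI[of _ "C' + C + L * (C + B)"] conjI exI[of _ h1]) auto
qed

text \<open>No stability of \<open>S\<close> is assumed: each step is compared with the Euler step
  from the same point, and the Lipschitz bound on \<open>F\<close> controls the propagation. The
  constants hold on the ball of radius R + 1 only, and it is the error bound itself that keeps the
  iterates there. Uniformity over \<open>K\<close> is what makes the result usable for images of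
  sets.\<close>

lemma splitting_converges:
  fixes F :: "'a::euclidean_space \<Rightarrow> 'a"
  assumes F: "llip F" and S: "consistent S F" and T: "0 \<le> T" and e: "0 < e"
    and \<Phi>0: "\<And>y. y \<in> K \<Longrightarrow> \<Phi> y 0 = y"
    and \<Phi>: "\<And>y t. y \<in> K \<Longrightarrow> 0 \<le> t \<Longrightarrow> t \<le> T \<Longrightarrow> (\<Phi> y has_vector_derivative F (\<Phi> y t)) (at t within {0..})"
    and R: "\<And>y t. y \<in> K \<Longrightarrow> 0 \<le> t \<Longrightarrow> t \<le> T \<Longrightarrow> norm (\<Phi> y t) \<le> R"
  shows "\<exists>m>0. \<forall>n\<ge>m. \<forall>y\<in>K. norm ((S (T / real n) ^^ n) y - \<Phi> y T) \<le> e"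
proof -
  obtain C h0 where C: "C \<ge> 0" "h0 > 0"
    "\<And>h y. 0 \<le> h \<Longrightarrow> h \<le> h0 \<Longrightarrow> norm y \<le> R + 1 \<Longrightarrow> norm (S h y - y - h *\<^sub>R F y) \<le> C * h\<^sup>2"
    using consistentE[OF S] by metis
  obtain L where L: "L \<ge> 0" "\<And>x y. norm x \<le> R + 1 \<Longrightarrow> norm y \<le> R + 1 \<Longrightarrow> norm (F x - F y) \<le> L * norm (x - y)"
    using llipE[OF F] by metis
  obtain B where B: "B \<ge> 0" "\<And>x. norm x \<le> R + 1 \<Longrightarrow> norm (F x) \<le> B" using llip_bounded[OF F] by metis
  \<comment> \<open>\<open>C\<close> is the error constant of a step of \<open>S\<close>, and
    \<open>L * B\<close> that of the Euler step along the exact solution. At most T / h steps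
    accumulate to a total error \<open>h * W\<close>; the choice of \<delta> makes this at most e,
    for the claim, and at most 1, for staying in the larger ball.\<close>
  define C' where "C' = C + L * B"
  have C': "C' \<ge> 0" using C L B by (simp add: C'_def)
  define W where "W = C' * T * exp (L * T)"
  have W: "W \<ge> 0" using C' T by (simp add: W_def)
  define \<delta> where "\<delta> = min h0 (min e 1 / (W + 1))"
  have \<delta>: "\<delta> > 0" using C e W by (simp add: \<delta>_def)
  obtain m :: nat where m: "T / \<delta> < real m" "m > 0"
    by (metis gr0I of_nat_0_less_iff reals_Archimedean2 T \<delta> divide_nonneg_pos not_le of_nat_0 order_less_le_trans)
  have main: "norm ((S (T / real n) ^^ n) y - \<Phi> y T) \<le> e" if n: "n \<ge> m" and y: "y \<in> K" for n y
  proof -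
    define h where "h = T / real n"
    have npos: "real n > 0" using n m by simp
    have h: "0 \<le> h" using T npos by (simp add: h_def)
    have nh: "real n * h = T" using npos by (simp add: h_def)
    have "T < \<delta> * real n"
      using m n \<delta> by (metis less_le_trans mult.commute of_nat_le_iff pos_divide_less_eq)
    then have h\<delta>: "h \<le> \<delta>" using npos by (simp add: h_def field_simps)
    then have hh0: "h \<le> h0" by (simp add: \<delta>_def)
    have hW: "h * W \<le> min e 1"
    proof -
      have "h * W \<le> \<delta> * (W + 1)" using h\<delta> h W by (intro mult_mono) auto
      also have "\<dots> \<le> min e 1 / (W + 1) * (W + 1)" using W by (intro mult_right_mono) (auto simp: \<delta>_def)
      also have "\<dots> = min e 1" using W by simp
      finally show ?thesis .
    qed
    have bd: "C' * h\<^sup>2 * real k * (1 + h * L) ^ k \<le> min e 1" if k: "k \<le> n" for k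
    proof -
      have kh: "real k * h \<le> T" using k h nh by (metis mult_right_mono of_nat_le_iff)
      have "(1 + h * L) ^ k \<le> exp (h * L) ^ k"
        using h L by (intro power_mono) (auto simp: add.commute)
      also have "\<dots> = exp (L * (real k * h))" by (simp add: exp_of_nat_mult[symmetric] mult_ac)
      also have "\<dots> \<le> exp (L * T)" using kh L by (auto intro!: mult_left_mono)
      finally have p: "(1 + h * L) ^ k \<le> exp (L * T)" .
      have "C' * h\<^sup>2 * real k * (1 + h * L) ^ k = (C' * h) * (real k * h) * (1 + h * L) ^ k"
        by (simp add: power2_eq_square)
      also have "\<dots> \<le> (C' * h) * T * exp (L * T)"
        using C' h kh p T L by (intro mult_mono) auto
      also have "\<dots> = h * W" by (simp add: W_def)
      finally show ?thesis using hW by simp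
    qed
    \<comment> \<open>The induction hypothesis, being at most 1 by \<open>bd\<close>, places the
      iterate in the ball of radius R + 1, which licenses the estimates for the next step.\<close>
    have "norm ((S h ^^ k) y - \<Phi> y (real k * h)) \<le> C' * h\<^sup>2 * real k * (1 + h * L) ^ k" if "k \<le> n" for k
      using that
    proof (induction k)
      case 0
      then show ?case using \<Phi>0[OF y] by simp
    next
      case (Suc k)
      define u where "u = (S h ^^ k) y"
      define a where "a = real k * h"
      define b where "b = real (Suc k) * h"
      define p where "p = \<Phi> y a"
      have ab: "0 \<le> a" "a \<le> b" "b - a = h" "b \<le> T"
        using h Suc.prems mult_right_mono[of "real (Suc k)" "real n" h] nh by (auto simp: a_def b_def algebra_simps)
      have IH: "norm (u - p) \<le> C' * h\<^sup>2 * real k * (1 + h * L) ^ k"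
        using Suc by (simp add: u_def p_def a_def)
      also have "\<dots> \<le> 1" using bd[of k] Suc.prems by simp
      finally have up1: "norm (u - p) \<le> 1" .
      have pR: "norm p \<le> R" unfolding p_def using ab by (intro R y) auto
      have uR: "norm u \<le> R + 1" using up1 pR norm_triangle_ineq[of "u - p" p] by simp
      have e1: "norm (S h u - u - h *\<^sub>R F u) \<le> C * h\<^sup>2" by (rule C(3)[OF h hh0 uR])
      have e2: "norm (h *\<^sub>R (F u - F p)) \<le> h * (L * norm (u - p))"
        using L(2)[OF uR, of p] pR h by (auto intro!: mult_left_mono)
      have inR: "norm (\<Phi> y s) \<le> R + 1" if "s \<in> {a..b}" for s
        using R[OF y, of s] that ab by auto
      have near: "norm (\<Phi> y s - p) \<le> B * (s - a)" if s: "s \<in> {a..b}" for s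
        unfolding p_def
        by (rule vector_derivative_increment_bound[where y'="\<lambda>s. F (\<Phi> y s)"]) (use s ab y inR in \<open>auto intro!: B \<Phi>\<close>)
      \<comment> \<open>Subtracting the linear part leaves a curve with derivative of size
        \<open>L * B * h\<close>, hence an increment of order h^2.\<close>
      have "norm ((\<Phi> y b - (b - a) *\<^sub>R F p) - (\<Phi> y a - (a - a) *\<^sub>R F p)) \<le> (L * (B * h)) * (b - a)"
      proof (rule vector_derivative_increment_bound[where y'="\<lambda>s. F (\<Phi> y s) - F p"])
        fix s assume s: "s \<in> {a..b}"
        show "((\<lambda>s. \<Phi> y s - (s - a) *\<^sub>R F p) has_vector_derivative F (\<Phi> y s) - F p) (at s within {0..})"
          using s ab by (auto intro!: derivative_eq_intros \<Phi> y)
        have "norm (F (\<Phi> y s) - F p) \<le> L * norm (\<Phi> y s - p)" using inR[OF s] pR by (intro L) auto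
        also have "\<dots> \<le> L * (B * h)"
        proof (intro mult_left_mono L)
          have "B * (s - a) \<le> B * h" using s ab B by (intro mult_left_mono) auto
          then show "norm (\<Phi> y s - p) \<le> B * h" using near[OF s] by simp
        qed
        finally show "norm (F (\<Phi> y s) - F p) \<le> L * (B * h)" .
      qed (use ab in auto)
      then have e3: "norm (\<Phi> y b - p - h *\<^sub>R F p) \<le> L * B * h\<^sup>2"
        using ab by (simp add: p_def power2_eq_square algebra_simps)
      \<comment> \<open>The four terms are the error of the scheme at the iterate, the error
        inherited from the previous step, the change of the Euler increment, and the defect of the
        exact solution.\<close>
      have "S h u - \<Phi> y b = (S h u - u - h *\<^sub>R F u) + (u - p) + h *\<^sub>R (F u - F p) - (\<Phi> y b - p - h *\<^sub>R F p)"
        by (simp add: algebra_simps)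
      also have "norm \<dots> \<le> C * h\<^sup>2 + norm (u - p) + h * (L * norm (u - p)) + L * B * h\<^sup>2"
        using e1 e2 e3 norm_triangle_ineq4[of "(S h u - u - h *\<^sub>R F u) + (u - p) + h *\<^sub>R (F u - F p)" "\<Phi> y b - p - h *\<^sub>R F p"]
          norm_triangle_ineq[of "(S h u - u - h *\<^sub>R F u) + (u - p)" "h *\<^sub>R (F u - F p)"]
          norm_triangle_ineq[of "S h u - u - h *\<^sub>R F u" "u - p"] by linarith
      also have "\<dots> = C' * h\<^sup>2 * 1 + (1 + h * L) * norm (u - p)" by (simp add: C'_def algebra_simps)
      also have "\<dots> \<le> C' * h\<^sup>2 * (1 + h * L) ^ Suc k + (1 + h * L) * (C' * h\<^sup>2 * real k * (1 + h * L) ^ k)"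
        using C' h L IH by (intro add_mono mult_left_mono one_le_power) auto
      also have "\<dots> = C' * h\<^sup>2 * real (Suc k) * (1 + h * L) ^ Suc k" by (simp add: algebra_simps)
      finally show ?case by (simp add: u_def b_def)
    qed
    from this[of n] bd[of n] nh show ?thesis by (simp add: h_def)
  qed
  then show ?thesis using m by blast
qed

section \<open>Flows of compact sets and passage of the volume bound to the limit\<close>

lemma flow_lipschitz_in_data:
  fixes F :: "'a::euclidean_space \<Rightarrow> 'a"
  assumes F: "llip F"
    and \<Phi>0: "\<And>y. y \<in> K \<Longrightarrow> \<Phi> y 0 = y"
    and \<Phi>: "\<And>y t. y \<in> K \<Longrightarrow> 0 \<le> t \<Longrightarrow> t \<le> T \<Longrightarrow> (\<Phi> y has_vector_derivative F (\<Phi> y t)) (at t within {0..})"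
    and R: "\<And>y t. y \<in> K \<Longrightarrow> 0 \<le> t \<Longrightarrow> t \<le> T \<Longrightarrow> norm (\<Phi> y t) \<le> R"
  shows "\<exists>C\<ge>0. \<forall>y\<in>K. \<forall>z\<in>K. \<forall>t\<in>{0..T}. norm (\<Phi> y t - \<Phi> z t) \<le> C * norm (y - z)"
proof -
  obtain L where L: "L \<ge> 0" "\<And>x y. norm x \<le> R \<Longrightarrow> norm y \<le> R \<Longrightarrow> norm (F x - F y) \<le> L * norm (x - y)"
    using llipE[OF F] by metis
  show ?thesis
  proof (intro exI[of _ "exp (L * T)"] conjI ballI)
    fix y z t assume yz: "y \<in> K" "z \<in> K" and "t \<in> {0..T}"
    then have t: "0 \<le> t" "t \<le> T" by auto
    have "norm (\<Phi> y t - \<Phi> z t) \<le> exp (L * t) * norm (\<Phi> y 0 - \<Phi> z 0)"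
      by (rule trajectories_distance(1)[where F=F and R=R]) (use yz t \<Phi> R L(2) in auto)
    also have "\<dots> \<le> exp (L * T) * norm (\<Phi> y 0 - \<Phi> z 0)"
      using t L by (intro mult_right_mono) (auto intro!: mult_left_mono)
    finally show "norm (\<Phi> y t - \<Phi> z t) \<le> exp (L * T) * norm (y - z)" using yz \<Phi>0 by simp
  qed simp
qed

lemma compact_flow_image:
  fixes F :: "'a::euclidean_space \<Rightarrow> 'a"
  assumes F: "llip F" and T: "0 \<le> T" and K: "compact K"
    and \<Phi>0: "\<And>y. y \<in> K \<Longrightarrow> \<Phi> y 0 = y"
    and \<Phi>: "\<And>y t. y \<in> K \<Longrightarrow> 0 \<le> t \<Longrightarrow> t \<le> T \<Longrightarrow> (\<Phi> y has_vector_derivative F (\<Phi> y t)) (at t within {0..})"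
    and R: "\<And>y t. y \<in> K \<Longrightarrow> 0 \<le> t \<Longrightarrow> t \<le> T \<Longrightarrow> norm (\<Phi> y t) \<le> R"
  shows "compact ((\<lambda>y. \<Phi> y T) ` K)"
proof -
  have "\<exists>C\<ge>0. \<forall>y\<in>K. \<forall>z\<in>K. \<forall>t\<in>{0..T}. norm (\<Phi> y t - \<Phi> z t) \<le> C * norm (y - z)"
    by (rule flow_lipschitz_in_data[OF F]) (auto intro: \<Phi>0 \<Phi> R)
  then obtain C where C: "C \<ge> 0" "\<And>y z t. y \<in> K \<Longrightarrow> z \<in> K \<Longrightarrow> t \<in> {0..T} \<Longrightarrow> norm (\<Phi> y t - \<Phi> z t) \<le> C * norm (y - z)"
    by blast
  have "continuous_on K (\<lambda>y. \<Phi> y T)"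
    using C T by (intro lipschitz_on_continuous_on[of C] lipschitz_onI) (auto simp: dist_norm)
  then show ?thesis using K by (rule compact_continuous_image)
qed

text \<open>The scheme does not decrease volume and converges uniformly on \<open>K\<close>, so its
  image of \<open>K\<close> eventually lies in any given open neighbourhood of the compact image
  under the flow. Outer regularity then passes the lower bound to the limit; convergence of
  Jacobians is not involved.\<close>

lemma flow_volume_nondecreasing:
  fixes F :: "'a::euclidean_space \<Rightarrow> 'a"
  assumes F: "llip F" and S: "consistent S F" and T: "0 \<le> T" and K: "compact K"
    and \<Phi>0: "\<And>y. y \<in> K \<Longrightarrow> \<Phi> y 0 = y"
    and \<Phi>: "\<And>y t. y \<in> K \<Longrightarrow> 0 \<le> t \<Longrightarrow> t \<le> T \<Longrightarrow> (\<Phi> y has_vector_derivative F (\<Phi> y t)) (at t within {0..})"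
    and R: "\<And>y t. y \<in> K \<Longrightarrow> 0 \<le> t \<Longrightarrow> t \<le> T \<Longrightarrow> norm (\<Phi> y t) \<le> R"
    and h0: "0 < h\<^sub>0"
    and cont: "\<And>h. 0 \<le> h \<Longrightarrow> h \<le> h\<^sub>0 \<Longrightarrow> continuous_on UNIV (S h)"
    and vol: "\<And>h. 0 \<le> h \<Longrightarrow> h \<le> h\<^sub>0 \<Longrightarrow> vol_ge 1 (S h)"
  shows "emeasure lborel K \<le> emeasure lborel ((\<lambda>y. \<Phi> y T) ` K)"
proof -
  let ?Q = "(\<lambda>y. \<Phi> y T) ` K"
  have Q: "compact ?Q" by (rule compact_flow_image[OF F T K \<Phi>0 \<Phi> R])
  show ?thesis
  proof (rule ennreal_le_epsilon)
    fix e :: real assume e: "0 < e"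
    obtain U where U: "open U" "?Q \<subseteq> U" "emeasure lborel (U - ?Q) < e"
      using outer_regular_lborel[OF borel_compact[OF Q] e] by metis
    obtain \<epsilon> where \<epsilon>: "\<epsilon> > 0" "(\<Union>x\<in>?Q. cball x \<epsilon>) \<subseteq> U"
      using compact_subset_open_imp_cball_epsilon_subset[OF Q U(1,2)] by metis
    have "\<exists>m>0. \<forall>n\<ge>m. \<forall>y\<in>K. norm ((S (T / real n) ^^ n) y - \<Phi> y T) \<le> \<epsilon>"
      by (rule splitting_converges[OF F S T \<epsilon>(1)]) (auto intro: \<Phi>0 \<Phi> R)
    then obtain m where m: "m > 0" "\<And>n y. n \<ge> m \<Longrightarrow> y \<in> K \<Longrightarrow> norm ((S (T / real n) ^^ n) y - \<Phi> y T) \<le> \<epsilon>"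
      by blast
    \<comment> \<open>\<open>m'\<close> brings the step size below \<open>h\<^sub>0\<close>, the
      range in which the scheme is known to be continuous and volume nondecreasing.\<close>
    obtain m' :: nat where m': "T / h\<^sub>0 < real m'" using reals_Archimedean2 by blast
    define n where "n = max m m'"
    define h where "h = T / real n"
    have n: "n \<ge> m" "n \<ge> m'" "real n > 0" using m by (auto simp: n_def)
    have "T < h\<^sub>0 * real n"
      using m' n h0 by (metis less_le_trans mult.commute of_nat_le_iff pos_divide_less_eq)
    then have h: "0 \<le> h" "h \<le> h\<^sub>0" using n T by (auto simp: h_def field_simps)
    have "compact ((S h ^^ k) ` K) \<and> emeasure lborel K \<le> emeasure lborel ((S h ^^ k) ` K)" for k
    proof (induction k)
      case (Suc k)
      have eq: "(S h ^^ Suc k) ` K = S h ` (S h ^^ k) ` K" by (simp add: image_comp)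
      have "compact ((S h ^^ Suc k) ` K)"
        unfolding eq using Suc by (intro compact_continuous_image[OF continuous_on_subset[OF cont[OF h]]]) auto
      moreover have "emeasure lborel ((S h ^^ k) ` K) \<le> emeasure lborel ((S h ^^ Suc k) ` K)"
        unfolding eq using vol[OF h] Suc by (auto simp: vol_ge_def)
      ultimately show ?case using Suc by auto
    qed (use K in auto)
    then have "emeasure lborel K \<le> emeasure lborel ((S h ^^ n) ` K)" by blast
    also have "\<dots> \<le> emeasure lborel U"
    proof (rule emeasure_mono)
      show "(S h ^^ n) ` K \<subseteq> U"
      proof (rule image_subsetI)
        fix y assume y: "y \<in> K"
        have "(S h ^^ n) y \<in> cball (\<Phi> y T) \<epsilon>" using m(2)[OF n(1) y] by (simp add: h_def dist_norm norm_minus_commute)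
        then show "(S h ^^ n) y \<in> U" using \<epsilon>(2) y by blast
      qed
    qed (use U in auto)
    also have "emeasure lborel U = emeasure lborel (?Q \<union> (U - ?Q))" using U by (simp add: Un_absorb1)
    also have "\<dots> \<le> emeasure lborel ?Q + emeasure lborel (U - ?Q)"
      using U borel_compact[OF Q] by (intro emeasure_subadditive) auto
    also have "\<dots> \<le> emeasure lborel ?Q + ennreal e" using U by (intro add_left_mono) auto
    finally show "emeasure lborel K \<le> emeasure lborel ?Q + ennreal e" .
  qed
qed


section \<open>Volume contraction by alignment\<close>

text \<open>The set is \<open>K\<close> times an interval, with the product bracketed to the right
  as in the extended phase space; hence the computation by fibres over \<open>x\<close>.\<close>

lemma compact_pairs_times_interval:
  fixes K :: "('a::euclidean_space \<times> 'b::euclidean_space) set"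
  assumes K: "compact K" and a: "0 \<le> (a::real)"
  shows "compact {(x, v, w). (x, v) \<in> K \<and> w \<in> {0..a}}"
    and "emeasure lborel {(x, v, w). (x, v) \<in> K \<and> w \<in> {0..a}} = ennreal a * emeasure lborel K"
proof -
  let ?A = "{(x, v, w). (x, v) \<in> K \<and> w \<in> {0..a}}"
  have "?A = (\<lambda>((x, v), w). (x, v, w)) ` (K \<times> {0..a})" by force
  also have "compact \<dots>"
    by (intro compact_continuous_image compact_Times K) (auto simp: case_prod_beta intro!: continuous_intros)
  finally show A: "compact ?A" .
  have "emeasure lborel ?A = (\<integral>\<^sup>+x. emeasure lborel (Pair x -` ?A) \<partial>lborel)"
    by (rule emeasure_fibres(1)[OF borel_compact[OF A]])
  also have "\<dots> = (\<integral>\<^sup>+x. ennreal a * emeasure lborel (Pair x -` K) \<partial>lborel)"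
  proof (rule nn_integral_cong)
    fix x
    have "Pair x -` K \<in> sets borel"
      using measurable_sets_borel[of "Pair x" borel K] borel_compact[OF K] by simp
    then have "emeasure (lborel \<Otimes>\<^sub>M lborel) ((Pair x -` K) \<times> {0..a}) = emeasure lborel (Pair x -` K) * emeasure lborel {0..a}"
      by (intro lborel.emeasure_pair_measure_Times) auto
    moreover have "Pair x -` ?A = (Pair x -` K) \<times> {0..a}" by auto
    ultimately show "emeasure lborel (Pair x -` ?A) = ennreal a * emeasure lborel (Pair x -` K)"
      using a by (simp add: lborel_prod mult.commute)
  qed
  also have "\<dots> = ennreal a * emeasure lborel K"
    using emeasure_fibres[OF borel_compact[OF K]] by (simp add: nn_integral_cmult)
  finally show "emeasure lborel ?A = ennreal a * emeasure lborel K" .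
qed

text \<open>The contraction of volume is recorded in an additional coordinate \<open>w\<close> with
  \<open>w' = c \<rho>(x) w\<close>: the flow of the extended system does not decrease volume, because each of the
  three Euler steps below does not. No derivative of the force \<open>f\<close> enters.\<close>

lemma alignment_volume_lower_bound:
  fixes A :: "'e::euclidean_space \<Rightarrow> 'e \<Rightarrow> 'e" and f :: "'e \<Rightarrow> 'e" and \<rho> :: "'e \<Rightarrow> real"
  assumes lin: "\<And>x. linear (A x)" and A: "\<And>x v. norm (A x v) \<le> k * \<rho> x * norm v"
    and \<rho>: "\<And>x. 0 \<le> \<rho> x" "\<And>x. \<rho> x \<le> P" and k: "0 \<le> k"
    and llip: "llip (\<lambda>z. A (fst z) (snd z))" "llip f" "llip \<rho>"
    and K: "compact K" and T: "0 \<le> T"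
    and \<Phi>0: "\<And>z. z \<in> K \<Longrightarrow> \<Phi> z 0 = z"
    and \<Phi>: "\<And>z t. z \<in> K \<Longrightarrow> 0 \<le> t \<Longrightarrow>
      (\<Phi> z has_vector_derivative (snd (\<Phi> z t), A (fst (\<Phi> z t)) (snd (\<Phi> z t)) + f (fst (\<Phi> z t)))) (at t within {0..})"
    and R: "\<And>z t. z \<in> K \<Longrightarrow> 0 \<le> t \<Longrightarrow> norm (\<Phi> z t) \<le> R"
    and M: "\<And>z. z \<in> K \<Longrightarrow> integral {0..T} (\<lambda>s. \<rho> (fst (\<Phi> z s))) \<le> M"
  shows "emeasure lborel K \<le> ennreal (exp (2 * k * DIM('e) * M)) * emeasure lborel ((\<lambda>z. \<Phi> z T) ` K)"
proof -
  define D where "D = real DIM('e)"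
  have D: "D > 0" by (simp add: D_def)
  \<comment> \<open>Each of the \<open>D\<close> velocity directions contracts at rate at most
    \<open>k * \<rho> x\<close>. The rate \<open>c\<close> of the additional coordinate is twice the
    sum, and the surplus absorbs the second-order terms of a discrete step.\<close>
  define c where "c = 2 * k * D"
  have c: "c \<ge> 0" using k D by (simp add: c_def)
  have P: "P \<ge> 0" using \<rho>[of 0] by linarith
  define F1 :: "'e \<times> 'e \<times> real \<Rightarrow> 'e \<times> 'e \<times> real" where "F1 = (\<lambda>y. (fst (snd y), 0, 0))"
  define F2 :: "'e \<times> 'e \<times> real \<Rightarrow> 'e \<times> 'e \<times> real" where "F2 = (\<lambda>y. (0, f (fst y), 0))"
  define F3 :: "'e \<times> 'e \<times> real \<Rightarrow> 'e \<times> 'e \<times> real"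
    where "F3 = (\<lambda>y. (0, A (fst y) (fst (snd y)), (c * \<rho> (fst y)) * snd (snd y)))"
  have projs: "llip (\<lambda>y::'e \<times> 'e \<times> real. fst y)" "llip (\<lambda>y::'e \<times> 'e \<times> real. fst (snd y))"
    "llip (\<lambda>y::'e \<times> 'e \<times> real. snd (snd y))"
    by (intro llip_bounded_linear bounded_linear_intros)+
  have l1: "llip F1" unfolding F1_def by (intro llip_Pair projs llip_const)
  have l2: "llip F2" unfolding F2_def by (intro llip_Pair llip_compose[OF llip(2)] projs llip_const)
  have l3: "llip F3" unfolding F3_def
    by (intro llip_Pair llip_const llip_compose[OF llip(1), of "\<lambda>y. (fst y, fst (snd y))", simplified] llip_Pair projs
          llip_bilinear[OF bounded_bilinear_mult] llip_compose[OF llip(3)])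
  define S where "S = (\<lambda>F::'e \<times> 'e \<times> real \<Rightarrow> 'e \<times> 'e \<times> real. \<lambda>h::real. \<lambda>y. y + h *\<^sub>R F y)"
  have S_cont: "continuous_on UNIV (S F h)" if "llip F" for F h
    unfolding S_def by (intro continuous_intros llip_continuous that)
  define F where "F = (\<lambda>y. F1 y + F2 y + F3 y)"
  have lF: "llip F" unfolding F_def by (intro llip_add l1 l2 l3)
  define SS where "SS = (\<lambda>h y. S F3 h (S F2 h (S F1 h y)))"
  have cons: "consistent SS F"
    unfolding SS_def F_def S_def by (intro consistent_compose consistent_euler l1 l2 l3 llip_add)
  \<comment> \<open>This makes \<open>q * D \<le> 1 / 2\<close> for every \<open>x\<close>, where
    \<open>q = h * k * \<rho> x\<close> bounds the relative displacement of a velocity in one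
    step.\<close>
  define h0 where "h0 = 1 / (2 * (k * P * D + 1))"
  have kPD: "k * P * D \<ge> 0" using k P D by simp
  then have h0: "h0 > 0" by (simp add: h0_def)
  have cont: "continuous_on UNIV (SS h)" for h
  proof -
    have "continuous_on UNIV (\<lambda>y. S F2 h (S F1 h y))"
      by (rule continuous_on_compose2[OF S_cont[OF l2] S_cont[OF l1]]) simp
    then show ?thesis unfolding SS_def
      by (rule continuous_on_compose2[OF S_cont[OF l3]]) simp
  qed
  \<comment> \<open>Free transport is a shear: with velocity and \<open>w\<close> fixed it
    translates positions. In the same way the force, with the position fixed, translates
    velocities.\<close>
  have v1: "vol_ge 1 (S F1 h)" for h
  proof -
    have eq: "S F1 h = (\<lambda>(x, b). (1 *\<^sub>R x + h *\<^sub>R fst b, b))" by (auto simp: S_def F1_def)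
    have "vol_ge 1 (\<lambda>x::'e. 1 *\<^sub>R x + h *\<^sub>R fst b)" for b :: "'e \<times> real"
      using vol_ge_affine[of 1 "h *\<^sub>R fst b"] by simp
    then show ?thesis using S_cont[OF l1, of h] unfolding eq by (intro vol_ge_fibrewise2) auto
  qed
  have v2: "vol_ge 1 (S F2 h)" for h
  proof -
    have eq: "S F2 h = (\<lambda>(x, b). (x, 1 *\<^sub>R b + (h *\<^sub>R f x, 0)))" by (auto simp: S_def F2_def)
    have "vol_ge 1 (\<lambda>b::'e \<times> real. 1 *\<^sub>R b + (h *\<^sub>R f x, 0))" for x
      using vol_ge_affine[of 1 "(h *\<^sub>R f x, 0::real)"] by simp
    then show ?thesis using S_cont[OF l2, of h] unfolding eq by (intro vol_ge_fibrewise) auto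
  qed
  \<comment> \<open>The position is frozen; velocities undergo a linear map close to the identity,
    and the factor \<mu> on \<open>w\<close> makes up for the volume they lose.\<close>
  have v3: "vol_ge 1 (S F3 h)" if h: "0 \<le> h" "h \<le> h0" for h
  proof -
    define g where "g = (\<lambda>x b. (fst b + h *\<^sub>R A x (fst b), snd b + h * (c * \<rho> x * snd b)) :: 'e \<times> real)"
    have eq: "S F3 h = (\<lambda>(x, b). (x, g x b))" by (auto simp: S_def F3_def g_def)
    have "vol_ge 1 (g x)" for x
    proof -
      define q where "q = h * k * \<rho> x"
      define \<mu> where "\<mu> = 1 + h * c * \<rho> x"
      have q0: "0 \<le> q" using h k \<rho> by (simp add: q_def)
      have "q * D \<le> h0 * k * P * D"
        unfolding q_def using h k \<rho> D P h0 by (intro mult_right_mono mult_mono) auto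
      also have "\<dots> = (k * P * D) / (2 * (k * P * D + 1))" by (simp add: h0_def)
      also have "\<dots> \<le> 1 / 2" using kPD by (simp add: field_simps)
      finally have qD: "q * D \<le> 1 / 2" .
      have "q * 1 \<le> q * D" using q0 by (intro mult_left_mono) (auto simp: D_def Suc_le_eq)
      then have q1: "q \<le> 1 / 2" using qD by simp
      define T where "T = (\<lambda>v. v + h *\<^sub>R A x v)"
      have linT: "linear T" unfolding T_def
        by (intro linear_compose_add linear_id[unfolded id_def] linear_compose_scale_right lin)
      have nT: "norm (T v - v) \<le> q * norm v" for v
        using mult_left_mono[OF A[of x v] h(1)] h by (simp add: T_def q_def mult_ac)
      have contT: "continuous_on X T" for X
        using linT by (intro linear_continuous_on) (simp add: linear_conv_bounded_linear)
      have vT: "vol_ge ((1 - q) ^ DIM('e)) T" by (rule vol_ge_near_identity[OF linT _ _ nT]) (use q0 q1 in auto)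
      have cT: "continuous_on UNIV (\<lambda>(v, w::real). (T v, w))"
        unfolding case_prod_beta by (intro continuous_intros continuous_on_compose2[OF contT]) auto
      have vTw: "vol_ge ((1 - q) ^ DIM('e)) (\<lambda>(v, w::real). (T v, w))"
        by (rule vol_ge_fibrewise2[where g="\<lambda>_. T", OF vT cT])
      have v\<mu>: "vol_ge \<mu> (\<lambda>(v::'e, w). (v, \<mu> *\<^sub>R w + (0::real)))"
      proof (rule vol_ge_fibrewise)
        have "\<mu> \<ge> 0" using h c \<rho> by (simp add: \<mu>_def)
        then show "vol_ge \<mu> (\<lambda>w. \<mu> *\<^sub>R w + (0::real))" using vol_ge_affine[of \<mu> "0::real"] by simp
        show "continuous_on UNIV (\<lambda>(v::'e, w). (v, \<mu> *\<^sub>R w + (0::real)))"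
          unfolding case_prod_beta by (intro continuous_intros)
      qed
      have "\<mu> \<ge> 0" using h c \<rho> by (simp add: \<mu>_def)
      then have "vol_ge (\<mu> * (1 - q) ^ DIM('e)) (\<lambda>b. (\<lambda>(v, w). (v, \<mu> *\<^sub>R w + (0::real))) ((\<lambda>(v, w). (T v, w)) b))"
        using q1 vol_ge_compose[OF vTw cT v\<mu>] by simp
      moreover have "(\<lambda>b. (\<lambda>(v, w). (v, \<mu> *\<^sub>R w + (0::real))) ((\<lambda>(v, w). (T v, w)) b)) = g x"
        by (auto simp: g_def T_def \<mu>_def algebra_simps)
      \<comment> \<open>Bernoulli's inequality gives (1 - q)^D \<ge> 1 - q D, and (1 + 2 q D)(1 - q
        D) \<ge> 1 as long as 2 q D \<le> 1.\<close>
      moreover have "1 \<le> \<mu> * (1 - q) ^ DIM('e)"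
      proof -
        have \<mu>: "\<mu> = 1 + 2 * (q * D)" by (simp add: \<mu>_def c_def q_def)
        have "1 - q * D \<le> (1 - q) ^ DIM('e)"
          using Bernoulli_inequality[of "- q" "DIM('e)"] q1 by (simp add: D_def mult.commute)
        then have "\<mu> * (1 - q * D) \<le> \<mu> * (1 - q) ^ DIM('e)"
          using \<open>\<mu> \<ge> 0\<close> by (intro mult_left_mono) auto
        moreover have "\<mu> * (1 - q * D) = 1 + (q * D) * (1 - 2 * (q * D))"
          unfolding \<mu> by (simp add: algebra_simps)
        moreover have "(q * D) * (1 - 2 * (q * D)) \<ge> 0" using qD q0 D by (intro mult_nonneg_nonneg) auto
        ultimately show ?thesis by linarith
      qed
      ultimately show ?thesis using vol_ge_mono by metis
    qed
    then show ?thesis using S_cont[OF l3, of h] unfolding eq by (intro vol_ge_fibrewise) auto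
  qed
  have vol: "vol_ge 1 (SS h)" if h: "0 \<le> h" "h \<le> h0" for h
  proof -
    have "vol_ge (1 * 1) (\<lambda>y. S F2 h (S F1 h y))"
      by (rule vol_ge_compose[OF v1 S_cont[OF l1] v2]) auto
    moreover have "continuous_on UNIV (\<lambda>y. S F2 h (S F1 h y))"
      by (rule continuous_on_compose2[OF S_cont[OF l2] S_cont[OF l1]]) simp
    ultimately have "vol_ge (1 * (1 * 1)) (\<lambda>y. S F3 h (S F2 h (S F1 h y)))"
      by (rule vol_ge_compose[OF _ _ v3[OF h]]) auto
    then show ?thesis by (simp add: SS_def)
  qed
  define I where "I = (\<lambda>z t. integral {0..t} (\<lambda>s. \<rho> (fst (\<Phi> z s))))"
  \<comment> \<open>\<Psi> is the exact solution of the extended system: the equation for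
    \<open>w\<close> is linear along a given trajectory and is solved by the exponential of the
    integral of \<open>c * \<rho>\<close>.\<close>
  define \<Psi> where "\<Psi> = (\<lambda>y t. let z = (fst y, fst (snd y)) in
      (fst (\<Phi> z t), snd (\<Phi> z t), snd (snd y) * exp (c * I z t)))"
  have \<Phi>cont: "continuous_on {0..} (\<Phi> z)" if "z \<in> K" for z
    using \<Phi>[OF that] by (auto simp: continuous_on_eq_continuous_within intro: has_vector_derivative_continuous)
  have \<rho>cont: "continuous_on {0..} (\<lambda>s. \<rho> (fst (\<Phi> z s)))" if "z \<in> K" for z
    by (intro continuous_on_compose2[OF llip_continuous[OF llip(3), of UNIV]] continuous_intros \<Phi>cont that) auto
  have I_deriv: "(I z has_vector_derivative \<rho> (fst (\<Phi> z t))) (at t within {0..})" if "z \<in> K" "0 \<le> t" for z t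
    unfolding I_def by (rule integral_has_vector_derivative_halfline[OF \<rho>cont]) (use that in auto)
  have I_bd: "I z t \<le> P * T" if "z \<in> K" "0 \<le> t" "t \<le> T" for z t
  proof -
    have "norm (I z t) \<le> P * (t - 0)"
      unfolding I_def using that \<rho> by (intro integral_bound continuous_on_subset[OF \<rho>cont]) auto
    also have "\<dots> \<le> P * T" using P that by (intro mult_left_mono) auto
    finally show ?thesis by simp
  qed
  define G where "G = (\<lambda>z. (snd z, A (fst z) (snd z) + f (fst z)))"
  have lG: "llip G"
    unfolding G_def by (intro llip_Pair llip_add llip(1) llip_compose[OF llip(2)] llip_bounded_linear bounded_linear_intros)
  have Q: "compact ((\<lambda>z. \<Phi> z T) ` K)"
    by (rule compact_flow_image[OF lG T K]) (use \<Phi>0 \<Phi> R in \<open>auto simp: G_def\<close>)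
  \<comment> \<open>The unit interval for \<open>w\<close> gives \<open>K'\<close> the same volume
    as \<open>K\<close>.\<close>
  define K' where "K' = {(x, v, w). (x, v) \<in> K \<and> w \<in> {0..1::real}}"
  have "emeasure lborel K = emeasure lborel K'"
    unfolding K'_def using compact_pairs_times_interval(2)[OF K, of 1] by simp
  also have "\<dots> \<le> emeasure lborel ((\<lambda>y. \<Psi> y T) ` K')"
  proof (rule flow_volume_nondecreasing[OF lF cons T _ _ _ _ h0 cont vol])
    show "compact K'" unfolding K'_def by (rule compact_pairs_times_interval(1)[OF K]) simp
    show "\<Psi> y 0 = y" if "y \<in> K'" for y
      using that \<Phi>0 by (auto simp: \<Psi>_def K'_def I_def Let_def)
    show "(\<Psi> y has_vector_derivative F (\<Psi> y t)) (at t within {0..})" if "y \<in> K'" "0 \<le> t" "t \<le> T" for y t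
    proof -
      define z where "z = (fst y, fst (snd y))"
      have z: "z \<in> K" using \<open>y \<in> K'\<close> by (auto simp: z_def K'_def)
      have d1: "((\<lambda>t. fst (\<Phi> z t)) has_vector_derivative snd (\<Phi> z t)) (at t within {0..})"
        using bounded_linear.has_vector_derivative[OF bounded_linear_fst \<Phi>[OF z \<open>0 \<le> t\<close>]] by simp
      have d2: "((\<lambda>t. snd (\<Phi> z t)) has_vector_derivative A (fst (\<Phi> z t)) (snd (\<Phi> z t)) + f (fst (\<Phi> z t))) (at t within {0..})"
        using bounded_linear.has_vector_derivative[OF bounded_linear_snd \<Phi>[OF z \<open>0 \<le> t\<close>]] by simp
      have "(I z has_field_derivative \<rho> (fst (\<Phi> z t))) (at t within {0..})"
        using I_deriv[OF z \<open>0 \<le> t\<close>] by (simp add: has_real_derivative_iff_has_vector_derivative)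
      then have "((\<lambda>t. snd (snd y) * exp (c * I z t)) has_field_derivative c * \<rho> (fst (\<Phi> z t)) * (snd (snd y) * exp (c * I z t))) (at t within {0..})"
        by (auto intro!: derivative_eq_intros)
      then have d3: "((\<lambda>t. snd (snd y) * exp (c * I z t)) has_vector_derivative c * \<rho> (fst (\<Phi> z t)) * (snd (snd y) * exp (c * I z t))) (at t within {0..})"
        by (simp add: has_real_derivative_iff_has_vector_derivative)
      have "((\<lambda>t. (fst (\<Phi> z t), snd (\<Phi> z t), snd (snd y) * exp (c * I z t))) has_vector_derivative
          (snd (\<Phi> z t), A (fst (\<Phi> z t)) (snd (\<Phi> z t)) + f (fst (\<Phi> z t)), c * \<rho> (fst (\<Phi> z t)) * (snd (snd y) * exp (c * I z t)))) (at t within {0..})"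
        by (intro has_vector_derivative_Pair d1 d2 d3)
      then show ?thesis
        by (simp add: \<Psi>_def Let_def z_def[symmetric] F_def F1_def F2_def F3_def add.commute)
    qed
    show "norm (\<Psi> y t) \<le> 2 * R + exp (c * (P * T))" if "y \<in> K'" "0 \<le> t" "t \<le> T" for y t
    proof -
      define z where "z = (fst y, fst (snd y))"
      have z: "z \<in> K" and w: "0 \<le> snd (snd y)" "snd (snd y) \<le> 1" using \<open>y \<in> K'\<close> by (auto simp: z_def K'_def)
      have "snd (snd y) * exp (c * I z t) \<le> 1 * exp (c * (P * T))"
        using w c I_bd[OF z] that by (intro mult_mono) (auto intro!: mult_left_mono)
      then have n3: "norm (snd (snd y) * exp (c * I z t)) \<le> exp (c * (P * T))" using w by simp
      have n12: "norm (fst (\<Phi> z t)) \<le> R" "norm (snd (\<Phi> z t)) \<le> R"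
        using R[OF z \<open>0 \<le> t\<close>] norm_fst_le[of "fst (\<Phi> z t)" "snd (\<Phi> z t)"] norm_snd_le[of "snd (\<Phi> z t)" "fst (\<Phi> z t)"] by auto
      have "norm (\<Psi> y t) \<le> norm (fst (\<Phi> z t)) + norm (snd (\<Phi> z t), snd (snd y) * exp (c * I z t))"
        unfolding \<Psi>_def Let_def z_def[symmetric] by (rule norm_Pair_le)
      also have "\<dots> \<le> norm (fst (\<Phi> z t)) + (norm (snd (\<Phi> z t)) + norm (snd (snd y) * exp (c * I z t)))"
        by (intro add_left_mono norm_Pair_le)
      finally show ?thesis using n3 n12 by linarith
    qed
  qed
  \<comment> \<open>The hypothesis on \<open>M\<close> enters here: at time \<open>T\<close> the
    coordinate \<open>w\<close> has grown to at most \<open>exp (c * M)\<close>.\<close>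
  also have "\<dots> \<le> emeasure lborel {(x, v, w). (x, v) \<in> (\<lambda>z. \<Phi> z T) ` K \<and> w \<in> {0..exp (c * M)}}"
  proof (rule emeasure_mono)
    show "(\<lambda>y. \<Psi> y T) ` K' \<subseteq> {(x, v, w). (x, v) \<in> (\<lambda>z. \<Phi> z T) ` K \<and> w \<in> {0..exp (c * M)}}"
    proof (rule image_subsetI)
      fix y assume "y \<in> K'"
      define z where "z = (fst y, fst (snd y))"
      have z: "z \<in> K" and w: "0 \<le> snd (snd y)" "snd (snd y) \<le> 1" using \<open>y \<in> K'\<close> by (auto simp: z_def K'_def)
      have "snd (snd y) * exp (c * I z T) \<le> 1 * exp (c * M)"
        using w c M[OF z] by (intro mult_mono) (auto intro!: mult_left_mono simp: I_def)
      then show "\<Psi> y T \<in> {(x, v, w). (x, v) \<in> (\<lambda>z. \<Phi> z T) ` K \<and> w \<in> {0..exp (c * M)}}"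
        using z w by (auto simp: \<Psi>_def Let_def z_def[symmetric])
    qed
  next
    show "{(x, v, w). (x, v) \<in> (\<lambda>z. \<Phi> z T) ` K \<and> w \<in> {0..exp (c * M)}} \<in> sets lborel"
      using borel_compact[OF compact_pairs_times_interval(1)[OF Q, of "exp (c * M)"]] by simp
  qed
  also have "\<dots> = ennreal (exp (c * M)) * emeasure lborel ((\<lambda>z. \<Phi> z T) ` K)"
    by (rule compact_pairs_times_interval(2)[OF Q]) simp
  finally show ?thesis by (simp add: c_def D_def)
qed

section \<open>A smooth bump function\<close>

text \<open>The functions p(1/t) exp(-1/t), extended by 0. With arbitrary polynomials p the family
  is closed under differentiation, so a single derivative computation yields smoothness.\<close>

definition bump :: "real poly \<Rightarrow> real \<Rightarrow> real" where
  "bump p t = (if t \<le> 0 then 0 else poly p (1 / t) * exp (- (1 / t)))"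

text \<open>The polynomial X^2 (p - p'), as it arises from differentiating p(1/t) exp(-1/t) with
  respect to t.\<close>

definition bump_step :: "real poly \<Rightarrow> real poly" where
  "bump_step p = pCons 0 (pCons 0 (p - pderiv p))"

lemma poly_times_exp_minus_tendsto_0:
  fixes p :: "real poly"
  shows "((\<lambda>u. poly p u * exp (- u)) \<longlongrightarrow> 0) at_top"
proof -
  have "((\<lambda>u. \<Sum>i\<le>degree p. coeff p i * (u ^ i / exp u)) \<longlongrightarrow> (\<Sum>i\<le>degree p. coeff p i * 0)) at_top"
    by (intro tendsto_sum tendsto_mult tendsto_const tendsto_power_div_exp_0)
  then show ?thesis
    by (simp add: poly_altdef sum_distrib_right exp_minus divide_inverse mult.assoc)
qed

lemma DERIV_bump: "(bump p has_field_derivative bump (bump_step p) t) (at t)"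
proof -
  consider "t < 0" | "t > 0" | "t = 0" by linarith
  then show ?thesis
  proof cases
    case 1
    have "((\<lambda>_. 0) has_field_derivative bump (bump_step p) t) (at t)" using 1 by (simp add: bump_def)
    then show ?thesis
      by (rule has_field_derivative_transform_within_open[where S="{..<0}"]) (use 1 in \<open>auto simp: bump_def\<close>)
  next
    case 2
    have "((\<lambda>t. poly p (1 / t) * exp (- (1 / t))) has_field_derivative bump (bump_step p) t) (at t)"
      using 2 by (auto intro!: derivative_eq_intros poly_DERIV DERIV_chain2[OF poly_DERIV]
          simp: bump_def bump_step_def power2_eq_square field_simps)
    then show ?thesis
      by (rule has_field_derivative_transform_within_open[where S="{0<..}"]) (use 2 in \<open>auto simp: bump_def\<close>)
  next
    case 3
    \<comment> \<open>At 0 the factor 1/h of the difference quotient is absorbed into the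
      polynomial, and the exponential wins.\<close>
    have "((\<lambda>h. poly (pCons 0 p) (inverse h) * exp (- inverse h)) \<longlongrightarrow> 0) (at_right 0)"
      by (rule filterlim_compose[OF poly_times_exp_minus_tendsto_0 filterlim_inverse_at_top_right])
    then have r: "((\<lambda>h. bump p h / h) \<longlongrightarrow> 0) (at_right 0)"
      by (rule Lim_transform_eventually)
         (auto simp: eventually_at_right_less bump_def divide_inverse mult_ac
           intro!: eventually_at_rightI[of 0 1])
    have l: "((\<lambda>h. bump p h / h) \<longlongrightarrow> 0) (at_left 0)"
      by (rule Lim_transform_eventually[OF tendsto_const])
         (auto simp: bump_def intro!: eventually_at_leftI[of "-1"])
    have "((\<lambda>h. bump p h / h) \<longlongrightarrow> 0) (at 0)" using l r by (simp add: filterlim_split_at)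
    then show ?thesis using 3 by (simp add: DERIV_def bump_def)
  qed
qed

lemma bump_has_derivative [derivative_intros]:
  assumes "(g has_derivative g') (at x within S)"
  shows "((\<lambda>x. bump p (g x)) has_derivative (\<lambda>h. g' h * bump (bump_step p) (g x))) (at x within S)"
  by (rule DERIV_compose_FDERIV[OF DERIV_bump assms])

lemma continuous_on_bump [continuous_intros]:
  assumes "continuous_on S f"
  shows "continuous_on S (\<lambda>x. bump p (f x))"
proof -
  have "continuous_on UNIV (bump p)"
    using DERIV_bump by (auto simp: continuous_on_eq_continuous_at intro: DERIV_isCont)
  then show ?thesis by (rule continuous_on_compose2[OF _ assms]) auto
qed

text \<open>An algebra that contains the radial bumps centred at \<open>c\<close> and is closed
  under directional derivatives, so that \<open>Ck k\<close> follows for all members by induction on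
  k. Constants and coordinates are included because they arise from differentiating
  \<open>(y - c) \<bullet> (y - c)\<close>. Here \<open>r\<close> has the role of a squared
  radius.\<close>

inductive bump_class :: "'a::euclidean_space \<Rightarrow> real \<Rightarrow> ('a \<Rightarrow> real) \<Rightarrow> bool" for c r where
  const: "bump_class c r (\<lambda>_. k)"
| coord: "bump_class c r (\<lambda>y. y \<bullet> b)"
| bump: "bump_class c r (\<lambda>y. bump p (r - (y - c) \<bullet> (y - c)))"
| add: "bump_class c r f \<Longrightarrow> bump_class c r g \<Longrightarrow> bump_class c r (\<lambda>y. f y + g y)"
| mult: "bump_class c r f \<Longrightarrow> bump_class c r g \<Longrightarrow> bump_class c r (\<lambda>y. f y * g y)"

lemma bump_class_derivative:
  assumes "bump_class c r f"
  shows "\<exists>f'. (\<forall>x. (f has_derivative f' x) (at x)) \<and> (\<forall>h. bump_class c r (\<lambda>x. f' x h))"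
  using assms
proof induction
  case (const k)
  have "bump_class c r (\<lambda>_. 0)" by (rule bump_class.const)
  then show ?case by (intro exI[of _ "\<lambda>_ _. 0"]) auto
next
  case (coord b)
  then show ?case
    by (intro exI[of _ "\<lambda>_ h. h \<bullet> b"]) (auto intro!: derivative_eq_intros bump_class.const)
next
  case (bump p)
  have "bump_class c r (\<lambda>x. (- 2 * (x \<bullet> h + - (c \<bullet> h))) * bump (bump_step p) (r - (x - c) \<bullet> (x - c)))" for h
    by (intro bump_class.intros)
  then show ?case
    by (intro exI[of _ "\<lambda>x h. (- 2 * (x \<bullet> h + - (c \<bullet> h))) * bump (bump_step p) (r - (x - c) \<bullet> (x - c))"])
       (auto intro!: derivative_eq_intros simp: inner_diff inner_commute algebra_simps)
next
  case (add f g)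
  then obtain f' g' where "\<And>x. (f has_derivative f' x) (at x)" "\<And>h. bump_class c r (\<lambda>x. f' x h)"
    "\<And>x. (g has_derivative g' x) (at x)" "\<And>h. bump_class c r (\<lambda>x. g' x h)" by blast
  then show ?case
    by (intro exI[of _ "\<lambda>x h. f' x h + g' x h"]) (auto intro: has_derivative_add bump_class.add)
next
  case (mult f g)
  then obtain f' g' where *: "\<And>x. (f has_derivative f' x) (at x)" "\<And>h. bump_class c r (\<lambda>x. f' x h)"
    "\<And>x. (g has_derivative g' x) (at x)" "\<And>h. bump_class c r (\<lambda>x. g' x h)" by blast
  have "bump_class c r (\<lambda>x. f x * g' x h + f' x h * g x)" for h
    by (intro bump_class.add bump_class.mult * mult.hyps)
  then show ?case
    using *(1,3) by (intro exI[of _ "\<lambda>x h. f x * g' x h + f' x h * g x"]) (auto intro: has_derivative_mult)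
qed

lemma bump_class_Ck:
  assumes "bump_class c r f"
  shows "Ck k f"
  using assms
proof (induction k arbitrary: f)
  case 0
  then show ?case using bump_class_derivative[OF 0]
    by (auto simp: continuous_on_eq_continuous_at intro: has_derivative_continuous)
next
  case (Suc k)
  obtain f' where f': "\<And>x. (f has_derivative f' x) (at x)" "\<And>h. bump_class c r (\<lambda>x. f' x h)"
    using bump_class_derivative[OF Suc.prems] by blast
  have "frechet_derivative f (at x) = f' x" for x
    using frechet_derivative_at[OF f'(1)] by simp
  then show ?case using Suc.IH f' by (auto simp: differentiable_def)
qed

section \<open>Mollification\<close>

text \<open>A smooth nonnegative kernel that is positive exactly inside the ball of radius r, for r
  \<ge> 0. It is not normalised; its mass is divided out later as \<open>Z n\<close>.\<close>

definition moll :: "real \<Rightarrow> 'a::euclidean_space \<Rightarrow> real" where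
  "moll r z = bump 1 (r\<^sup>2 - z \<bullet> z)"

definition moll' :: "real \<Rightarrow> 'a::euclidean_space \<Rightarrow> 'a \<Rightarrow> real" where
  "moll' r z h = - 2 * (z \<bullet> h) * bump (bump_step 1) (r\<^sup>2 - z \<bullet> z)"

lemma moll_has_derivative: "(moll r has_derivative moll' r z) (at z)"
  unfolding moll_def moll'_def
  by (auto intro!: derivative_eq_intros simp: inner_commute)

lemma inner_self_ge_iff: "r \<ge> 0 \<Longrightarrow> r\<^sup>2 - z \<bullet> z \<le> 0 \<longleftrightarrow> r \<le> norm z"
  by (simp add: power2_norm_eq_inner[symmetric] abs_le_square_iff[symmetric])

lemma moll_nonneg: "0 \<le> moll r z"
  by (simp add: moll_def bump_def)

lemma moll_outside: "0 \<le> r \<Longrightarrow> r \<le> norm z \<Longrightarrow> moll r z = 0"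
  using inner_self_ge_iff[of r z] by (simp add: moll_def bump_def)

lemma moll_pos: "norm z < r \<Longrightarrow> 0 < moll r z"
  using inner_self_ge_iff[of r z] norm_ge_zero[of z] by (simp add: moll_def bump_def)

lemma moll'_outside: "0 \<le> r \<Longrightarrow> r \<le> norm z \<Longrightarrow> moll' r z h = 0"
  using inner_self_ge_iff[of r z] by (simp add: moll'_def bump_def)

lemma continuous_on_moll [continuous_intros]:
  "continuous_on S f \<Longrightarrow> continuous_on S (\<lambda>x. moll r (f x))"
  unfolding moll_def by (intro continuous_intros)

lemma continuous_on_moll' [continuous_intros]:
  "continuous_on S f \<Longrightarrow> continuous_on S (\<lambda>x. moll' r (f x) h)"
  unfolding moll'_def by (intro continuous_intros)

lemma moll_le: "moll r z \<le> 1"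
  by (simp add: moll_def bump_def)

lemma moll'_bound:
  fixes r :: real
  assumes "0 \<le> r"
  obtains B where "B \<ge> 0" "\<And>z h::'a::euclidean_space. \<bar>moll' r z h\<bar> \<le> B * norm h"
proof -
  have "compact (bump (bump_step 1) ` {0..r\<^sup>2})"
    by (intro compact_continuous_image continuous_on_bump continuous_intros) auto
  then obtain C where C: "C > 0" "\<And>t. t \<in> {0..r\<^sup>2} \<Longrightarrow> \<bar>bump (bump_step 1) t\<bar> \<le> C"
    using compact_imp_bounded[of "bump (bump_step 1) ` {0..r\<^sup>2}"] unfolding bounded_pos by auto
  show ?thesis
  proof (rule that[of "2 * r * C"])
    show "2 * r * C \<ge> 0" using C assms by simp
    fix z h :: 'a
    show "\<bar>moll' r z h\<bar> \<le> 2 * r * C * norm h"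
    proof (cases "r \<le> norm z")
      case True
      then show ?thesis using C assms by (simp add: moll'_outside)
    next
      case False
      then have "r\<^sup>2 - z \<bullet> z \<in> {0..r\<^sup>2}" using inner_self_ge_iff[of r z] assms by auto
      then have "\<bar>bump (bump_step 1) (r\<^sup>2 - z \<bullet> z)\<bar> \<le> C" by (rule C)
      moreover have "\<bar>z \<bullet> h\<bar> \<le> r * norm h"
        using Cauchy_Schwarz_ineq2[of z h] mult_right_mono[of "norm z" r "norm h"] False by simp
      ultimately have "\<bar>z \<bullet> h\<bar> * \<bar>bump (bump_step 1) (r\<^sup>2 - z \<bullet> z)\<bar> \<le> (r * norm h) * C"
        by (intro mult_mono) auto
      then show ?thesis by (simp add: moll'_def abs_mult mult_ac)
    qed
  qed
qed

text \<open>Supplies the dominating function for difference quotients of mollified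
  functions.\<close>

lemma moll_lipschitz:
  fixes r :: real
  assumes "0 \<le> r"
  obtains B where "B \<ge> 0" "\<And>u v::'a::euclidean_space. \<bar>moll r u - moll r v\<bar> \<le> B * norm (u - v)"
proof -
  obtain B where B: "B \<ge> 0" "\<And>z h::'a. \<bar>moll' r z h\<bar> \<le> B * norm h"
    using moll'_bound[OF assms, where ?'a='a] by metis
  show ?thesis
  proof (rule that[OF B(1)])
    fix u v :: 'a
    have "norm (moll r u - moll r v) \<le> B * norm (u - v)"
      by (rule differentiable_bound[of UNIV _ "moll' r"])
         (use B in \<open>auto intro: moll_has_derivative onorm_le\<close>)
    then show "\<bar>moll r u - moll r v\<bar> \<le> B * norm (u - v)" by simp
  qed
qed

lemma test_function_moll:
  fixes x :: "'a::euclidean_space"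
  assumes "0 \<le> r"
  shows "test_function (\<lambda>y. moll r (y - x))"
  unfolding test_function_def
proof
  show "\<forall>k. Ck k (\<lambda>y. moll r (y - x))"
    unfolding moll_def by (auto intro: bump_class_Ck bump_class.bump)
  have "{y. moll r (y - x) \<noteq> 0} \<subseteq> cball x r"
    using moll_outside[OF assms] by (force simp: dist_norm norm_minus_commute)
  then show "compact (closure {y. moll r (y - x) \<noteq> 0})"
    using bounded_subset compact_closure bounded_cball by blast
qed

lemma frechet_derivative_moll:
  "frechet_derivative (\<lambda>y. moll r (y - x)) (at y) = moll' r (y - x)"
proof -
  have "((\<lambda>y. moll r (y - x)) has_derivative (\<lambda>h. moll' r (y - x) h)) (at y)"
    by (rule has_derivative_compose[OF _ moll_has_derivative, of "\<lambda>y. y - x" "\<lambda>h. h", simplified])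
       (auto intro!: derivative_eq_intros)
  then show ?thesis using frechet_derivative_at by metis
qed

section \<open>Integrability and derivatives of mollified functions\<close>

lemma Linf_loc_bound:
  fixes f :: "'a::euclidean_space \<Rightarrow> real"
  assumes "Linf_loc f"
  obtains C where "C \<ge> 0" "AE y in lebesgue. norm y \<le> R \<longrightarrow> \<bar>f y\<bar> \<le> C"
proof -
  obtain C where C: "AE y in lebesgue. y \<in> cball 0 R \<longrightarrow> \<bar>f y\<bar> \<le> C"
    using assms compact_cball unfolding Linf_loc_def by blast
  show ?thesis
  proof (rule that[of "max C 0"])
    show "AE y in lebesgue. norm y \<le> R \<longrightarrow> \<bar>f y\<bar> \<le> max C 0"
      using C by eventually_elim auto
  qed simp
qed

lemma continuous_borel_measurable_lebesgue:
  "continuous_on UNIV (g :: 'a::euclidean_space \<Rightarrow> real) \<Longrightarrow> g \<in> borel_measurable lebesgue"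
  by (intro measurable_completion) (simp add: borel_measurable_continuous_onI)

lemma integrable_indicator_ball:
  "integrable lebesgue (\<lambda>y::'a::euclidean_space. C * indicat_real (cball 0 R) y)"
  using lmeasurable_iff_integrable[of "cball 0 R :: 'a set"] by (intro integrable_mult_right) auto

lemma Linf_loc_integrable:
  fixes f :: "'a::euclidean_space \<Rightarrow> real"
  assumes f: "Linf_loc f" and g: "continuous_on UNIV g"
    and B: "\<And>y. \<bar>g y\<bar> \<le> B" and supp: "\<And>y. norm y > R \<Longrightarrow> g y = 0"
  shows "integrable lebesgue (\<lambda>y. f y * g y)"
proof -
  obtain C where C: "C \<ge> 0" "AE y in lebesgue. norm y \<le> R \<longrightarrow> \<bar>f y\<bar> \<le> C"
    using Linf_loc_bound[OF f] by blast
  show ?thesis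
  proof (rule Bochner_Integration.integrable_bound[OF integrable_indicator_ball[of "C * B" R]])
    show "(\<lambda>y. f y * g y) \<in> borel_measurable lebesgue"
      using f continuous_borel_measurable_lebesgue[OF g] by (auto simp: Linf_loc_def)
    show "AE y in lebesgue. norm (f y * g y) \<le> norm (C * B * indicat_real (cball 0 R) y)"
      using C(2)
    proof eventually_elim
      case (elim y)
      then show ?case
      proof (cases "norm y \<le> R")
        case True
        then have "\<bar>f y\<bar> * \<bar>g y\<bar> \<le> C * B" using elim B[of y] C by (intro mult_mono) auto
        then show ?thesis using True C(1) order_trans[OF abs_ge_zero B[of y]] by (simp add: abs_mult)
      qed (use supp[of y] in auto)
    qed
  qed
qed

definition mollify :: "real \<Rightarrow> ('a::euclidean_space \<Rightarrow> real) \<Rightarrow> 'a \<Rightarrow> real" where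
  "mollify r f x = (\<integral>y. f y * moll r (y - x) \<partial>lebesgue)"

lemma moll_support:
  assumes "0 \<le> r" "norm y > norm x + r"
  shows "moll r (y - x) = 0" "moll' r (y - x) h = 0"
proof -
  have "r \<le> norm (y - x)" using assms(2) norm_triangle_ineq2[of y x] by linarith
  then show "moll r (y - x) = 0" "moll' r (y - x) h = 0" using moll_outside moll'_outside assms(1) by auto
qed

lemma mollify_integrable:
  assumes "Linf_loc f" "0 \<le> r"
  shows "integrable lebesgue (\<lambda>y. f y * moll r (y - x))"
proof (rule Linf_loc_integrable[OF assms(1)])
  show "\<bar>moll r (y - x)\<bar> \<le> 1" for y using moll_nonneg[of r "y - x"] moll_le[of r "y - x"] by simp
  show "norm y > norm x + r \<Longrightarrow> moll r (y - x) = 0" for y by (rule moll_support[OF assms(2)])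
qed (intro continuous_intros)

lemma mollify'_integrable:
  fixes x :: "'a::euclidean_space"
  assumes "Linf_loc f" "0 \<le> r"
  shows "integrable lebesgue (\<lambda>y. f y * moll' r (y - x) h)"
proof -
  obtain B where B: "B \<ge> 0" "\<And>z h::'a. \<bar>moll' r z h\<bar> \<le> B * norm h"
    using moll'_bound[OF assms(2), where ?'a='a] by metis
  show ?thesis
  proof (rule Linf_loc_integrable[OF assms(1)])
    show "\<bar>moll' r (y - x) h\<bar> \<le> B * norm h" for y by (rule B)
    show "norm y > norm x + r \<Longrightarrow> moll' r (y - x) h = 0" for y by (rule moll_support[OF assms(2)])
  qed (intro continuous_intros)
qed

text \<open>Differentiation under the integral by dominated convergence, with the derivative falling
  on the kernel. The minus sign comes from the argument \<open>y - x\<close> and will cancel the one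
  in the definition of weak derivatives.\<close>

lemma mollify_directional_derivative:
  fixes f :: "'a::euclidean_space \<Rightarrow> real"
  assumes f: "Linf_loc f" and r: "0 \<le> r"
  shows "((\<lambda>s. mollify r f (x + s *\<^sub>R h)) has_real_derivative
           - (\<integral>y. f y * moll' r (y - x) h \<partial>lebesgue)) (at 0)"
proof -
  obtain B where B: "B \<ge> 0" "\<And>u v::'a. \<bar>moll r u - moll r v\<bar> \<le> B * norm (u - v)"
    using moll_lipschitz[OF r, where ?'a='a] by metis
  have "((\<lambda>s. (mollify r f (x + s *\<^sub>R h) - mollify r f x) / s) \<longlongrightarrow>
      - (\<integral>y. f y * moll' r (y - x) h \<partial>lebesgue)) (at 0)"
    unfolding tendsto_at_iff_sequentially
  proof (intro allI impI)
    fix X :: "nat \<Rightarrow> real" assume X0: "\<forall>i. X i \<in> UNIV - {0}" and X: "X \<longlonglongrightarrow> 0"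
    have nz: "X i \<noteq> 0" for i using X0 by simp
    obtain K where K: "\<And>i. \<bar>X i\<bar> \<le> K"
      using convergent_imp_Bseq[of X] X by (auto simp: convergent_def Bseq_def)
    have K0: "K \<ge> 0" using K[of 0] by simp
    \<comment> \<open>A ball that contains the supports of all shifted kernels, since the shifts
      \<open>X i *\<^sub>R h\<close> have norm at most \<open>K * norm h\<close>; the difference
      quotients vanish outside it.\<close>
    define R where "R = norm x + r + K * norm h"
    define q where "q = (\<lambda>i y. f y * ((moll r (y - (x + X i *\<^sub>R h)) - moll r (y - x)) / X i))"
    obtain C where C: "C \<ge> 0" "AE y in lebesgue. norm y \<le> R \<longrightarrow> \<bar>f y\<bar> \<le> C"
      using Linf_loc_bound[OF f] by blast
    have "(\<lambda>i. \<integral>y. q i y \<partial>lebesgue) \<longlonglongrightarrow> (\<integral>y. f y * moll' r (y - x) (- h) \<partial>lebesgue)"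
    proof (rule integral_dominated_convergence)
      show "(\<lambda>y. f y * moll' r (y - x) (- h)) \<in> borel_measurable lebesgue"
        using mollify'_integrable[OF f r] by blast
      show "q i \<in> borel_measurable lebesgue" for i
      proof -
        have fm: "f \<in> borel_measurable lebesgue" using f by (simp add: Linf_loc_def)
        have "continuous_on UNIV (\<lambda>y. (moll r (y - (x + X i *\<^sub>R h)) - moll r (y - x)) / X i)"
          using nz by (intro continuous_intros) auto
        then show ?thesis
          unfolding q_def by (rule borel_measurable_times[OF fm continuous_borel_measurable_lebesgue])
      qed
      show "integrable lebesgue (\<lambda>y. C * (B * norm h) * indicat_real (cball 0 R) y)"
        by (rule integrable_indicator_ball)
      have "((\<lambda>i. (moll r (y - (x + X i *\<^sub>R h)) - moll r (y - x)) / X i) \<longlonglongrightarrow> moll' r (y - x) (- h))" for y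
      proof -
        have "((\<lambda>s. moll r ((y - x) + s *\<^sub>R (- h))) has_derivative (\<lambda>s. moll' r (y - x) (s *\<^sub>R (- h)))) (at 0)"
          by (rule has_derivative_compose[of "\<lambda>s. (y - x) + s *\<^sub>R (- h)" "\<lambda>s. s *\<^sub>R (- h)" 0 UNIV "moll r" "moll' r (y - x)"])
             (auto intro!: derivative_eq_intros moll_has_derivative)
        then have "((\<lambda>s. moll r ((y - x) + s *\<^sub>R (- h))) has_real_derivative moll' r (y - x) (- h)) (at 0)"
          by (simp add: has_field_derivative_def moll'_def mult_ac mult_commute_abs)
        then have "((\<lambda>s. (moll r ((y - x) + s *\<^sub>R (- h)) - moll r (y - x)) / s) \<longlongrightarrow> moll' r (y - x) (- h)) (at 0)"
          by (simp add: DERIV_def)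
        then have "(\<lambda>i. (moll r ((y - x) + X i *\<^sub>R (- h)) - moll r (y - x)) / X i) \<longlonglongrightarrow> moll' r (y - x) (- h)"
          using X nz unfolding tendsto_at_iff_sequentially by (auto simp: o_def)
        then show ?thesis by (simp add: algebra_simps)
      qed
      then show "AE y in lebesgue. (\<lambda>i. q i y) \<longlonglongrightarrow> f y * moll' r (y - x) (- h)"
        unfolding q_def by (intro always_eventually allI tendsto_mult tendsto_const)
      show "AE y in lebesgue. norm (q i y) \<le> C * (B * norm h) * indicat_real (cball 0 R) y" for i
        using C(2)
      proof eventually_elim
        case (elim y)
        show ?case
        proof (cases "norm y \<le> R")
          case True
          have "\<bar>moll r (y - (x + X i *\<^sub>R h)) - moll r (y - x)\<bar> \<le> B * norm ((y - (x + X i *\<^sub>R h)) - (y - x))"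
            by (rule B)
          also have "\<dots> = B * norm h * \<bar>X i\<bar>" by simp
          finally have "\<bar>(moll r (y - (x + X i *\<^sub>R h)) - moll r (y - x)) / X i\<bar> \<le> B * norm h"
            using nz[of i] by (simp add: abs_divide pos_divide_le_eq)
          then have "\<bar>f y\<bar> * \<bar>(moll r (y - (x + X i *\<^sub>R h)) - moll r (y - x)) / X i\<bar> \<le> C * (B * norm h)"
            using elim True C by (intro mult_mono) auto
          then show ?thesis using True by (simp add: q_def abs_mult)
        next
          case False
          have "norm (x + X i *\<^sub>R h) \<le> norm x + \<bar>X i\<bar> * norm h" using norm_triangle_ineq[of x "X i *\<^sub>R h"] by simp
          also have "\<dots> \<le> norm x + K * norm h" using K[of i] by (intro add_left_mono mult_right_mono) auto
          finally have "norm y > norm (x + X i *\<^sub>R h) + r" using False by (simp add: R_def)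
          moreover have "norm y > norm x + r" using False mult_nonneg_nonneg[OF K0 norm_ge_zero[of h]] by (simp add: R_def)
          ultimately show ?thesis using False by (simp add: q_def moll_support(1)[OF r])
        qed
      qed
    qed
    moreover have "(\<integral>y. q i y \<partial>lebesgue) = (mollify r f (x + X i *\<^sub>R h) - mollify r f x) / X i" for i
    proof -
      have "q i = (\<lambda>y. (f y * moll r (y - (x + X i *\<^sub>R h)) - f y * moll r (y - x)) / X i)"
        by (auto simp: q_def algebra_simps diff_divide_distrib)
      then show ?thesis unfolding mollify_def
        using mollify_integrable[OF f r] by simp
    qed
    moreover have "(\<integral>y. f y * moll' r (y - x) (- h) \<partial>lebesgue) = - (\<integral>y. f y * moll' r (y - x) h \<partial>lebesgue)"
      by (simp add: moll'_def)
    ultimately show "((\<lambda>s. (mollify r f (x + s *\<^sub>R h) - mollify r f x) / s) \<circ> X) \<longlonglongrightarrow>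
        - (\<integral>y. f y * moll' r (y - x) h \<partial>lebesgue)"
      by (simp add: o_def)
  qed
  then show ?thesis by (simp add: DERIV_def)
qed


text \<open>Translation invariance of Lebesgue measure, used for the Borel measure and carried over
  to its completion because the kernel is Borel measurable.\<close>

lemma mollify_one:
  fixes x :: "'a::euclidean_space"
  shows "mollify r (\<lambda>_. 1) x = mollify r (\<lambda>_. 1) (0::'a)"
proof -
  have m: "(\<lambda>y. moll r (y - x)) \<in> borel_measurable lborel" for x :: 'a
  proof -
    have "continuous_on UNIV (\<lambda>y. moll r (y - x))" by (intro continuous_intros)
    then show ?thesis using borel_measurable_continuous_onI by auto
  qed
  have "mollify r (\<lambda>_. 1) x = (\<integral>y. moll r (y - x) \<partial>lborel)"
    unfolding mollify_def using integral_completion[OF m[of x]] by simp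
  also have "\<dots> = (\<integral>y. moll r (- x + y) \<partial>lborel)"
    by simp
  also have "\<dots> = (\<integral>y. moll r y \<partial>distr lborel borel ((+) (- x)))"
    using m[of 0] by (intro integral_distr[symmetric]) auto
  also have "\<dots> = mollify r (\<lambda>_. 1) (0::'a)"
    unfolding lborel_distr_plus mollify_def using integral_completion[OF m[of 0], symmetric] by simp
  finally show ?thesis .
qed

lemma Linf_loc_continuous:
  fixes f :: "'a::euclidean_space \<Rightarrow> real"
  assumes f: "continuous_on UNIV f"
  shows "Linf_loc f"
  unfolding Linf_loc_def
proof (intro conjI allI impI)
  show "f \<in> borel_measurable lebesgue" by (rule continuous_borel_measurable_lebesgue[OF f])
  fix K :: "'a set" assume "compact K"
  then have "bounded (f ` K)"
    using f by (intro compact_imp_bounded compact_continuous_image) (auto intro: continuous_on_subset)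
  then obtain C where "\<And>x. x \<in> K \<Longrightarrow> \<bar>f x\<bar> \<le> C" unfolding bounded_iff by auto
  then show "\<exists>C. AE x in lebesgue. x \<in> K \<longrightarrow> \<bar>f x\<bar> \<le> C" by auto
qed

lemma mollify_one_pos:
  assumes r: "0 < r"
  shows "0 < mollify r (\<lambda>_. 1) (0::'a::euclidean_space)"
proof -
  have int: "integrable lebesgue (\<lambda>y::'a. moll r y)"
    using mollify_integrable[OF Linf_loc_continuous[of "\<lambda>_. 1"], of r "0::'a"] r by simp
  have "mollify r (\<lambda>_. 1) (0::'a) \<noteq> 0"
  proof
    assume "mollify r (\<lambda>_. 1) (0::'a) = 0"
    then have "AE y::'a in lebesgue. moll r y = 0"
      using integral_nonneg_eq_0_iff_AE[OF int] by (simp add: mollify_def moll_nonneg)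
    then have "AE y::'a in lebesgue. y \<notin> ball 0 r"
      by eventually_elim (use moll_pos[of _ r] in force)
    then have "ball 0 r \<in> null_sets (lebesgue :: 'a measure)"
      by (subst AE_iff_null_sets) auto
    then have "negligible (ball (0::'a) r)" by (simp add: negligible_iff_null_sets)
    then show False using open_not_negligible[of "ball (0::'a) r"] r by simp
  qed
  moreover have "0 \<le> mollify r (\<lambda>_. 1) (0::'a)"
    unfolding mollify_def by (intro integral_nonneg_AE) (simp add: moll_nonneg)
  ultimately show ?thesis by simp
qed

text \<open>This serves twice: with a second weak derivative as \<open>f\<close> it gives bounds
  uniform in the radius, and with \<open>\<lambda>y. U y - U x\<close> it gives convergence of the
  mollified potentials.\<close>

lemma mollify_bound:
  fixes f :: "'a::euclidean_space \<Rightarrow> real"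
  assumes int: "integrable lebesgue (\<lambda>y. f y * moll r (y - x))" and r: "0 \<le> r"
    and C: "AE y in lebesgue. norm (y - x) < r \<longrightarrow> \<bar>f y\<bar> \<le> C"
  shows "\<bar>mollify r f x\<bar> \<le> C * mollify r (\<lambda>_. 1) (0::'a)"
proof -
  have int1: "integrable lebesgue (\<lambda>y. C * moll r (y - x))"
    using mollify_integrable[OF Linf_loc_continuous[of "\<lambda>_. 1"] r, of x] by simp
  have "\<bar>mollify r f x\<bar> \<le> (\<integral>y. \<bar>f y * moll r (y - x)\<bar> \<partial>lebesgue)"
    unfolding mollify_def by (rule integral_abs_bound)
  also have "\<dots> \<le> (\<integral>y. C * moll r (y - x) \<partial>lebesgue)"
  proof (rule integral_mono_AE)
    show "AE y in lebesgue. \<bar>f y * moll r (y - x)\<bar> \<le> C * moll r (y - x)"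
      using C
    proof eventually_elim
      case (elim y)
      then show ?case
      proof (cases "norm (y - x) < r")
        case True
        then show ?thesis using elim moll_nonneg[of r "y - x"] by (simp add: abs_mult mult_right_mono)
      next
        case False
        then show ?thesis using r by (simp add: moll_outside)
      qed
    qed
  qed (use int int1 in auto)
  also have "\<dots> = C * mollify r (\<lambda>_. 1) x" by (simp add: mollify_def)
  also have "mollify r (\<lambda>_. 1) x = mollify r (\<lambda>_. 1) (0::'a)" by (rule mollify_one)
  finally show ?thesis .
qed

text \<open>The translated kernel is itself a test function. Inserting it into
  \<open>weak_partial_deriv\<close> moves the derivative from the kernel to \<open>f\<close>, so the
  derivative of the mollification is the mollification of the weak derivative.\<close>

lemma mollify_weak_gradient:
  fixes f :: "'a::euclidean_space \<Rightarrow> real"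
  assumes f: "Linf_loc f" and r: "0 \<le> r"
    and g: "\<And>b. b \<in> Basis \<Longrightarrow> weak_partial_deriv b f (g b)"
  shows "((\<lambda>s. mollify r f (x + s *\<^sub>R h)) has_real_derivative
           (\<Sum>b\<in>Basis. (h \<bullet> b) * mollify r (g b) (x + s *\<^sub>R h))) (at s)"
proof -
  have "((\<lambda>t. mollify r f (x + t *\<^sub>R h)) has_real_derivative (\<Sum>b\<in>Basis. (h \<bullet> b) * mollify r (g b) x)) (at 0)" for x
  proof -
    have "moll' r z h = (\<Sum>b\<in>Basis. (h \<bullet> b) * moll' r z b)" for z
      unfolding moll'_def euclidean_inner[of z h] by (simp add: sum_distrib_left sum_distrib_right mult_ac)
    then have "(\<integral>y. f y * moll' r (y - x) h \<partial>lebesgue)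
        = (\<integral>y. (\<Sum>b\<in>Basis. (h \<bullet> b) * (f y * moll' r (y - x) b)) \<partial>lebesgue)"
      by (simp add: sum_distrib_left mult_ac)
    also have "\<dots> = (\<Sum>b\<in>Basis. (h \<bullet> b) * (\<integral>y. f y * moll' r (y - x) b \<partial>lebesgue))"
      using mollify'_integrable[OF f r] by simp
    also have "\<dots> = (\<Sum>b\<in>Basis. (h \<bullet> b) * - mollify r (g b) x)"
    proof (intro sum.cong refl arg_cong2[of _ _ _ _ "(*)"])
      fix b :: 'a assume "b \<in> Basis"
      from g[OF this] test_function_moll[OF r, of x]
      have "(\<integral>y. f y * frechet_derivative (\<lambda>y. moll r (y - x)) (at y) b \<partial>lebesgue) = - (\<integral>y. g b y * moll r (y - x) \<partial>lebesgue)"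
        unfolding weak_partial_deriv_def by blast
      then show "(\<integral>y. f y * moll' r (y - x) b \<partial>lebesgue) = - mollify r (g b) x"
        by (simp add: frechet_derivative_moll mollify_def)
    qed
    finally show ?thesis
      using mollify_directional_derivative[OF f r, of x h] by (simp add: sum_negf)
  qed
  from this[of "x + s *\<^sub>R h"] show ?thesis
    using DERIV_shift[of "\<lambda>t. mollify r f (x + t *\<^sub>R h)" _ 0 s] by (simp add: algebra_simps)
qed

lemma mollify_mean_value:
  fixes f :: "'a::euclidean_space \<Rightarrow> real"
  assumes f: "Linf_loc f" and r: "0 \<le> r"
    and g: "\<And>b. b \<in> Basis \<Longrightarrow> weak_partial_deriv b f (g b)"
    and x: "norm x \<le> R" "norm (x + h) \<le> R"
  obtains \<xi> where "0 < \<xi>" "\<xi> < 1" "norm (x + \<xi> *\<^sub>R h) \<le> R"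
    "mollify r f (x + h) - mollify r f x = (\<Sum>b\<in>Basis. (h \<bullet> b) * mollify r (g b) (x + \<xi> *\<^sub>R h))"
proof -
  have "\<exists>\<xi>. 0 < \<xi> \<and> \<xi> < 1 \<and> mollify r f (x + 1 *\<^sub>R h) - mollify r f (x + 0 *\<^sub>R h)
      = (1 - 0) * (\<Sum>b\<in>Basis. (h \<bullet> b) * mollify r (g b) (x + \<xi> *\<^sub>R h))"
    by (rule MVT2) (auto intro: mollify_weak_gradient[OF f r g])
  then obtain \<xi> where \<xi>: "0 < \<xi>" "\<xi> < 1"
    "mollify r f (x + h) - mollify r f x = (\<Sum>b\<in>Basis. (h \<bullet> b) * mollify r (g b) (x + \<xi> *\<^sub>R h))" by auto
  have "(1 - \<xi>) *\<^sub>R x + \<xi> *\<^sub>R (x + h) \<in> cball 0 R"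
    using x \<xi> by (intro convexD[OF convex_cball]) auto
  then have "norm (x + \<xi> *\<^sub>R h) \<le> R" by (simp add: algebra_simps)
  then show ?thesis using that \<xi> by blast
qed

lemma abs_sum_Basis_le:
  fixes h :: "'a::euclidean_space" and C :: real
  assumes "\<And>b::'a. b \<in> Basis \<Longrightarrow> \<bar>c b\<bar> \<le> C"
  shows "\<bar>\<Sum>b\<in>Basis. (h \<bullet> b) * c b\<bar> \<le> DIM('a) * C * norm h"
proof -
  have "\<bar>\<Sum>b\<in>Basis. (h \<bullet> b) * c b\<bar> \<le> (\<Sum>b\<in>(Basis::'a set). norm h * C)"
    by (rule order_trans[OF sum_abs sum_mono])
       (auto simp: abs_mult intro!: mult_mono assms Basis_le_norm)
  then show ?thesis by (simp add: mult_ac)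
qed

text \<open>The mollified functions have gradients that are Lipschitz uniformly in the mollification
  parameter, so that pointwise convergence of the functions forces convergence of the gradients.\<close>

lemma W2inf_loc_gradient:
  fixes U :: "'a::euclidean_space \<Rightarrow> real"
  assumes cont: "continuous_on UNIV U" and W: "Wkinf_loc 2 U"
  obtains G where "\<And>x. GDERIV U x :> G x" "llip G"
proof -
  have "\<forall>b\<in>Basis. \<exists>g. weak_partial_deriv b U g \<and> Wkinf_loc (Suc 0) g" and U: "Linf_loc U"
    using W by (auto simp: numeral_2_eq_2 simp del: Wkinf_loc.simps(1))
  then obtain g where g: "\<And>b. b \<in> Basis \<Longrightarrow> weak_partial_deriv b U (g b)"
    and gW: "\<And>b. b \<in> Basis \<Longrightarrow> Wkinf_loc (Suc 0) (g b)" by metis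
  have gL: "Linf_loc (g b)" if "b \<in> Basis" for b using gW[OF that] by simp
  have "\<forall>b\<in>Basis. \<forall>c\<in>Basis. \<exists>g2. weak_partial_deriv c (g b) g2 \<and> Linf_loc g2"
    using gW by simp
  then obtain g2 where g2: "\<And>b c. b \<in> Basis \<Longrightarrow> c \<in> Basis \<Longrightarrow> weak_partial_deriv c (g b) (g2 b c)"
    and g2L: "\<And>b c. b \<in> Basis \<Longrightarrow> c \<in> Basis \<Longrightarrow> Linf_loc (g2 b c)" by metis
  define r where "r = (\<lambda>n. inverse (real (Suc n)))"
  have r: "0 < r n" "r n \<le> 1" for n by (auto simp: r_def inverse_le_1_iff)
  have r0: "0 \<le> r n" for n using r(1)[of n] by simp
  define Z where "Z = (\<lambda>n. mollify (r n) (\<lambda>_. 1) (0::'a))"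
  have Z: "Z n > 0" for n unfolding Z_def by (rule mollify_one_pos[OF r(1)])
  \<comment> \<open>Normalised mollifications with radii tending to 0. The functions
    \<open>a n b\<close> are the partial derivatives of \<open>u n\<close>.\<close>
  define a where "a = (\<lambda>n b x. mollify (r n) (g b) x / Z n)"
  define u where "u = (\<lambda>n x. mollify (r n) U x / Z n)"
  define D where "D = real DIM('a)"
  have D: "D > 0" by (simp add: D_def)
  \<comment> \<open>The constant does not depend on n: the radii are at most 1, so on the ball of
    radius R only second weak derivatives on the ball of radius R + 1 are seen, where they are
    essentially bounded. The second clause is a first-order Taylor formula with quadratic
    remainder.\<close>
  have lip: "\<exists>L\<ge>0. (\<forall>n x h. \<forall>b\<in>Basis. norm x \<le> R \<longrightarrow> norm (x + h) \<le> R \<longrightarrow> \<bar>a n b (x + h) - a n b x\<bar> \<le> L * norm h)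
      \<and> (\<forall>n x h. norm x \<le> R \<longrightarrow> norm (x + h) \<le> R \<longrightarrow>
            \<bar>u n (x + h) - u n x - (\<Sum>b\<in>Basis. (h \<bullet> b) * a n b x)\<bar> \<le> D * L * (norm h)\<^sup>2)" for R
  proof -
    have "\<forall>b\<in>Basis. \<forall>c\<in>Basis. \<exists>C\<ge>0. AE y in lebesgue. norm y \<le> R + 1 \<longrightarrow> \<bar>g2 b c y\<bar> \<le> C"
      using Linf_loc_bound[OF g2L] by metis
    then obtain C0 where C0: "\<And>b c. b \<in> Basis \<Longrightarrow> c \<in> Basis \<Longrightarrow> C0 b c \<ge> 0"
      "\<And>b c. b \<in> Basis \<Longrightarrow> c \<in> Basis \<Longrightarrow> AE y in lebesgue. norm y \<le> R + 1 \<longrightarrow> \<bar>g2 b c y\<bar> \<le> C0 b c"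
      by metis
    define C where "C = (\<Sum>b\<in>Basis. \<Sum>c\<in>Basis. C0 b c)"
    have Cle: "C0 b c \<le> C" if "b \<in> Basis" "c \<in> Basis" for b c
    proof -
      have "C0 b c \<le> (\<Sum>c\<in>Basis. C0 b c)" using that C0(1) by (intro member_le_sum) auto
      also have "\<dots> \<le> C" unfolding C_def using that C0(1)
        by (intro member_le_sum[of b Basis "\<lambda>b. \<Sum>c\<in>Basis. C0 b c"]) (auto intro: sum_nonneg)
      finally show ?thesis .
    qed
    have C: "C \<ge> 0" unfolding C_def using C0(1) by (intro sum_nonneg) auto
    have m2: "\<bar>mollify (r n) (g2 b c) x\<bar> \<le> C * Z n"
      if bc: "b \<in> Basis" "c \<in> Basis" and x: "norm x \<le> R" for b c n x
      unfolding Z_def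
    proof (rule mollify_bound[OF mollify_integrable[OF g2L[OF bc] r0] r0])
      show "AE y in lebesgue. norm (y - x) < r n \<longrightarrow> \<bar>g2 b c y\<bar> \<le> C"
        using C0(2)[OF bc]
      proof eventually_elim
        case (elim y)
        show ?case
        proof
          assume "norm (y - x) < r n"
          then have "norm y \<le> R + 1" using x r(2)[of n] norm_triangle_ineq2[of y x] by linarith
          then show "\<bar>g2 b c y\<bar> \<le> C" using elim Cle[OF bc] by simp
        qed
      qed
    qed
    have lip1: "\<bar>a n b (x + h) - a n b x\<bar> \<le> (D * C) * norm h"
      if b: "b \<in> Basis" and x: "norm x \<le> R" "norm (x + h) \<le> R" for n b x h
    proof -
      obtain \<xi> where \<xi>: "norm (x + \<xi> *\<^sub>R h) \<le> R"
        "mollify (r n) (g b) (x + h) - mollify (r n) (g b) x = (\<Sum>c\<in>Basis. (h \<bullet> c) * mollify (r n) (g2 b c) (x + \<xi> *\<^sub>R h))"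
        using mollify_mean_value[OF gL[OF b] r0 g2[OF b] x] by metis
      have "\<bar>mollify (r n) (g b) (x + h) - mollify (r n) (g b) x\<bar> \<le> D * (C * Z n) * norm h"
        unfolding \<xi>(2) D_def using abs_sum_Basis_le[of "\<lambda>c. mollify (r n) (g2 b c) (x + \<xi> *\<^sub>R h)" "C * Z n" h] m2[OF b _ \<xi>(1)] by simp
      then show ?thesis
        using Z[of n] by (simp add: a_def diff_divide_distrib[symmetric] abs_divide pos_divide_le_eq mult_ac)
    qed
    have "\<bar>u n (x + h) - u n x - (\<Sum>b\<in>Basis. (h \<bullet> b) * a n b x)\<bar> \<le> D * (D * C) * (norm h)\<^sup>2"
      if x: "norm x \<le> R" "norm (x + h) \<le> R" for n x h
    proof -
      obtain \<xi> where \<xi>: "0 < \<xi>" "\<xi> < 1" "norm (x + \<xi> *\<^sub>R h) \<le> R"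
        "mollify (r n) U (x + h) - mollify (r n) U x = (\<Sum>c\<in>Basis. (h \<bullet> c) * mollify (r n) (g c) (x + \<xi> *\<^sub>R h))"
        using mollify_mean_value[OF U r0 g x] by metis
      have "u n (x + h) - u n x = (\<Sum>c\<in>Basis. (h \<bullet> c) * a n c (x + \<xi> *\<^sub>R h))"
        unfolding u_def a_def diff_divide_distrib[symmetric] \<xi>(4) by (simp add: sum_divide_distrib)
      then have "u n (x + h) - u n x - (\<Sum>b\<in>Basis. (h \<bullet> b) * a n b x)
          = (\<Sum>b\<in>Basis. (h \<bullet> b) * (a n b (x + \<xi> *\<^sub>R h) - a n b x))"
        by (simp add: sum_subtractf right_diff_distrib)
      also have "\<bar>\<dots>\<bar> \<le> D * (D * C * norm h) * norm h"
        unfolding D_def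
      proof (intro abs_sum_Basis_le)
        fix b :: 'a assume b: "b \<in> Basis"
        have "\<bar>a n b (x + \<xi> *\<^sub>R h) - a n b x\<bar> \<le> D * C * norm (\<xi> *\<^sub>R h)" by (rule lip1[OF b x(1) \<xi>(3)])
        also have "\<dots> \<le> D * C * norm h"
          using \<xi> D C by (intro mult_left_mono) (auto simp: mult_left_le_one_le)
        finally show "\<bar>a n b (x + \<xi> *\<^sub>R h) - a n b x\<bar> \<le> real DIM('a) * C * norm h" by (simp add: D_def)
      qed
      finally show ?thesis by (simp add: power2_eq_square mult_ac)
    qed
    then show ?thesis using lip1 C D by (intro exI[of _ "D * C"]) auto
  qed
  \<comment> \<open>Continuity of \<open>U\<close> gives convergence at every point rather than at
    almost every point.\<close>
  have u_lim: "(\<lambda>n. u n x) \<longlonglongrightarrow> U x" for x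
  proof (rule LIMSEQ_I)
    fix e :: real assume e: "e > 0"
    have "isCont U x" using cont by (simp add: continuous_on_eq_continuous_at)
    then obtain d where d: "d > 0" "\<And>y. norm (y - x) < d \<Longrightarrow> \<bar>U y - U x\<bar> < e / 2"
      using e unfolding continuous_at_eps_delta dist_norm real_norm_def by (metis half_gt_zero)
    obtain N where N: "r N < d" using d(1) reals_Archimedean[of d] by (auto simp: r_def)
    have "norm (u n x - U x) < e" if n: "n \<ge> N" for n
    proof -
      have rn: "r n \<le> r N" using n by (simp add: r_def le_imp_inverse_le)
      have i1: "integrable lebesgue (\<lambda>y. U x * (1 * moll (r n) (y - x)))"
        by (intro integrable_mult_right mollify_integrable Linf_loc_continuous r0) auto
      have i2: "integrable lebesgue (\<lambda>y. U y * moll (r n) (y - x))" by (rule mollify_integrable[OF U r0])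
      have eq: "(\<lambda>y. (U y - U x) * moll (r n) (y - x)) = (\<lambda>y. U y * moll (r n) (y - x) - U x * (1 * moll (r n) (y - x)))"
        by (auto simp: algebra_simps)
      have "\<bar>mollify (r n) (\<lambda>y. U y - U x) x\<bar> \<le> (e / 2) * Z n"
        unfolding Z_def
      proof (rule mollify_bound[OF _ r0])
        show "integrable lebesgue (\<lambda>y. (U y - U x) * moll (r n) (y - x))"
          unfolding eq using i1 i2 by (intro Bochner_Integration.integrable_diff)
        show "AE y in lebesgue. norm (y - x) < r n \<longrightarrow> \<bar>U y - U x\<bar> \<le> e / 2"
          using d(2) rn N by (intro always_eventually) (auto intro: less_imp_le)
      qed
      also have "mollify (r n) (\<lambda>y. U y - U x) x = mollify (r n) U x - U x * mollify (r n) (\<lambda>_. 1) x"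
        unfolding mollify_def eq using i1 i2 by simp
      also have "\<dots> = (u n x - U x) * Z n"
        using Z[of n] mollify_one[of "r n" x] by (simp add: u_def Z_def algebra_simps)
      finally have "\<bar>u n x - U x\<bar> \<le> e / 2" using Z[of n] by (simp add: abs_mult)
      then show ?thesis using e by simp
    qed
    then show "\<exists>N. \<forall>n\<ge>N. norm (u n x - U x) < e" by blast
  qed
  \<comment> \<open>\<open>a n b x\<close> differs from the difference quotient of
    \<open>u n\<close> with a fixed step \<delta> by at most \<open>D * L * \<delta>\<close>,
    uniformly in n, and these quotients converge because \<open>u n\<close> does.\<close>
  have conv: "convergent (\<lambda>n. a n b x)" if b: "b \<in> Basis" for b x
  proof -
    obtain L where L0: "L \<ge> 0" and L':
      "\<And>n y h. norm y \<le> norm x + 1 \<Longrightarrow> norm (y + h) \<le> norm x + 1 \<Longrightarrow>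
         \<bar>u n (y + h) - u n y - (\<Sum>b\<in>Basis. (h \<bullet> b) * a n b y)\<bar> \<le> D * L * (norm h)\<^sup>2"
      using lip[of "norm x + 1"] by blast
    have L: "L \<ge> 0"
      "\<And>n h. norm (x + h) \<le> norm x + 1 \<Longrightarrow> \<bar>u n (x + h) - u n x - (\<Sum>b\<in>Basis. (h \<bullet> b) * a n b x)\<bar> \<le> D * L * (norm h)\<^sup>2"
      using L0 L'[of x] by auto
    have "Cauchy (\<lambda>n. a n b x)"
    proof (rule CauchyI)
      fix e :: real assume e: "e > 0"
      \<comment> \<open>The bound 1 keeps \<open>x + h\<close> in the ball where \<open>L\<close> is
        valid; the other one makes each remainder at most \<delta> e/8. Two remainders and four
        approximation errors of \<delta> e/16 add up to \<delta> e/2.\<close>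
      define \<delta> where "\<delta> = min 1 (e / (8 * (D * L + 1)))"
      have DL: "D * L \<ge> 0" using D L by simp
      have \<delta>: "\<delta> > 0" "\<delta> \<le> 1" using e DL by (auto simp: \<delta>_def)
      have DL\<delta>: "D * L * \<delta> \<le> e / 8"
      proof -
        have "D * L * \<delta> \<le> (D * L + 1) * (e / (8 * (D * L + 1)))"
          using DL \<delta> by (intro mult_mono) (auto simp: \<delta>_def)
        also have "\<dots> = ((D * L + 1) * e) / ((D * L + 1) * 8)"
          by (simp only: times_divide_eq_right mult.commute[of 8])
        also have "\<dots> = e / 8" using DL by (intro nonzero_mult_divide_mult_cancel_left) simp
        finally show ?thesis .
      qed
      define h where "h = \<delta> *\<^sub>R b"
      have nh: "norm h = \<delta>" using b \<delta> by (simp add: h_def)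
      have xh: "norm (x + h) \<le> norm x + 1" using norm_triangle_ineq[of x h] nh \<delta> by linarith
      have sum: "(\<Sum>c\<in>Basis. (h \<bullet> c) * a n c x) = \<delta> * a n b x" for n
      proof -
        have "(\<Sum>c\<in>Basis. (h \<bullet> c) * a n c x) = (\<Sum>c\<in>Basis. if c = b then \<delta> * a n b x else 0)"
          using b by (intro sum.cong) (auto simp: h_def inner_Basis)
        then show ?thesis using b by simp
      qed
      have est: "\<bar>u n (x + h) - u n x - \<delta> * a n b x\<bar> \<le> \<delta> * (e / 8)" for n
      proof -
        have "\<bar>u n (x + h) - u n x - \<delta> * a n b x\<bar> \<le> D * L * \<delta>\<^sup>2" using L(2)[OF xh, of n] by (simp add: sum nh)
        also have "\<dots> = \<delta> * (D * L * \<delta>)" by (simp add: power2_eq_square)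
        also have "\<dots> \<le> \<delta> * (e / 8)" using DL\<delta> \<delta> by (intro mult_left_mono) auto
        finally show ?thesis .
      qed
      have "\<delta> * (e / 16) > 0" using \<delta> e by simp
      from LIMSEQ_D[OF u_lim[of x] this] LIMSEQ_D[OF u_lim[of "x + h"] this]
      obtain N1 N2 where N12: "\<And>n. n \<ge> N1 \<Longrightarrow> \<bar>u n x - U x\<bar> < \<delta> * (e / 16)"
        "\<And>n. n \<ge> N2 \<Longrightarrow> \<bar>u n (x + h) - U (x + h)\<bar> < \<delta> * (e / 16)"
        unfolding real_norm_def by blast
      define N where "N = max N1 N2"
      have N: "\<And>n. n \<ge> N \<Longrightarrow> \<bar>u n x - U x\<bar> < \<delta> * (e / 16)"
        "\<And>n. n \<ge> N \<Longrightarrow> \<bar>u n (x + h) - U (x + h)\<bar> < \<delta> * (e / 16)"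
        using N12 by (auto simp: N_def)
      have "norm (a m b x - a n b x) < e" if "m \<ge> N" "n \<ge> N" for m n
      proof -
        have "\<bar>\<delta> * a m b x - \<delta> * a n b x\<bar> \<le> 2 * (\<delta> * (e / 8)) + 4 * (\<delta> * (e / 16))"
          using est[of m] est[of n] N[OF that(1)] N[OF that(2)] by linarith
        also have "\<dots> < \<delta> * e" using \<delta> e by simp
        finally have "\<delta> * \<bar>a m b x - a n b x\<bar> < \<delta> * e"
          using \<delta> by (simp add: right_diff_distrib[symmetric] abs_mult)
        then show ?thesis using \<delta> by simp
      qed
      then show "\<exists>N. \<forall>m\<ge>N. \<forall>n\<ge>N. norm (a m b x - a n b x) < e" by blast
    qed
    then show ?thesis by (simp add: Cauchy_convergent_iff)
  qed
  define A where "A = (\<lambda>b x. lim (\<lambda>n. a n b x))"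
  have A: "(\<lambda>n. a n b x) \<longlonglongrightarrow> A b x" if "b \<in> Basis" for b x
    using conv[OF that] unfolding A_def convergent_LIMSEQ_iff .
  define G where "G = (\<lambda>x. \<Sum>b\<in>Basis. A b x *\<^sub>R b)"
  have G: "h \<bullet> G x = (\<Sum>b\<in>Basis. (h \<bullet> b) * A b x)" for h x
    by (simp add: G_def inner_sum_right mult.commute)
  \<comment> \<open>Both estimates of \<open>lip\<close> survive the limit because their constants
    are uniform in n. The Taylor formula yields differentiability of \<open>U\<close>, and the other
    estimate the local Lipschitz property of the gradient.\<close>
  have ulim': "\<exists>L\<ge>0. (\<forall>x h. \<forall>b\<in>Basis. norm x \<le> R \<longrightarrow> norm (x + h) \<le> R \<longrightarrow> \<bar>A b (x + h) - A b x\<bar> \<le> L * norm h)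
      \<and> (\<forall>x h. norm x \<le> R \<longrightarrow> norm (x + h) \<le> R \<longrightarrow> \<bar>U (x + h) - U x - h \<bullet> G x\<bar> \<le> D * L * (norm h)\<^sup>2)" for R
  proof -
    obtain L where L: "L \<ge> 0"
      "\<And>n x h b. b \<in> Basis \<Longrightarrow> norm x \<le> R \<Longrightarrow> norm (x + h) \<le> R \<Longrightarrow> \<bar>a n b (x + h) - a n b x\<bar> \<le> L * norm h"
      "\<And>n x h. norm x \<le> R \<Longrightarrow> norm (x + h) \<le> R \<Longrightarrow> \<bar>u n (x + h) - u n x - (\<Sum>b\<in>Basis. (h \<bullet> b) * a n b x)\<bar> \<le> D * L * (norm h)\<^sup>2"
      using lip[of R] by blast
    have "\<bar>A b (x + h) - A b x\<bar> \<le> L * norm h" if "b \<in> Basis" "norm x \<le> R" "norm (x + h) \<le> R" for b x h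
      by (rule LIMSEQ_le_const2[OF tendsto_rabs[OF tendsto_diff[OF A A]]]) (use that L(2) in auto)
    moreover have "\<bar>U (x + h) - U x - h \<bullet> G x\<bar> \<le> D * L * (norm h)\<^sup>2" if "norm x \<le> R" "norm (x + h) \<le> R" for x h
      unfolding G
      by (rule LIMSEQ_le_const2[of "\<lambda>n. \<bar>u n (x + h) - u n x - (\<Sum>b\<in>Basis. (h \<bullet> b) * a n b x)\<bar>"])
         (use that L(3) in \<open>auto intro!: tendsto_intros u_lim A\<close>)
    ultimately show ?thesis using L(1) by blast
  qed
  show ?thesis
  proof (rule that)
    fix x :: 'a
    obtain L where L0: "L \<ge> 0" and L': "\<And>y h. norm y \<le> norm x + 1 \<Longrightarrow> norm (y + h) \<le> norm x + 1 \<Longrightarrow>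
        \<bar>U (y + h) - U y - h \<bullet> G y\<bar> \<le> D * L * (norm h)\<^sup>2"
      using ulim'[of "norm x + 1"] by blast
    have L: "L \<ge> 0" "\<And>h. norm (x + h) \<le> norm x + 1 \<Longrightarrow> \<bar>U (x + h) - U x - h \<bullet> G x\<bar> \<le> D * L * (norm h)\<^sup>2"
      using L0 L'[of x] by auto
    have "((\<lambda>h. norm (U (x + h) - U x - h \<bullet> G x) / norm h) \<longlongrightarrow> 0) (at 0)"
    proof (rule tendsto_sandwich[where f="\<lambda>_. 0" and h="\<lambda>h::'a. D * L * norm h"])
      show "\<forall>\<^sub>F h in at 0. norm (U (x + h) - U x - h \<bullet> G x) / norm h \<le> D * L * norm h"
      proof (rule eventually_at_ball'[THEN eventually_mono, of 1])
        fix h :: 'a assume h: "h \<in> ball 0 1 \<and> h \<noteq> 0 \<and> h \<in> UNIV"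
        then have "norm (x + h) \<le> norm x + 1" using norm_triangle_ineq[of x h] by simp
        from L(2)[OF this] show "norm (U (x + h) - U x - h \<bullet> G x) / norm h \<le> D * L * norm h"
          using h by (simp add: pos_divide_le_eq power2_eq_square mult_ac)
      qed simp
      have "((\<lambda>h::'a. D * L * norm h) \<longlongrightarrow> D * L * norm (0::'a)) (at 0)"
        by (intro tendsto_intros)
      then show "((\<lambda>h::'a. D * L * norm h) \<longlongrightarrow> 0) (at 0)" by simp
    qed (auto intro: always_eventually)
    then show "GDERIV U x :> G x"
      unfolding gderiv_def has_derivative_at by (auto intro: bounded_linear_intros)
  next
    show "llip G"
    proof (rule llipI)
      fix R :: real
      obtain L where L: "L \<ge> 0" "\<And>x h b. b \<in> Basis \<Longrightarrow> norm x \<le> R \<Longrightarrow> norm (x + h) \<le> R \<Longrightarrow> \<bar>A b (x + h) - A b x\<bar> \<le> L * norm h"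
        using ulim'[of R] by blast
      show "\<exists>L\<ge>0. \<forall>x y. norm x \<le> R \<longrightarrow> norm y \<le> R \<longrightarrow> norm (G x - G y) \<le> L * norm (x - y)"
      proof (intro exI[of _ "D * L"] conjI allI impI)
        fix x y :: 'a assume xy: "norm x \<le> R" "norm y \<le> R"
        have "norm (G x - G y) \<le> (\<Sum>b\<in>Basis. \<bar>(G x - G y) \<bullet> b\<bar>)" by (rule norm_le_l1)
        also have "\<dots> \<le> (\<Sum>b\<in>(Basis::'a set). L * norm (x - y))"
        proof (rule sum_mono)
          fix b :: 'a assume b: "b \<in> Basis"
          have "(G x - G y) \<bullet> b = A b x - A b y"
            using b by (simp add: G_def inner_diff_left inner_sum_left_Basis)
          then show "\<bar>(G x - G y) \<bullet> b\<bar> \<le> L * norm (x - y)" using L(2)[OF b xy(2), of "x - y"] xy by simp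
        qed
        finally show "norm (G x - G y) \<le> D * L * norm (x - y)" by (simp add: D_def)
      qed (use D L in auto)
    qed
  qed
qed

section \<open>Recurrence\<close>

lemma has_vector_derivative_shift_halfline:
  assumes "(y has_vector_derivative d) (at (s + t) within {0..})" "0 \<le> s" "0 \<le> (t::real)"
  shows "((\<lambda>t. y (s + t)) has_vector_derivative d) (at t within {0..})"
proof -
  have "(y has_vector_derivative d) (at (s + t) within (\<lambda>t. s + t) ` {0..})"
    by (rule has_vector_derivative_within_subset[OF assms(1)]) (use assms(2) in auto)
  moreover have "((\<lambda>t. s + t) has_vector_derivative 1) (at t within {0..})"
    by (auto intro!: derivative_eq_intros)
  ultimately have "((y \<circ> (\<lambda>t. s + t)) has_vector_derivative 1 *\<^sub>R d) (at t within {0..})"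
    by (intro vector_diff_chain_within)
  then show ?thesis by (simp add: o_def)
qed

text \<open>Only trajectories that start in the compact, forward invariant set \<open>Q\<close> are
  spoken of. The semigroup law, injectivity and continuity in the data are not assumed; they follow
  from the Lipschitz bounds. In the application \<open>Q\<close> is an energy sublevel.\<close>

locale compact_semiflow =
  fixes F :: "'a::euclidean_space \<Rightarrow> 'a" and \<Phi> :: "'a \<Rightarrow> real \<Rightarrow> 'a" and \<rho> :: "'a \<Rightarrow> real" and Q :: "'a set"
  assumes F: "llip F" and \<rho>: "llip \<rho>" and \<rho>_nonneg: "\<And>z. 0 \<le> \<rho> z" and Q: "compact Q"
    and \<Phi>0: "\<And>z. z \<in> Q \<Longrightarrow> \<Phi> z 0 = z"
    and \<Phi>: "\<And>z t. z \<in> Q \<Longrightarrow> 0 \<le> t \<Longrightarrow> (\<Phi> z has_vector_derivative F (\<Phi> z t)) (at t within {0..})"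
    and stay: "\<And>z t. z \<in> Q \<Longrightarrow> 0 \<le> t \<Longrightarrow> \<Phi> z t \<in> Q"
begin

definition R where "R = (SOME R. \<forall>z\<in>Q. norm z \<le> R)"

lemma R: "z \<in> Q \<Longrightarrow> norm z \<le> R"
  unfolding R_def using someI_ex[of "\<lambda>R. \<forall>z\<in>Q. norm z \<le> R"] compact_imp_bounded[OF Q]
  by (auto simp: bounded_iff)

text \<open>Read from left to right this is forward uniqueness, which yields the semigroup law; read
  from right to left it is backward uniqueness, which yields injectivity.\<close>

lemma trajectories_eq:
  assumes y: "\<And>t. 0 \<le> t \<Longrightarrow> t \<le> T \<Longrightarrow> (y has_vector_derivative F (y t)) (at t within {0..})" "\<And>t. 0 \<le> t \<Longrightarrow> t \<le> T \<Longrightarrow> y t \<in> Q"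
    and z: "\<And>t. 0 \<le> t \<Longrightarrow> t \<le> T \<Longrightarrow> (z has_vector_derivative F (z t)) (at t within {0..})" "\<And>t. 0 \<le> t \<Longrightarrow> t \<le> T \<Longrightarrow> z t \<in> Q"
    and T: "0 \<le> T"
  shows "y 0 = z 0 \<longleftrightarrow> y T = z T"
proof -
  obtain L where L: "L \<ge> 0" "\<And>u v. norm u \<le> R \<Longrightarrow> norm v \<le> R \<Longrightarrow> norm (F u - F v) \<le> L * norm (u - v)"
    using llipE[OF F] by metis
  have "norm (y T - z T) \<le> exp (L * T) * norm (y 0 - z 0)" "norm (y 0 - z 0) \<le> exp (L * T) * norm (y T - z T)"
    by (rule trajectories_distance[where F=F and R=R]; use y z R L(2) T in auto)+
  then show ?thesis by auto
qed

lemma semigroup: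
  assumes z: "z \<in> Q" and st: "0 \<le> s" "0 \<le> t"
  shows "\<Phi> (\<Phi> z s) t = \<Phi> z (s + t)"
proof -
  have zs: "\<Phi> z s \<in> Q" using stay z st by auto
  have "\<Phi> (\<Phi> z s) 0 = \<Phi> z (s + 0) \<longleftrightarrow> \<Phi> (\<Phi> z s) t = \<Phi> z (s + t)"
    by (rule trajectories_eq[of t "\<Phi> (\<Phi> z s)" "\<lambda>t. \<Phi> z (s + t)"])
       (use z zs st in \<open>auto intro!: \<Phi> stay has_vector_derivative_shift_halfline\<close>)
  then show ?thesis using \<Phi>0[OF zs] by simp
qed

lemma injective:
  assumes "y \<in> Q" "z \<in> Q" "0 \<le> t" "\<Phi> y t = \<Phi> z t"
  shows "y = z"
  using trajectories_eq[of t "\<Phi> y" "\<Phi> z"] assms \<Phi> stay \<Phi>0 by auto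

text \<open>A value \<rho> \<ge> \<delta> at one time therefore persists as \<rho> \<ge> \<delta>/2
  over a length of time that is the same for all trajectories in \<open>Q\<close>.\<close>

lemma \<rho>_along_lipschitz:
  obtains \<Lambda> where "\<Lambda> > 0" "\<And>z s t. z \<in> Q \<Longrightarrow> 0 \<le> s \<Longrightarrow> s \<le> t \<Longrightarrow> \<bar>\<rho> (\<Phi> z t) - \<rho> (\<Phi> z s)\<bar> \<le> \<Lambda> * (t - s)"
proof -
  obtain L where L: "L \<ge> 0" "\<And>u v. norm u \<le> R \<Longrightarrow> norm v \<le> R \<Longrightarrow> norm (\<rho> u - \<rho> v) \<le> L * norm (u - v)"
    using llipE[OF \<rho>] by metis
  obtain B where B: "B \<ge> 0" "\<And>x. norm x \<le> R \<Longrightarrow> norm (F x) \<le> B" using llip_bounded[OF F] by metis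
  show ?thesis
  proof (rule that[of "L * B + 1"])
    show "L * B + 1 > 0" using L B by (simp add: add_nonneg_pos)
    fix z and s t :: real assume z: "z \<in> Q" and st: "0 \<le> s" "s \<le> t"
    have "norm (\<rho> (\<Phi> z t) - \<rho> (\<Phi> z s)) \<le> L * norm (\<Phi> z t - \<Phi> z s)"
      using z st by (intro L R stay) auto
    also have "\<dots> \<le> L * (B * (t - s))"
      using z st by (intro mult_left_mono L vector_derivative_increment_bound[where y'="\<lambda>s. F (\<Phi> z s)"])
        (auto intro!: \<Phi> B R stay)
    also have "\<dots> \<le> (L * B + 1) * (t - s)" using st by (simp add: algebra_simps)
    finally show "\<bar>\<rho> (\<Phi> z t) - \<rho> (\<Phi> z s)\<bar> \<le> (L * B + 1) * (t - s)" by simp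
  qed
qed

lemma \<Phi>_continuous: "z \<in> Q \<Longrightarrow> continuous_on {0..} (\<Phi> z)"
  using \<Phi> by (auto simp: continuous_on_eq_continuous_within intro: has_vector_derivative_continuous)

lemma \<rho>_along_continuous: "z \<in> Q \<Longrightarrow> continuous_on {0..} (\<lambda>s. \<rho> (\<Phi> z s))"
  by (rule continuous_on_compose2[OF llip_continuous[OF \<rho>, of UNIV] \<Phi>_continuous]) auto

lemma \<rho>_integrable: "z \<in> Q \<Longrightarrow> 0 \<le> a \<Longrightarrow> (\<lambda>s. \<rho> (\<Phi> z s)) integrable_on {a..b}"
  by (intro integrable_continuous_interval continuous_on_subset[OF \<rho>_along_continuous]) auto

lemma data_lipschitz:
  assumes "0 \<le> T"
  obtains C where "C \<ge> 0" "\<And>y z t. y \<in> Q \<Longrightarrow> z \<in> Q \<Longrightarrow> 0 \<le> t \<Longrightarrow> t \<le> T \<Longrightarrow> \<bar>\<rho> (\<Phi> y t) - \<rho> (\<Phi> z t)\<bar> \<le> C * norm (y - z)"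
proof -
  obtain L where L: "L \<ge> 0" "\<And>u v. norm u \<le> R \<Longrightarrow> norm v \<le> R \<Longrightarrow> norm (\<rho> u - \<rho> v) \<le> L * norm (u - v)"
    using llipE[OF \<rho>] by metis
  have "\<exists>C\<ge>0. \<forall>y\<in>Q. \<forall>z\<in>Q. \<forall>t\<in>{0..T}. norm (\<Phi> y t - \<Phi> z t) \<le> C * norm (y - z)"
    by (rule flow_lipschitz_in_data[OF F, where R=R]) (auto intro!: \<Phi>0 \<Phi> R stay)
  then obtain C where C: "C \<ge> 0" "\<And>y z t. y \<in> Q \<Longrightarrow> z \<in> Q \<Longrightarrow> t \<in> {0..T} \<Longrightarrow> norm (\<Phi> y t - \<Phi> z t) \<le> C * norm (y - z)"
    by blast
  show ?thesis
  proof (rule that[of "L * C"])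
    show "L * C \<ge> 0" using L C by simp
    show "\<bar>\<rho> (\<Phi> y t) - \<rho> (\<Phi> z t)\<bar> \<le> L * C * norm (y - z)" if "y \<in> Q" "z \<in> Q" "0 \<le> t" "t \<le> T" for y z t
    proof -
      have "norm (\<rho> (\<Phi> y t) - \<rho> (\<Phi> z t)) \<le> L * norm (\<Phi> y t - \<Phi> z t)" using that by (intro L R stay) auto
      also have "\<dots> \<le> L * (C * norm (y - z))" using that by (intro mult_left_mono C L) auto
      finally show ?thesis by simp
    qed
  qed
qed

text \<open>The bound is imposed on every finite time interval, which makes the set an intersection
  of closed conditions on \<open>Q\<close>, hence compact.\<close>

definition visiting :: "real \<Rightarrow> real \<Rightarrow> real \<Rightarrow> 'a set" where
  "visiting M \<delta> q = {z \<in> Q. \<delta> \<le> \<rho> (\<Phi> z q) \<and> (\<forall>T\<ge>0. integral {0..T} (\<lambda>s. \<rho> (\<Phi> z s)) \<le> M)}"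

lemma compact_visiting:
  assumes q: "0 \<le> q"
  shows "compact (visiting M \<delta> q)"
proof -
  have c1: "continuous_on Q (\<lambda>z. \<rho> (\<Phi> z T))" if T: "0 \<le> T" for T
  proof -
    obtain C where C: "C \<ge> 0" "\<And>y z t. y \<in> Q \<Longrightarrow> z \<in> Q \<Longrightarrow> 0 \<le> t \<Longrightarrow> t \<le> T \<Longrightarrow> \<bar>\<rho> (\<Phi> y t) - \<rho> (\<Phi> z t)\<bar> \<le> C * norm (y - z)"
      using data_lipschitz[OF T] by metis
    show ?thesis
      by (rule lipschitz_on_continuous_on[of C]) (use C T in \<open>auto intro!: lipschitz_onI simp: dist_norm\<close>)
  qed
  have c2: "continuous_on Q (\<lambda>z. integral {0..T} (\<lambda>s. \<rho> (\<Phi> z s)))" if T: "0 \<le> T" for T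
  proof -
    obtain C where C: "C \<ge> 0" "\<And>y z t. y \<in> Q \<Longrightarrow> z \<in> Q \<Longrightarrow> 0 \<le> t \<Longrightarrow> t \<le> T \<Longrightarrow> \<bar>\<rho> (\<Phi> y t) - \<rho> (\<Phi> z t)\<bar> \<le> C * norm (y - z)"
      using data_lipschitz[OF T] by metis
    have "norm (integral {0..T} (\<lambda>s. \<rho> (\<Phi> y s)) - integral {0..T} (\<lambda>s. \<rho> (\<Phi> z s))) \<le> (C * T) * norm (y - z)"
      if yz: "y \<in> Q" "z \<in> Q" for y z
    proof -
      have "integral {0..T} (\<lambda>s. \<rho> (\<Phi> y s)) - integral {0..T} (\<lambda>s. \<rho> (\<Phi> z s))
          = integral {0..T} (\<lambda>s. \<rho> (\<Phi> y s) - \<rho> (\<Phi> z s))"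
        using yz by (intro integral_diff[symmetric] \<rho>_integrable) auto
      also have "norm \<dots> \<le> (C * norm (y - z)) * (T - 0)"
        using T yz C by (intro integral_bound continuous_on_diff continuous_on_subset[OF \<rho>_along_continuous]) auto
      finally show ?thesis by (simp add: mult_ac)
    qed
    then show ?thesis
      using C T by (intro lipschitz_on_continuous_on[of "C * T"] lipschitz_onI) (auto simp: dist_norm)
  qed
  have "visiting M \<delta> q = (Q \<inter> (\<lambda>z. \<rho> (\<Phi> z q)) -` {\<delta>..}) \<inter> (\<Inter>T\<in>{0..}. Q \<inter> (\<lambda>z. integral {0..T} (\<lambda>s. \<rho> (\<Phi> z s))) -` {..M})"
    unfolding visiting_def by auto
  also have "closed \<dots>"
    using q by (intro closed_Int closed_INT ballI continuous_closed_preimage c1 c2 compact_imp_closed[OF Q]) auto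
  finally have "closed (visiting M \<delta> q)" .
  moreover have "visiting M \<delta> q = Q \<inter> visiting M \<delta> q" by (auto simp: visiting_def)
  ultimately show ?thesis using Q by (metis compact_Int_closed)
qed

text \<open>A visit at time k means \<rho> \<ge> \<delta> at time k + q, which contributes at least
  a fixed amount \<beta> to the integral over [k + q, k + q + 1]. For distinct integers k these
  intervals overlap at most in an endpoint, and the total is at most M.\<close>

lemma visits_bounded:
  assumes \<delta>: "0 < \<delta>" and q: "0 \<le> q"
  obtains J where "J \<ge> 0"
    "\<And>z S. z \<in> visiting M \<delta> q \<Longrightarrow> finite S \<Longrightarrow> (\<And>k. k \<in> S \<Longrightarrow> \<Phi> z (real k) \<in> visiting M \<delta> q) \<Longrightarrow> real (card S) \<le> J"
proof -
  obtain \<Lambda> where \<Lambda>: "\<Lambda> > 0" "\<And>z s t. z \<in> Q \<Longrightarrow> 0 \<le> s \<Longrightarrow> s \<le> t \<Longrightarrow> \<bar>\<rho> (\<Phi> z t) - \<rho> (\<Phi> z s)\<bar> \<le> \<Lambda> * (t - s)"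
    by (rule \<rho>_along_lipschitz) blast
  \<comment> \<open>Over a time \<delta> / (2 \<Lambda>) the value of \<rho> loses at most
    \<delta>/2; the cap 1 keeps the interval inside the unit interval that belongs to the
    visit.\<close>
  define \<tau> where "\<tau> = min 1 (\<delta> / (2 * \<Lambda>))"
  have \<tau>: "\<tau> > 0" "\<tau> \<le> 1" using \<delta> \<Lambda> by (auto simp: \<tau>_def)
  define \<beta> where "\<beta> = \<tau> * (\<delta> / 2)"
  have \<beta>: "\<beta> > 0" using \<tau> \<delta> by (simp add: \<beta>_def)
  have unit: "\<beta> \<le> integral {a..a+1} (\<lambda>s. \<rho> (\<Phi> z s))" if z: "z \<in> Q" and a: "0 \<le> a" "\<delta> \<le> \<rho> (\<Phi> z a)" for z a
  proof -
    have low: "\<delta> / 2 \<le> \<rho> (\<Phi> z s)" if s: "s \<in> {a..a+\<tau>}" for s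
    proof -
      have "\<Lambda> * (s - a) \<le> \<Lambda> * (\<delta> / (2 * \<Lambda>))" using s \<Lambda> by (intro mult_left_mono) (auto simp: \<tau>_def)
      also have "\<dots> = \<delta> / 2" using \<Lambda> by simp
      finally show ?thesis using \<Lambda>(2)[OF z a(1), of s] s a(2) by auto
    qed
    have "integral {a..a+\<tau>} (\<lambda>_. \<delta> / 2) \<le> integral {a..a+\<tau>} (\<lambda>s. \<rho> (\<Phi> z s))"
      using a z low by (intro integral_le \<rho>_integrable) auto
    also have "\<dots> \<le> integral {a..a+1} (\<lambda>s. \<rho> (\<Phi> z s))"
      using \<tau> a z by (intro integral_subset_le \<rho>_integrable) (auto intro: \<rho>_nonneg)
    finally show ?thesis using \<tau> by (simp add: \<beta>_def)
  qed
  show ?thesis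
  \<comment> \<open>The absolute value keeps the bound nonnegative when M < 0, in which case the set
    is empty.\<close>
  proof (rule that[of "\<bar>M\<bar> / \<beta>"])
    show "\<bar>M\<bar> / \<beta> \<ge> 0" using \<beta> by simp
    fix z S assume z: "z \<in> visiting M \<delta> q" and S: "finite (S::nat set)" "\<And>k. k \<in> S \<Longrightarrow> \<Phi> z (real k) \<in> visiting M \<delta> q"
    have zQ: "z \<in> Q" using z by (simp add: visiting_def)
    have partial: "(\<Sum>k<n. if k \<in> S then \<beta> else 0) \<le> integral {0..real n + q} (\<lambda>s. \<rho> (\<Phi> z s))" for n
    proof (induction n)
      case 0
      then show ?case by (auto intro!: integral_nonneg \<rho>_integrable zQ \<rho>_nonneg)
    next
      case (Suc n)
      have eq: "integral {0..real (Suc n) + q} (\<lambda>s. \<rho> (\<Phi> z s))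
          = integral {0..real n + q} (\<lambda>s. \<rho> (\<Phi> z s)) + integral {real n + q..(real n + q) + 1} (\<lambda>s. \<rho> (\<Phi> z s))"
        using q zQ by (subst Henstock_Kurzweil_Integration.integral_combine) (auto intro!: \<rho>_integrable simp: algebra_simps)
      have "(if n \<in> S then \<beta> else 0) \<le> integral {real n + q..(real n + q) + 1} (\<lambda>s. \<rho> (\<Phi> z s))"
      proof (cases "n \<in> S")
        case True
        have "\<delta> \<le> \<rho> (\<Phi> (\<Phi> z (real n)) q)" using S(2)[OF True] by (simp add: visiting_def)
        then have "\<delta> \<le> \<rho> (\<Phi> z (real n + q))" using semigroup[OF zQ, of "real n" q] q by simp
        then show ?thesis using unit[OF zQ, of "real n + q"] q True by simp
      next
        case False
        then show ?thesis using q by (auto intro!: integral_nonneg \<rho>_integrable zQ \<rho>_nonneg)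
      qed
      then show ?case unfolding eq using Suc.IH by simp
    qed
    obtain n where n: "S \<subseteq> {..<n}" using S(1) finite_nat_iff_bounded by auto
    have "real (card S) * \<beta> = (\<Sum>k<n. if k \<in> S then \<beta> else 0)"
      using n by (subst sum.inter_restrict[symmetric]) (auto simp: Int_absorb1)
    also have "\<dots> \<le> integral {0..real n + q} (\<lambda>s. \<rho> (\<Phi> z s))"
      by (rule partial)
    also have "\<dots> \<le> M" using z q by (auto simp: visiting_def)
    finally have "real (card S) * \<beta> \<le> \<bar>M\<bar>" by simp
    then show "real (card S) \<le> \<bar>M\<bar> / \<beta>" using \<beta> by (simp add: pos_le_divide_eq)
  qed
qed

text \<open>A point lies in few of the images \<open>\<Phi>\<^sub>k(B)\<close>: pulled back by the injective flow to the latest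
  of these times, it visits \<open>B\<close> at all the corresponding later times. So the volumes of the
  images have a bounded sum, although each is at least a fixed fraction of that of \<open>B\<close>.\<close>

lemma visiting_null:
  assumes \<delta>: "0 < \<delta>" and q: "0 \<le> q" and c: "0 \<le> c"
    and vol: "\<And>K T. compact K \<Longrightarrow> K \<subseteq> Q \<Longrightarrow> 0 \<le> T \<Longrightarrow>
        (\<And>z. z \<in> K \<Longrightarrow> integral {0..T} (\<lambda>s. \<rho> (\<Phi> z s)) \<le> M) \<Longrightarrow>
        emeasure lborel K \<le> ennreal c * emeasure lborel ((\<lambda>z. \<Phi> z T) ` K)"
  shows "visiting M \<delta> q \<in> null_sets lborel"
proof -
  define B where "B = visiting M \<delta> q"
  have B: "compact B" unfolding B_def by (rule compact_visiting[OF q])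
  have BQ: "B \<subseteq> Q" by (auto simp: B_def visiting_def)
  obtain J where J: "J \<ge> 0"
    "\<And>z S. z \<in> B \<Longrightarrow> finite S \<Longrightarrow> (\<And>k. k \<in> S \<Longrightarrow> \<Phi> z (real k) \<in> B) \<Longrightarrow> real (card S) \<le> J"
    using visits_bounded[OF \<delta> q, of M] unfolding B_def by metis
  define I where "I = (\<lambda>k. (\<lambda>z. \<Phi> z (real k)) ` B)"
  have I: "compact (I k)" for k
    unfolding I_def by (rule compact_flow_image[OF F _ B, where R=R]) (use BQ in \<open>auto intro!: \<Phi>0 \<Phi> R stay\<close>)
  have count: "real (card {k\<in>{..<n}. p \<in> I k}) \<le> J" for n p
  proof (cases "{k\<in>{..<n}. p \<in> I k} = {}")
    case True
    show ?thesis unfolding True using J by simp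
  next
    case False
    define S where "S = {k\<in>{..<n}. p \<in> I k}"
    have S: "finite S" "S \<noteq> {}" using False by (auto simp: S_def)
    define m where "m = Max S"
    have m: "m \<in> S" "\<And>k. k \<in> S \<Longrightarrow> k \<le> m" using S by (auto simp: m_def)
    obtain z where z: "z \<in> B" "p = \<Phi> z (real m)" using m(1) by (auto simp: S_def I_def)
    have "real (card ((\<lambda>k. m - k) ` S)) \<le> J"
    proof (rule J(2)[OF z(1)])
      fix l assume "l \<in> (\<lambda>k. m - k) ` S"
      then obtain k where k: "k \<in> S" "l = m - k" by auto
      obtain y where y: "y \<in> B" "p = \<Phi> y (real k)" using k(1) by (auto simp: S_def I_def)
      have "real l + real k = real m" using k m(2)[OF k(1)] by simp
      then have e: "\<Phi> (\<Phi> z (real l)) (real k) = \<Phi> y (real k)"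
        using semigroup[of z "real l" "real k"] z y BQ by auto
      have "\<Phi> z (real l) \<in> Q" using z BQ by (intro stay) auto
      then have "\<Phi> z (real l) = y"
        using y BQ by (intro injective[OF _ _ _ e]) auto
      then show "\<Phi> z (real l) \<in> B" using y by simp
    qed (use S in auto)
    moreover have "inj_on (\<lambda>k. m - k) S"
      using m(2) by (intro inj_onI) (metis diff_diff_cancel)
    ultimately show ?thesis by (simp add: card_image S_def)
  qed
  \<comment> \<open>Summing the volume bounds over the first n images and exchanging sum and
    integral gives a bound independent of n, so the volume of \<open>B\<close> must vanish.\<close>
  have bound: "of_nat n * emeasure lborel B \<le> ennreal c * (ennreal J * emeasure lborel Q)" for n
  proof -
    have "of_nat n * emeasure lborel B = (\<Sum>k<n. emeasure lborel B)" by simp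
    also have "\<dots> \<le> (\<Sum>k<n. ennreal c * emeasure lborel (I k))"
      unfolding I_def by (intro sum_mono vol B BQ) (auto simp: B_def visiting_def)
    also have "\<dots> = ennreal c * (\<Sum>k<n. emeasure lborel (I k))" by (simp add: sum_distrib_left)
    also have "(\<Sum>k<n. emeasure lborel (I k)) = (\<Sum>k<n. \<integral>\<^sup>+p. indicator (I k) p \<partial>lborel)"
      using borel_compact[OF I] by simp
    also have "\<dots> = (\<integral>\<^sup>+p. (\<Sum>k<n. indicator (I k) p) \<partial>lborel)"
      using borel_compact[OF I] by (intro nn_integral_sum[symmetric]) auto
    also have "\<dots> \<le> (\<integral>\<^sup>+p. ennreal J * indicator Q p \<partial>lborel)"
    proof (rule nn_integral_mono)
      fix p
      show "(\<Sum>k<n. indicator (I k) p) \<le> ennreal J * indicator Q p"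
      proof (cases "p \<in> Q")
        case True
        have "(\<Sum>k<n. indicator (I k) p) = (of_nat (card {k\<in>{..<n}. p \<in> I k}) :: ennreal)"
          by (simp add: indicator_def sum.If_cases Int_def)
        also have "\<dots> = ennreal (real (card {k\<in>{..<n}. p \<in> I k}))" by (simp add: ennreal_of_nat_eq_real_of_nat)
        also have "\<dots> \<le> ennreal J" using count by (intro ennreal_leI)
        finally show ?thesis using True by simp
      next
        case False
        then have "p \<notin> I k" for k using BQ stay by (auto simp: I_def)
        then show ?thesis by simp
      qed
    qed
    also have "\<dots> = ennreal J * emeasure lborel Q"
      using borel_compact[OF Q] by (simp add: nn_integral_cmult_indicator)
    finally show ?thesis by (simp add: mult_left_mono)
  qed
  have "emeasure lborel Q < \<infinity>" using emeasure_compact_finite[OF Q] by simp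
  then have "ennreal c * (ennreal J * emeasure lborel Q) < \<infinity>"
    by (simp add: ennreal_mult_less_top)
  then obtain K where K: "K \<ge> 0" "ennreal c * (ennreal J * emeasure lborel Q) = ennreal K"
    by (cases "ennreal c * (ennreal J * emeasure lborel Q)") auto
  have "emeasure lborel B < \<infinity>" using emeasure_compact_finite[OF B] by simp
  then obtain b where b: "b \<ge> 0" "emeasure lborel B = ennreal b"
    by (cases "emeasure lborel B") auto
  have nb: "real n * b \<le> K" for n
    using bound[of n] K b by (simp add: ennreal_of_nat_eq_real_of_nat ennreal_mult[symmetric])
  have "b = 0"
  proof (rule ccontr)
    assume "b \<noteq> 0"
    then have "b > 0" using b by simp
    obtain n :: nat where "K / b < real n" using reals_Archimedean2 by blast
    then show False using nb[of n] \<open>b > 0\<close> by (simp add: pos_divide_less_eq)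
  qed
  then show ?thesis using b borel_compact[OF B] by (auto simp: null_sets_def B_def)
qed

end

section \<open>The particle system\<close>

lemma Ck_1_llip:
  fixes f :: "'a::euclidean_space \<Rightarrow> real"
  assumes "Ck 1 f"
  shows "llip f"
proof (rule llipI)
  fix R :: real
  have d: "f differentiable (at x)" and c: "\<And>b. b \<in> Basis \<Longrightarrow> continuous_on UNIV (\<lambda>x. frechet_derivative f (at x) b)" for x
    using assms by auto
  have deriv: "(f has_derivative frechet_derivative f (at x)) (at x)" for x
    using d frechet_derivative_works by blast
  have "\<forall>b\<in>Basis. \<exists>C\<ge>0. \<forall>x\<in>cball 0 R. \<bar>frechet_derivative f (at x) b\<bar> \<le> C"
  proof
    fix b :: 'a assume "b \<in> Basis"
    then have "compact ((\<lambda>x. frechet_derivative f (at x) b) ` cball 0 R)"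
      by (intro compact_continuous_image continuous_on_subset[OF c]) auto
    then obtain C where "C > 0" "\<And>x. x \<in> cball 0 R \<Longrightarrow> \<bar>frechet_derivative f (at x) b\<bar> \<le> C"
      using compact_imp_bounded bounded_pos by (metis (no_types, lifting) image_eqI real_norm_def)
    then show "\<exists>C\<ge>0. \<forall>x\<in>cball 0 R. \<bar>frechet_derivative f (at x) b\<bar> \<le> C" by (intro exI[of _ C]) auto
  qed
  then obtain C0 where C0: "\<And>b. b \<in> Basis \<Longrightarrow> C0 b \<ge> 0"
    "\<And>b x. b \<in> Basis \<Longrightarrow> x \<in> cball 0 R \<Longrightarrow> \<bar>frechet_derivative f (at x) b\<bar> \<le> C0 b" by metis
  define C where "C = (\<Sum>b\<in>Basis. C0 b)"
  have C: "C \<ge> 0" unfolding C_def using C0 by (intro sum_nonneg) auto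
  have le: "C0 b \<le> C" if "b \<in> Basis" for b unfolding C_def using that C0 by (intro member_le_sum) auto
  show "\<exists>L\<ge>0. \<forall>x y. norm x \<le> R \<longrightarrow> norm y \<le> R \<longrightarrow> norm (f x - f y) \<le> L * norm (x - y)"
  proof (intro exI[of _ "DIM('a) * C"] conjI allI impI)
    fix x y :: 'a assume xy: "norm x \<le> R" "norm y \<le> R"
    show "norm (f x - f y) \<le> DIM('a) * C * norm (x - y)"
    proof (rule differentiable_bound[where S="cball 0 R" and f'="\<lambda>x. frechet_derivative f (at x)"])
      fix z :: 'a assume z: "z \<in> cball 0 R"
      show "(f has_derivative frechet_derivative f (at z)) (at z within cball 0 R)"
        using deriv by (rule has_derivative_at_withinI)
      show "onorm (frechet_derivative f (at z)) \<le> DIM('a) * C"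
      proof (rule onorm_le)
        fix h :: 'a
        interpret linear "frechet_derivative f (at z)" by (rule has_derivative_linear[OF deriv])
        have "frechet_derivative f (at z) h = frechet_derivative f (at z) (\<Sum>b\<in>Basis. (h \<bullet> b) *\<^sub>R b)"
          by (simp add: euclidean_representation)
        also have "\<dots> = (\<Sum>b\<in>Basis. (h \<bullet> b) * frechet_derivative f (at z) b)"
          by (simp add: sum scale)
        finally show "norm (frechet_derivative f (at z) h) \<le> DIM('a) * C * norm h"
          using abs_sum_Basis_le[of "\<lambda>b. frechet_derivative f (at z) b" C h] C0(2)[OF _ z] le by force
      qed
    qed (use xy in auto)
  qed (use C in auto)
qed

section \<open>Reformulation as a first-order equation in phase space, and the energy\<close>

lemma has_vector_derivative_componentwise:
  fixes x :: "real \<Rightarrow> ('a::euclidean_space)^'N"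
  shows "(x has_vector_derivative d) (at t within S) \<longleftrightarrow>
    (\<forall>i. ((\<lambda>s. x s $ i) has_vector_derivative d $ i) (at t within S))"
proof
  assume "(x has_vector_derivative d) (at t within S)"
  then show "\<forall>i. ((\<lambda>s. x s $ i) has_vector_derivative d $ i) (at t within S)"
    using bounded_linear.has_vector_derivative[OF bounded_linear_vec_nth] by blast
next
  assume *: "\<forall>i. ((\<lambda>s. x s $ i) has_vector_derivative d $ i) (at t within S)"
  have "((\<lambda>s. \<Sum>i\<in>UNIV. axis i (x s $ i)) has_vector_derivative (\<Sum>i\<in>UNIV. axis i (d $ i))) (at t within S)"
    using * by (intro has_vector_derivative_sum bounded_linear.has_vector_derivative[OF bounded_linear_axis]) auto
  moreover have "(\<Sum>i\<in>UNIV. axis i (y $ i)) = y" for y :: "'a^'N"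
    by (simp add: vec_eq_iff axis_def)
  ultimately show "(x has_vector_derivative d) (at t within S)" by simp
qed

definition alignment :: "(real^'n \<Rightarrow> real) \<Rightarrow> (real^'n)^'N::finite \<Rightarrow> (real^'n)^'N::finite \<Rightarrow> (real^'n)^'N::finite" where
  "alignment \<phi> x v = (\<chi> i. (1 / real CARD('N)) *\<^sub>R (\<Sum>j\<in>UNIV. \<phi> (x $ i - x $ j) *\<^sub>R (v $ j - v $ i)))"

text \<open>The integrand of \<open>total_communication\<close> as a function of the positions, in
  the role of \<rho>. The pairs are ordered.\<close>

definition interaction :: "(real^'n \<Rightarrow> real) \<Rightarrow> (real^'n)^'N::finite \<Rightarrow> real" where
  "interaction \<phi> x = (\<Sum>(i, j)\<in>{(i, j). i \<noteq> j}. \<phi> (x $ i - x $ j))"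

definition force :: "(real^'n \<Rightarrow> real^'n) \<Rightarrow> (real^'n)^'N::finite \<Rightarrow> (real^'n)^'N::finite" where
  "force G x = (\<chi> i. - G (x $ i))"

definition phase_field :: "(real^'n \<Rightarrow> real) \<Rightarrow> (real^'n \<Rightarrow> real^'n) \<Rightarrow> ('n, 'N::finite) phase \<Rightarrow> ('n, 'N::finite) phase" where
  "phase_field \<phi> G z = (snd z, alignment \<phi> (fst z) (snd z) + force G (fst z))"

definition energy :: "(real^'n \<Rightarrow> real) \<Rightarrow> ('n, 'N::finite) phase \<Rightarrow> real" where
  "energy U z = (\<Sum>i\<in>UNIV. (snd z $ i \<bullet> snd z $ i) / 2 + U (fst z $ i))"

definition energy' :: "(real^'n \<Rightarrow> real^'n) \<Rightarrow> ('n, 'N::finite) phase \<Rightarrow> ('n, 'N::finite) phase \<Rightarrow> real" where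
  "energy' G z h = (\<Sum>i\<in>UNIV. snd h $ i \<bullet> snd z $ i + fst h $ i \<bullet> G (fst z $ i))"

lemma is_solution_iff:
  fixes z :: "real \<Rightarrow> ('n::finite, 'N::finite) phase"
  shows "is_solution \<phi> U z\<^sub>0 z \<longleftrightarrow>
    z 0 = z\<^sub>0 \<and> (\<forall>t\<ge>0. (z has_vector_derivative phase_field \<phi> (grad U) (z t)) (at t within {0..}))"
proof -
  have "(z has_vector_derivative phase_field \<phi> (grad U) (z t)) (at t within {0..}) \<longleftrightarrow>
     ((\<lambda>s. fst (z s)) has_vector_derivative snd (z t)) (at t within {0..}) \<and>
     ((\<lambda>s. snd (z s)) has_vector_derivative alignment \<phi> (fst (z t)) (snd (z t)) + force (grad U) (fst (z t))) (at t within {0..})"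
    for t
  proof
    assume "(z has_vector_derivative phase_field \<phi> (grad U) (z t)) (at t within {0..})"
    from bounded_linear.has_vector_derivative[OF bounded_linear_fst this]
      bounded_linear.has_vector_derivative[OF bounded_linear_snd this]
    show "((\<lambda>s. fst (z s)) has_vector_derivative snd (z t)) (at t within {0..}) \<and>
     ((\<lambda>s. snd (z s)) has_vector_derivative alignment \<phi> (fst (z t)) (snd (z t)) + force (grad U) (fst (z t))) (at t within {0..})"
      by (simp add: phase_field_def)
  next
    assume "((\<lambda>s. fst (z s)) has_vector_derivative snd (z t)) (at t within {0..}) \<and>
     ((\<lambda>s. snd (z s)) has_vector_derivative alignment \<phi> (fst (z t)) (snd (z t)) + force (grad U) (fst (z t))) (at t within {0..})"
    then have "((\<lambda>s. (fst (z s), snd (z s))) has_vector_derivative phase_field \<phi> (grad U) (z t)) (at t within {0..})"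
      unfolding phase_field_def by (intro has_vector_derivative_Pair) auto
    then show "(z has_vector_derivative phase_field \<phi> (grad U) (z t)) (at t within {0..})" by simp
  qed
  then show ?thesis
    unfolding is_solution_def
    by (auto simp: has_vector_derivative_componentwise alignment_def force_def)
qed

lemma energy_has_derivative:
  assumes "\<And>x. GDERIV U x :> G x"
  shows "(energy U has_derivative energy' G z) (at z)"
proof -
  have p: "bounded_linear (\<lambda>z. fst z $ i)" "bounded_linear (\<lambda>z. snd z $ i)" for i
    by (auto intro!: bounded_linear_compose[OF bounded_linear_vec_nth] bounded_linear_fst bounded_linear_snd)
  have 1: "((\<lambda>z. U (fst z $ i)) has_derivative (\<lambda>h. fst h $ i \<bullet> G (fst z $ i))) (at z)" for i
    using has_derivative_compose[OF bounded_linear_imp_has_derivative[OF p(1)[of i]], of U "\<lambda>h. h \<bullet> G (fst z $ i)" z UNIV]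
      assms[of "fst z $ i"] by (simp add: gderiv_def)
  have 2: "((\<lambda>z. (snd z $ i \<bullet> snd z $ i) / 2) has_derivative (\<lambda>h. snd h $ i \<bullet> snd z $ i)) (at z)" for i
    using bounded_linear_imp_has_derivative[OF p(2)[of i], of "at z"]
    by (auto intro!: derivative_eq_intros simp: inner_commute)
  show ?thesis
    unfolding energy_def energy'_def
    by (intro has_derivative_sum has_derivative_add 1 2)
qed

lemma strictly_local_kernelD:
  fixes \<phi> :: "'a::euclidean_space \<Rightarrow> real"
  assumes "strictly_local_kernel r\<^sub>0 \<phi>"
  shows "llip \<phi>" "0 \<le> \<phi> x" "\<phi> x \<le> \<phi> 0" "\<phi> (- x) = \<phi> x" "norm x < r\<^sub>0 \<Longrightarrow> 0 < \<phi> x"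
proof -
  show "llip \<phi>" using assms by (intro Ck_1_llip) (auto simp: strictly_local_kernel_def)
  show "\<phi> (- x) = \<phi> x"
    using assms unfolding strictly_local_kernel_def by (intro antisym) auto
qed (use assms in \<open>auto simp: strictly_local_kernel_def\<close>)

text \<open>Transport and potential force cancel. In the remaining alignment term the roles of i and
  j are exchanged, which is allowed as \<phi> is even; averaging the two forms leaves minus a sum of
  \<phi> times squared velocity differences.\<close>

lemma energy'_phase_field_nonpos:
  fixes z :: "('n::finite, 'N::finite) phase"
  assumes \<phi>: "\<And>x. 0 \<le> \<phi> x" "\<And>x. \<phi> (- x) = \<phi> x"
  shows "energy' G z (phase_field \<phi> G z) \<le> 0"
proof -
  define x v where "x = fst z" and "v = snd z"
  have sym: "\<phi> (x $ j - x $ i) = \<phi> (x $ i - x $ j)" for i j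
    using \<phi>(2)[of "x $ i - x $ j"] by simp
  define s where "s = (\<Sum>i\<in>UNIV. \<Sum>j\<in>UNIV. \<phi> (x $ i - x $ j) * ((v $ j - v $ i) \<bullet> v $ i))"
  have "s = (\<Sum>i\<in>UNIV. \<Sum>j\<in>UNIV. \<phi> (x $ i - x $ j) * ((v $ i - v $ j) \<bullet> v $ j))"
    unfolding s_def by (subst sum.swap) (simp add: sym)
  then have "2 * s = (\<Sum>i\<in>UNIV. \<Sum>j\<in>UNIV. \<phi> (x $ i - x $ j) * ((v $ j - v $ i) \<bullet> v $ i))
      + (\<Sum>i\<in>UNIV. \<Sum>j\<in>UNIV. \<phi> (x $ i - x $ j) * ((v $ i - v $ j) \<bullet> v $ j))"
    by (simp add: s_def)
  also have "\<dots> = (\<Sum>i\<in>UNIV. \<Sum>j\<in>UNIV. - (\<phi> (x $ i - x $ j) * ((v $ i - v $ j) \<bullet> (v $ i - v $ j))))"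
    by (simp add: sum.distrib[symmetric] algebra_simps inner_diff_left inner_diff_right)
  also have "\<dots> \<le> 0" by (intro sum_nonpos) (auto intro: \<phi> mult_nonneg_nonneg)
  finally have s: "s \<le> 0" by simp
  have "energy' G z (phase_field \<phi> G z) = (\<Sum>i\<in>UNIV. alignment \<phi> x v $ i \<bullet> v $ i)"
    by (simp add: energy'_def phase_field_def force_def x_def v_def inner_add_left inner_diff_left inner_diff_right inner_commute)
  also have "\<dots> = (1 / real CARD('N)) * s"
    by (simp add: alignment_def s_def inner_sum_left sum_divide_distrib)
  also have "\<dots> \<le> 0" using s by (simp add: divide_nonpos_pos)
  finally show ?thesis .
qed

lemma linear_alignment:
  fixes x :: "(real^'n::finite)^'N::finite"
  shows "linear (alignment \<phi> x)"
proof (rule linearI)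
  fix v w :: "(real^'n)^'N"
  have "(\<Sum>j\<in>UNIV. \<phi> (x $ i - x $ j) *\<^sub>R ((v + w) $ j - (v + w) $ i))
      = (\<Sum>j\<in>UNIV. \<phi> (x $ i - x $ j) *\<^sub>R (v $ j - v $ i)) + (\<Sum>j\<in>UNIV. \<phi> (x $ i - x $ j) *\<^sub>R (w $ j - w $ i))" for i
    unfolding sum.distrib[symmetric] by (intro sum.cong) (simp_all add: add_diff_add scaleR_add_right)
  then show "alignment \<phi> x (v + w) = alignment \<phi> x v + alignment \<phi> x w"
    unfolding alignment_def vec_eq_iff by (simp only: vec_lambda_beta plus_vec_def scaleR_add_right) (simp add: add_divide_distrib)
next
  fix c :: real and v :: "(real^'n)^'N"
  have "(\<Sum>j\<in>UNIV. \<phi> (x $ i - x $ j) *\<^sub>R ((c *\<^sub>R v) $ j - (c *\<^sub>R v) $ i))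
      = c *\<^sub>R (\<Sum>j\<in>UNIV. \<phi> (x $ i - x $ j) *\<^sub>R (v $ j - v $ i))" for i
    unfolding scaleR_sum_right by (intro sum.cong) (auto simp: algebra_simps)
  then show "alignment \<phi> x (c *\<^sub>R v) = c *\<^sub>R alignment \<phi> x v"
    unfolding alignment_def by (simp add: vec_eq_iff)
qed

lemma norm_le_sum_components: "norm (x :: ('a::real_normed_vector)^'N) \<le> (\<Sum>i\<in>UNIV. norm (x $ i))"
  unfolding norm_vec_def by (rule L2_set_le_sum) simp

text \<open>The term j = i vanishes, so only pairs of distinct agents contribute and
  \<open>interaction\<close> suffices as a bound. The constant 2 comes from
  \<open>norm (v $ j - v $ i) \<le> 2 * norm v\<close>, and 1/N is estimated by 1.\<close>

lemma norm_alignment_le: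
  assumes \<phi>: "\<And>x. 0 \<le> \<phi> x"
  shows "norm (alignment \<phi> x v) \<le> 2 * interaction \<phi> x * norm (v :: (real^'n::finite)^'N::finite)"
proof -
  have N: "1 / real CARD('N) \<le> 1" by (simp add: divide_le_eq_1 Suc_le_eq)
  have "norm (alignment \<phi> x v $ i) \<le> (\<Sum>j\<in>UNIV. if i \<noteq> j then \<phi> (x $ i - x $ j) * (2 * norm v) else 0)" for i
  proof -
    have "norm (alignment \<phi> x v $ i) = (1 / real CARD('N)) * norm (\<Sum>j\<in>UNIV. \<phi> (x $ i - x $ j) *\<^sub>R (v $ j - v $ i))"
      by (simp add: alignment_def)
    also have "\<dots> \<le> 1 * norm (\<Sum>j\<in>UNIV. \<phi> (x $ i - x $ j) *\<^sub>R (v $ j - v $ i))"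
      by (rule mult_right_mono[OF N]) simp
    also have "\<dots> \<le> (\<Sum>j\<in>UNIV. norm (\<phi> (x $ i - x $ j) *\<^sub>R (v $ j - v $ i)))"
      unfolding mult_1 by (rule norm_sum)
    also have "\<dots> \<le> (\<Sum>j\<in>UNIV. if i \<noteq> j then \<phi> (x $ i - x $ j) * (2 * norm v) else 0)"
    proof (rule sum_mono)
      fix j
      have "norm (v $ j - v $ i) \<le> 2 * norm v"
        using norm_triangle_ineq4[of "v $ j" "v $ i"] Finite_Cartesian_Product.norm_nth_le[of v j] Finite_Cartesian_Product.norm_nth_le[of v i] by linarith
      then show "norm (\<phi> (x $ i - x $ j) *\<^sub>R (v $ j - v $ i)) \<le> (if i \<noteq> j then \<phi> (x $ i - x $ j) * (2 * norm v) else 0)"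
        using \<phi>[of "x $ i - x $ j"] by (auto intro!: mult_left_mono)
    qed
    finally show ?thesis .
  qed
  then have "(\<Sum>i\<in>UNIV. norm (alignment \<phi> x v $ i))
      \<le> (\<Sum>i\<in>UNIV. \<Sum>j\<in>UNIV. if i \<noteq> j then \<phi> (x $ i - x $ j) * (2 * norm v) else 0)"
    by (rule sum_mono)
  also have "\<dots> = (\<Sum>(i, j)\<in>UNIV. if i \<noteq> j then \<phi> (x $ i - x $ j) * (2 * norm v) else 0)"
    by (simp add: sum.cartesian_product)
  also have "\<dots> = (\<Sum>(i, j)\<in>{(i, j). i \<noteq> j}. \<phi> (x $ i - x $ j) * (2 * norm v))"
    by (rule sum.mono_neutral_cong_right) auto
  also have "\<dots> = 2 * interaction \<phi> x * norm v"
    by (simp add: interaction_def sum_distrib_right sum_distrib_left case_prod_beta mult_ac)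
  finally show ?thesis using norm_le_sum_components[of "alignment \<phi> x v"] by simp
qed

text \<open>A continuous confining potential is bounded below, so a large contribution of one agent
  cannot be compensated by the others.\<close>

lemma bounded_energy_sublevel:
  fixes U :: "real^'n::finite \<Rightarrow> real"
  assumes U: "confining_radial_potential U"
  shows "bounded {z :: ('n, 'N::finite) phase. energy U z \<le> c}"
proof -
  have cont: "continuous_on UNIV U" using U by (simp add: confining_radial_potential_def)
  obtain u where u: "\<And>x. U x = u (norm x)" "filterlim u at_top at_top"
    using U by (auto simp: confining_radial_potential_def)
  have large: "\<exists>R>0. \<forall>x. U x \<le> a \<longrightarrow> norm x \<le> R" for a
  proof -
    obtain R where R: "\<And>r. r \<ge> R \<Longrightarrow> a + 1 \<le> u r"
      using u(2) unfolding filterlim_at_top eventually_at_top_linorder by blast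
    have "norm x \<le> max R 1" if "U x \<le> a" for x
      using R[of "norm x"] u(1)[of x] that by linarith
    then show ?thesis by (intro exI[of _ "max R 1"]) auto
  qed
  obtain R0 where R0: "R0 > 0" "\<And>x. U x \<le> 0 \<Longrightarrow> norm x \<le> R0" using large[of 0] by blast
  have "compact (U ` cball 0 R0)"
    by (intro compact_continuous_image continuous_on_subset[OF cont]) auto
  then obtain m where m: "m > 0" "\<And>x. norm x \<le> R0 \<Longrightarrow> \<bar>U x\<bar> \<le> m"
    using compact_imp_bounded[of "U ` cball 0 R0"] unfolding bounded_pos by auto
  have low: "- m \<le> U x" for x using R0(2)[of x] m(2)[of x] m(1) by linarith
  define c' where "c' = \<bar>c\<bar> + real CARD('N) * m"
  obtain R1 where R1: "R1 > 0" "\<And>x. U x \<le> c' \<Longrightarrow> norm x \<le> R1" using large[of c'] by blast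
  show ?thesis
    unfolding bounded_iff
  proof (intro exI[of _ "real CARD('N) * R1 + real CARD('N) * (2 * c' + 1)"] ballI)
    fix z :: "('n, 'N) phase" assume "z \<in> {z. energy U z \<le> c}"
    then have E: "energy U z \<le> c" by simp
    \<comment> \<open>Each agent's energy is shifted by \<open>m\<close> to be nonnegative; every
      single one is then bounded by the sum, hence by \<open>c'\<close>.\<close>
    define e where "e = (\<lambda>i. (snd z $ i \<bullet> snd z $ i) / 2 + U (fst z $ i) + m)"
    have e0: "e i \<ge> 0" for i
      using low[of "fst z $ i"] inner_ge_zero[of "snd z $ i"] unfolding e_def by linarith
    have "(\<Sum>i\<in>UNIV. e i) = energy U z + real CARD('N) * m"
      by (simp add: e_def energy_def sum.distrib)
    then have "(\<Sum>i\<in>UNIV. e i) \<le> c'" using E by (simp add: c'_def)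
    moreover have "e i \<le> (\<Sum>i\<in>UNIV. e i)" for i using e0 by (intro member_le_sum) auto
    ultimately have ei: "e i \<le> c'" for i using order_trans by blast
    have x: "norm (fst z $ i) \<le> R1" for i
    proof (rule R1)
      show "U (fst z $ i) \<le> c'"
        using ei[of i] m(1) inner_ge_zero[of "snd z $ i"] unfolding e_def by linarith
    qed
    have v: "norm (snd z $ i) \<le> 2 * c' + 1" for i
    proof -
      have "snd z $ i \<bullet> snd z $ i \<le> 2 * c'" using ei[of i] low[of "fst z $ i"] by (simp add: e_def)
      then have "(norm (snd z $ i))\<^sup>2 \<le> 2 * c'" by (simp add: power2_norm_eq_inner)
      moreover have "norm (snd z $ i) \<le> (norm (snd z $ i))\<^sup>2 + 1"
      proof -
        have "2 * norm (snd z $ i) \<le> (norm (snd z $ i))\<^sup>2 + 1"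
          using zero_le_power2[of "norm (snd z $ i) - 1"] by (simp add: power2_diff)
        then show ?thesis using norm_ge_zero[of "snd z $ i"] by linarith
      qed
      ultimately show ?thesis by linarith
    qed
    have "norm z \<le> norm (fst z) + norm (snd z)" using norm_Pair_le[of "fst z" "snd z"] by simp
    also have "norm (fst z) \<le> (\<Sum>i\<in>(UNIV::'N set). R1)"
      by (rule order_trans[OF norm_le_sum_components sum_mono]) (rule x)
    also have "norm (snd z) \<le> (\<Sum>i\<in>(UNIV::'N set). 2 * c' + 1)"
      by (rule order_trans[OF norm_le_sum_components sum_mono]) (rule v)
    finally show "norm z \<le> real CARD('N) * R1 + real CARD('N) * (2 * c' + 1)" by simp
  qed
qed

text \<open>Translates finiteness of an extended real integral over the half-line into the uniform
  bound on finite intervals that \<open>visiting\<close> asks for. The bound is a natural number so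
  that countably many sets suffice later.\<close>

lemma total_communication_finite:
  fixes z\<^sub>0 :: "('n::finite, 'N::finite) phase"
  assumes \<phi>: "\<And>x. 0 \<le> \<phi> x"
    and cont: "continuous_on {0..} (\<lambda>s. interaction \<phi> (fst (solution \<phi> U z\<^sub>0 s)))"
    and fin: "total_communication \<phi> U z\<^sub>0 \<noteq> \<infinity>"
  obtains m :: nat where
    "\<And>T. T \<ge> 0 \<Longrightarrow> integral {0..T} (\<lambda>s. interaction \<phi> (fst (solution \<phi> U z\<^sub>0 s))) \<le> real m"
proof -
  let ?g = "\<lambda>s. interaction \<phi> (fst (solution \<phi> U z\<^sub>0 s))"
  have g0: "?g s \<ge> 0" for s unfolding interaction_def using \<phi> by (auto intro: sum_nonneg)
  obtain K where K: "K \<ge> 0" "total_communication \<phi> U z\<^sub>0 = ennreal K"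
    using fin by (cases "total_communication \<phi> U z\<^sub>0") auto
  obtain m :: nat where m: "K \<le> real m" using real_arch_simple by blast
  show ?thesis
  proof (rule that[of m])
    fix T :: real assume T: "T \<ge> 0"
    have "?g integrable_on {0..T}"
      by (intro integrable_continuous_interval continuous_on_subset[OF cont]) auto
    then have "(?g has_integral integral {0..T} ?g) {0..T}" by (rule integrable_integral)
    then have "ennreal (integral {0..T} ?g) = (\<integral>\<^sup>+s. indicator {0..T} s * ?g s \<partial>lborel)"
      using nn_integral_has_integral_lebesgue[where f="?g", OF g0] by simp
    also have "\<dots> \<le> total_communication \<phi> U z\<^sub>0"
      unfolding total_communication_def interaction_def
      by (intro nn_integral_mono) (auto simp: indicator_def)
    also have "\<dots> \<le> ennreal (real m)" using K m by (simp add: ennreal_leI)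
    finally show "integral {0..T} ?g \<le> real m" by (simp add: ennreal_le_iff)
  qed
qed


section \<open>Regularity of the vector field and existence of solutions\<close>

lemma grad_eqI:
  assumes "GDERIV f x :> D"
  shows "grad f x = D"
  unfolding grad_def
proof (rule the_equality)
  show "GDERIV f x :> D" by fact
  fix D' assume "GDERIV f x :> D'"
  then have "(\<lambda>h. h \<bullet> D') = (\<lambda>h. h \<bullet> D)"
    using assms has_derivative_unique unfolding gderiv_def by blast
  then have "(D' - D) \<bullet> D' = (D' - D) \<bullet> D" by meson
  then have "(D' - D) \<bullet> (D' - D) = 0" by (simp add: inner_diff_right)
  then show "D' = D" by simp
qed

lemma llip_component: "llip (\<lambda>x. x $ i :: 'a::euclidean_space)"
  by (rule llip_bounded_linear[OF bounded_linear_vec_nth])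

lemma llip_alignment:
  assumes "llip \<phi>"
  shows "llip (\<lambda>z::('n::finite, 'N::finite) phase. alignment \<phi> (fst z) (snd z))"
proof -
  have p: "llip (\<lambda>z::('n, 'N) phase. fst z $ i)" "llip (\<lambda>z::('n, 'N) phase. snd z $ i)" for i
    using llip_compose[OF llip_component llip_bounded_linear[OF bounded_linear_fst]]
      llip_compose[OF llip_component llip_bounded_linear[OF bounded_linear_snd]] .
  show ?thesis
    unfolding alignment_def
    by (intro llip_vec llip_scaleR llip_const llip_sum llip_compose[OF assms] llip_diff p)
qed

lemma llip_interaction:
  assumes "llip \<phi>"
  shows "llip (interaction \<phi> :: (real^'n::finite)^'N::finite \<Rightarrow> real)"
  unfolding interaction_def[abs_def] case_prod_beta
  by (intro llip_sum llip_compose[OF assms] llip_diff llip_component)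

lemma llip_force:
  assumes "llip G"
  shows "llip (force G :: (real^'n::finite)^'N::finite \<Rightarrow> _)"
  unfolding force_def[abs_def]
  by (intro llip_vec llip_minus llip_compose[OF assms] llip_component)

lemma confining_gradient:
  fixes U :: "real^'n::finite \<Rightarrow> real"
  assumes U: "confining_radial_potential U"
  shows "GDERIV U x :> grad U x" "llip (grad U)"
proof -
  obtain G where G: "\<And>x. GDERIV U x :> G x" "llip G"
    using W2inf_loc_gradient[of U] U unfolding confining_radial_potential_def by metis
  have "grad U = G" using grad_eqI[OF G(1)] by auto
  then show "GDERIV U x :> grad U x" "llip (grad U)" using G by auto
qed

lemma llip_phase_field:
  assumes "llip \<phi>" "llip G"
  shows "llip (phase_field \<phi> G :: ('n::finite, 'N::finite) phase \<Rightarrow> _)"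
  unfolding phase_field_def[abs_def]
  by (intro llip_Pair llip_add llip_alignment assms(1) llip_compose[OF llip_force[OF assms(2)]]
      llip_bounded_linear bounded_linear_fst bounded_linear_snd)

text \<open>Existence justifies the choice operator in \<open>solution\<close>: the energy is a
  Lyapunov function with bounded sublevels, which rules out blow-up.\<close>

lemma is_solution_solution:
  fixes \<phi> U :: "real^'n::finite \<Rightarrow> real" and z\<^sub>0 :: "('n, 'N::finite) phase"
  assumes K: "strictly_local_kernel r\<^sub>0 \<phi>" and U: "confining_radial_potential U"
  shows "is_solution \<phi> U z\<^sub>0 (solution \<phi> U z\<^sub>0)"
proof -
  note \<phi> = strictly_local_kernelD[OF K] and G = confining_gradient[OF U]
  obtain y where "y 0 = z\<^sub>0"
    "\<And>t. t \<ge> 0 \<Longrightarrow> (y has_vector_derivative phase_field \<phi> (grad U) (y t)) (at t within {0..})"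
  proof (rule lyapunov_global_solution)
    show "llip (phase_field \<phi> (grad U) :: ('n, 'N) phase \<Rightarrow> _)" by (rule llip_phase_field[OF \<phi>(1) G(2)])
    show "(energy U has_derivative energy' (grad U) z) (at z)" for z :: "('n, 'N) phase"
      by (rule energy_has_derivative[OF G(1)])
    show "energy' (grad U) z (phase_field \<phi> (grad U) z) \<le> 0" for z :: "('n, 'N) phase"
      by (rule energy'_phase_field_nonpos) (rule \<phi>(2), rule \<phi>(4))
    show "bounded {z :: ('n, 'N) phase. energy U z \<le> a}" for a
      by (rule bounded_energy_sublevel[OF U])
  qed blast
  then have "is_solution \<phi> U z\<^sub>0 y" unfolding is_solution_iff by auto
  then show ?thesis unfolding solution_def by (rule someI[of "is_solution \<phi> U z\<^sub>0"])
qed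

text \<open>The abstract recurrence result on an energy sublevel, which is forward invariant because
  the energy does not increase and compact because the potential is confining.\<close>

lemma visiting_null_particles:
  fixes \<phi> U :: "real^'n::finite \<Rightarrow> real" and c M \<delta> q :: real
  assumes K: "strictly_local_kernel r\<^sub>0 \<phi>" and U: "confining_radial_potential U"
    and \<delta>: "0 < \<delta>" and q: "0 \<le> q"
  shows "{z :: ('n, 'N::finite) phase. energy U z \<le> c \<and> \<delta> \<le> interaction \<phi> (fst (solution \<phi> U z q)) \<and>
    (\<forall>T\<ge>0. integral {0..T} (\<lambda>s. interaction \<phi> (fst (solution \<phi> U z s))) \<le> M)} \<in> null_sets lborel"
proof -
  note \<phi> = strictly_local_kernelD[OF K] and G = confining_gradient[OF U]
  define F where "F = (phase_field \<phi> (grad U) :: ('n, 'N) phase \<Rightarrow> ('n, 'N) phase)"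
  have lF: "llip F" unfolding F_def by (rule llip_phase_field[OF \<phi>(1) G(2)])
  have H: "(energy U has_derivative energy' (grad U) z) (at z)" for z :: "('n, 'N) phase"
    by (rule energy_has_derivative[OF G(1)])
  have neg: "energy' (grad U) z (F z) \<le> 0" for z
    unfolding F_def by (rule energy'_phase_field_nonpos) (rule \<phi>(2), rule \<phi>(4))
  define \<Phi> where "\<Phi> = (solution \<phi> U :: ('n, 'N) phase \<Rightarrow> real \<Rightarrow> ('n, 'N) phase)"
  have \<Phi>0: "\<Phi> z 0 = z" and \<Phi>d: "0 \<le> t \<Longrightarrow> (\<Phi> z has_vector_derivative F (\<Phi> z t)) (at t within {0..})" for z t
    using is_solution_solution[OF K U, of z] unfolding is_solution_iff F_def \<Phi>_def by auto
  define Q where "Q = {z :: ('n, 'N) phase. energy U z \<le> c}"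
  have "closed Q"
    unfolding Q_def by (intro closed_Collect_le continuous_on_const)
      (auto intro!: continuous_at_imp_continuous_on has_derivative_continuous[OF H])
  then have Q: "compact Q"
    using bounded_energy_sublevel[OF U, of c] by (simp add: compact_eq_bounded_closed Q_def)
  have stay: "\<Phi> z t \<in> Q" if "z \<in> Q" "0 \<le> t" for z t
    using lyapunov_nonincreasing[OF \<Phi>d H neg \<open>0 \<le> t\<close>, of z] \<Phi>0[of z] that(1) by (simp add: Q_def)
  have \<rho>0: "0 \<le> interaction \<phi> x" for x :: "(real^'n)^'N"
    unfolding interaction_def by (intro sum_nonneg) (auto intro: \<phi>)
  have l\<rho>: "llip (\<lambda>z::('n, 'N) phase. interaction \<phi> (fst z))"
    by (rule llip_compose[OF llip_interaction[OF \<phi>(1)] llip_bounded_linear[OF bounded_linear_fst]])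
  interpret compact_semiflow F \<Phi> "\<lambda>z. interaction \<phi> (fst z)" Q
    by unfold_locales
       (auto intro!: lF l\<rho> \<rho>0 Q \<Phi>0 \<Phi>d stay)
  define P where "P = real (card {(i::'N, j). i \<noteq> j}) * \<phi> 0"
  have P: "interaction \<phi> x \<le> P" for x :: "(real^'n)^'N"
    unfolding interaction_def P_def by (rule sum_bounded_above) (auto intro: \<phi>)
  have "visiting M \<delta> q \<in> null_sets lborel"
  proof (rule visiting_null[OF \<delta> q])
    fix K :: "('n, 'N) phase set" and T :: real
    assume K: "compact K" "K \<subseteq> Q" "0 \<le> T" "\<And>z. z \<in> K \<Longrightarrow> integral {0..T} (\<lambda>s. interaction \<phi> (fst (\<Phi> z s))) \<le> M"
    \<comment> \<open>The first factor 2 belongs to \<open>alignment_volume_lower_bound\<close>, the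
      second is the constant of \<open>norm_alignment_le\<close>.\<close>
    show "emeasure lborel K \<le> ennreal (exp (2 * 2 * real DIM((real^'n)^'N) * M)) * emeasure lborel ((\<lambda>z. \<Phi> z T) ` K)"
    proof (rule alignment_volume_lower_bound[where A="alignment \<phi>" and f="force (grad U)" and \<rho>="interaction \<phi>" and P=P and R=R])
      show "norm (alignment \<phi> x v) \<le> 2 * interaction \<phi> x * norm v" for x v :: "(real^'n)^'N"
        by (rule norm_alignment_le[OF \<phi>(2)])
      show "(\<Phi> z has_vector_derivative (snd (\<Phi> z t), alignment \<phi> (fst (\<Phi> z t)) (snd (\<Phi> z t)) + force (grad U) (fst (\<Phi> z t)))) (at t within {0..})"
        if "0 \<le> t" for z t
        using \<Phi>d[OF that] by (simp add: F_def phase_field_def)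
      show "norm (\<Phi> z t) \<le> R" if "z \<in> K" "0 \<le> t" for z t
        using that K by (intro R stay) auto
    qed (use K in \<open>auto intro: linear_alignment \<rho>0 P llip_alignment \<phi>(1) llip_force G(2) llip_interaction \<Phi>0\<close>)
  qed simp
  then show ?thesis unfolding visiting_def unfolding Q_def \<Phi>_def by simp
qed

theorem proposition4p1:
  fixes \<phi> U :: "real^'n \<Rightarrow> real" and r\<^sub>0 :: real
  assumes "CARD('N::finite) \<ge> 2"
    and "strictly_local_kernel r\<^sub>0 \<phi>"
    and "confining_radial_potential U"
  shows "(AE z\<^sub>0 :: ('n, 'N::finite) phase in lebesgue.
            z\<^sub>0 \<notin> noninteracting_data r\<^sub>0 \<phi> U \<longrightarrow> total_communication \<phi> U z\<^sub>0 = \<infinity>) \<and>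
         (AE z\<^sub>0 :: ('n, 'N::finite) phase in lebesgue.
            (\<exists>i j. i \<noteq> j \<and> norm (fst z\<^sub>0 $ i - fst z\<^sub>0 $ j) < r\<^sub>0) \<longrightarrow>
              total_communication \<phi> U z\<^sub>0 = \<infinity>)"
proof -
  note \<phi> = strictly_local_kernelD[OF assms(2)]
  define g where "g = (\<lambda>(z :: ('n, 'N) phase) s. interaction \<phi> (fst (solution \<phi> U z s)))"
  \<comment> \<open>Countably many null sets cover the exceptional data: the energy is at most c,
    the total communication at most m, and the interaction at least 1/(k + 1) at some rational time.
    The absolute value lets q range over all rationals while the time stays nonnegative.\<close>
  define B where "B = (\<lambda>(c::nat, m::nat, k::nat, q::rat). {z :: ('n, 'N) phase. energy U z \<le> real c \<and>
      1 / real (Suc k) \<le> g z \<bar>of_rat q\<bar> \<and> (\<forall>T\<ge>0. integral {0..T} (g z) \<le> real m)})"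
  have B: "B i \<in> null_sets lborel" for i
  proof -
    obtain c m k q where i: "i = (c, m, k, q)" by (cases i)
    show ?thesis
      unfolding i B_def g_def case_prod_conv
      by (rule visiting_null_particles[OF assms(2,3)]) auto
  qed
  have sol: "is_solution \<phi> U z (solution \<phi> U z)" for z :: "('n, 'N) phase"
    by (rule is_solution_solution[OF assms(2,3)])
  have g_cont: "continuous_on {0..} (g z)" for z
  proof -
    have "continuous_on {0..} (solution \<phi> U z)"
      using sol[of z] unfolding is_solution_iff
      by (auto simp: continuous_on_eq_continuous_within intro: has_vector_derivative_continuous)
    then show ?thesis
      unfolding g_def
      by (intro continuous_on_compose2[OF llip_continuous[OF llip_interaction[OF \<phi>(1)], of UNIV]] continuous_intros) auto
  qed
  have main: "z \<in> (\<Union>i. B i)" if z: "z \<notin> noninteracting_data r\<^sub>0 \<phi> U" "total_communication \<phi> U z \<noteq> \<infinity>" for z :: "('n, 'N) phase"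
  proof -
    obtain m :: nat where m: "\<And>T. T \<ge> 0 \<Longrightarrow> integral {0..T} (g z) \<le> real m"
      using total_communication_finite[OF \<phi>(2) g_cont[of z, unfolded g_def] z(2)] unfolding g_def by metis
    obtain c :: nat where c: "energy U z \<le> real c" using real_arch_simple by blast
    obtain i j t where ij: "i \<noteq> j" "0 \<le> t" "norm (pos \<phi> U z i t - pos \<phi> U z j t) < r\<^sub>0"
      using z(1) unfolding noninteracting_data_def by (auto simp: not_le)
    have "g z t > 0"
      unfolding g_def interaction_def
      by (rule sum_pos2[of _ "(i, j)"]) (use ij \<phi> in auto)
    moreover have "((g z) \<longlongrightarrow> g z t) (at t within {0..})"
      using g_cont[of z] ij(2) by (auto simp: continuous_on)
    ultimately have "\<forall>\<^sub>F s in at t within {0..}. g z s > 0" by (rule order_tendstoD(1)[rotated])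
    then obtain d where d: "d > 0" "\<And>s. s \<ge> 0 \<Longrightarrow> s \<noteq> t \<Longrightarrow> dist s t < d \<Longrightarrow> g z s > 0"
      unfolding eventually_at by auto
    \<comment> \<open>By continuity the interaction is still positive at nearby times; the rational
      one is taken to the right of t, so that it is nonnegative even if t = 0.\<close>
    obtain q :: rat where q: "t < of_rat q" "of_rat q < t + d" using of_rat_dense[of t "t + d"] d(1) by auto
    then have q0: "\<bar>of_rat q :: real\<bar> = of_rat q" using ij(2) by (intro abs_of_nonneg) linarith
    have gq: "g z (of_rat q) > 0" 
    proof (rule d(2))
      show "(0::real) \<le> of_rat q" using q(1) ij(2) by linarith
    qed (use q in \<open>auto simp: dist_real_def\<close>)
    obtain k where "inverse (real (Suc k)) < g z (of_rat q)" using reals_Archimedean[OF gq] by blast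
    then have "1 / real (Suc k) \<le> g z \<bar>of_rat q\<bar>" unfolding q0 by (simp add: inverse_eq_divide)
    then have "z \<in> B (c, m, k, q)" using c m by (simp add: B_def)
    then show ?thesis by blast
  qed
  have "(\<Union>i. B i) \<in> null_sets lborel" by (rule null_sets_UN'[OF _ B]) auto
  then have "(\<Union>i. B i) \<in> null_sets lebesgue" by (rule null_sets_completionI)
  then have AE: "AE z\<^sub>0 :: ('n, 'N) phase in lebesgue.
      z\<^sub>0 \<notin> noninteracting_data r\<^sub>0 \<phi> U \<longrightarrow> total_communication \<phi> U z\<^sub>0 = \<infinity>"
    by (rule AE_I') (use main in auto)
  \<comment> \<open>Time 0 already violates the condition that defines
    \<open>noninteracting_data\<close>.\<close>
  have close: "z \<notin> noninteracting_data r\<^sub>0 \<phi> U"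
    if "i \<noteq> j" "norm (fst z $ i - fst z $ j) < r\<^sub>0" for z :: "('n, 'N) phase" and i j
  proof -
    have z0: "solution \<phi> U z 0 = z" using sol[of z] by (simp add: is_solution_iff)
    show ?thesis
    proof
      assume "z \<in> noninteracting_data r\<^sub>0 \<phi> U"
      then have "r\<^sub>0 \<le> norm (pos \<phi> U z i 0 - pos \<phi> U z j 0)"
        using that(1) unfolding noninteracting_data_def by auto
      then show False using that(2) z0 by simp
    qed
  qed
  have "AE z\<^sub>0 :: ('n, 'N) phase in lebesgue.
      (\<exists>i j. i \<noteq> j \<and> norm (fst z\<^sub>0 $ i - fst z\<^sub>0 $ j) < r\<^sub>0) \<longrightarrow> total_communication \<phi> U z\<^sub>0 = \<infinity>"
    using AE by eventually_elim (use close in blast)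
  with AE show ?thesis by blast
qed

end
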